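(* Let $n\in\mathbb{N}$, $n\ge 1$, $0<\alpha\le 1$, and let $\gamma_1,\dots,\gamma_n\in\mathbb{R}$. Put $s_k:=\sum_{i=1}^k\gamma_i$ for $k=1,\dots,n$, and assume that $\gamma_k\ge 0$ and $\alpha+s_k\le k$ for all $k=1,\dots,n$, that $n-1<\alpha+s_n$, and that $\gamma_k<1$ for $k=2,\dots,n$. Let $D^{\alpha,(\gamma)}_{nL_+}$ be the $n$th level fractional derivative of order $\alpha$ and type $\gamma=(\gamma_1,\dots,\gamma_n)$ on the positive real semi-axis (defined in the context). Let $f$ be a function on $(0,\infty)$ whose restriction to $[0,X]$ belongs to the space $X_{nL}([0,X])$ (defined in the context) for every $X>0$, and suppose that the Laplace transforms of $f$ and of $D^{\alpha,(\gamma)}_{nL_+}f$ exist for $\Re(s)>s_0$, with some $s_0\ge 0$. Then for $\Re(s)>s_0$ $$(\mathcal{L}\, D^{\alpha,(\gamma)}_{nL_+} f)(s)=s^\alpha(\mathcal{L} f)(s)-\sum_{k=1}^n a_k\, s^{k-s_k-1},$$ where $$a_k=\left(\prod_{i=k+1}^n\left(I^{\gamma_i}_{0+}\frac{d}{dx}\right) I^{n-\alpha-s_n}_{0+} f\right)(0),\qquad k=1,\dots,n.$$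
   Context: For $\beta\ge 0$, $I^\beta_{0+}$ is the Riemann-Liouville fractional integral on the positive semi-axis: $(I^\beta_{0+} f)(x)=\frac{1}{\Gamma(\beta)}\int_0^x (x-t)^{\beta-1}f(t)\,dt$, $x>0$, for $\beta>0$, and $I^0_{0+} f=f$. The Laplace transform is $(\mathcal{L}f)(s)=\int_0^{+\infty}f(t)e^{-st}\,dt$. Products of operators are ordered compositions with the smallest index leftmost (applied last): $\prod_{k=i}^n (I^{\gamma_k}_{0+}\frac{d}{dx}) = I^{\gamma_i}_{0+}\frac{d}{dx}\, I^{\gamma_{i+1}}_{0+}\frac{d}{dx}\cdots I^{\gamma_n}_{0+}\frac{d}{dx}$; an empty product is the identity operator. The $n$th level fractional derivative on the positive semi-axis is $$(D^{\alpha,(\gamma)}_{nL_+} f)(x)=\left(\prod_{k=1}^n \left(I^{\gamma_k}_{0+}\frac{d}{dx}\right)\right)(I^{n-\alpha-s_n}_{0+}f)(x),\quad x>0.$$ For $X>0$, $$X_{nL}([0,X])=\left\{f:\ \left(\prod_{k=i}^n \left(I^{\gamma_k}_{0+}\tfrac{d}{dx}\right)\right) I^{n-\alpha-s_n}_{0+}f\in \mathrm{AC}([0,X]),\ i=2,\dots,n+1\right\},$$ where $\mathrm{AC}([0,X])$ is the space of absolutely continuous functions on $[0,X]$; $f$ is understood to be integrable on $(0,X)$, with functions identified when equal almost everywhere, so that values at $0$ of the AC functions above are those of the continuous representative. The derivative of $h\in \mathrm{AC}([0,X])$ with $h(x)=h(0)+\int_0^x\phi(t)\,dt$, $\phi\in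 L_1(0,X)$, is $\frac{dh}{dx}:=\phi$. *)

theory Defs
  imports "HOL-Analysis.Analysis"
begin

text \<open>
  Functions on \<open>(0,X)\<close> or \<open>(0,\<infinity>)\<close> are total functions \<open>real \<Rightarrow> complex\<close>, considered up to
  equality almost everywhere; their values on \<open>{..0}\<close> play no role.
  Integrals are Lebesgue integrals (measure \<open>lebesgue\<close>).
\<close>

definition rl_integral :: "real \<Rightarrow> (real \<Rightarrow> complex) \<Rightarrow> real \<Rightarrow> complex" where
  "rl_integral \<beta> f =
     (if \<beta> = 0 then f
      else (\<lambda>x. (1 / Gamma \<beta>) *\<^sub>R (LINT t:{0..x}|lebesgue. ((x - t) powr (\<beta> - 1)) *\<^sub>R f t)))"

text \<open>
  Absolute continuity on \<open>[a,b]\<close>; \<open>P\<close> is a finite family of intervals with pairwise disjoint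
  interiors, each given by the pair of its endpoints.
\<close>

definition abs_cont_on :: "real \<Rightarrow> real \<Rightarrow> (real \<Rightarrow> complex) \<Rightarrow> bool" where
  "abs_cont_on a b h \<longleftrightarrow>
     (\<forall>\<epsilon>>0. \<exists>\<delta>>0. \<forall>P :: (real \<times> real) set.
        finite P \<longrightarrow> (\<forall>(u, v)\<in>P. a \<le> u \<and> u \<le> v \<and> v \<le> b) \<longrightarrow>
        disjoint_family_on (\<lambda>(u, v). {u<..<v}) P \<longrightarrow>
        (\<Sum>(u, v)\<in>P. v - u) < \<delta> \<longrightarrow>
        (\<Sum>(u, v)\<in>P. norm (h v - h u)) < \<epsilon>)"

text \<open>\<open>h\<close> is a continuous (indeed AC) representative on \<open>[0,X]\<close> of the a.e. class of \<open>g\<close>.\<close>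

definition ac_rep :: "real \<Rightarrow> (real \<Rightarrow> complex) \<Rightarrow> (real \<Rightarrow> complex) \<Rightarrow> bool" where
  "ac_rep X g h \<longleftrightarrow>
     abs_cont_on 0 X h \<and> (AE x in lebesgue. x \<in> {0<..<X} \<longrightarrow> g x = h x)"

definition AC_space :: "real \<Rightarrow> (real \<Rightarrow> complex) set" where
  "AC_space X = {g. \<exists>h. ac_rep X g h}"

definition ac_value_0 :: "(real \<Rightarrow> complex) \<Rightarrow> complex" where
  "ac_value_0 g = (THE c. \<exists>X>0. \<exists>h. ac_rep X g h \<and> h 0 = c)"

text \<open>
  The derivative on the interval \<open>T\<close>, which is \<open>{0..X}\<close> or the half-line \<open>{0..}\<close>; in the latter case
  the function is AC on every \<open>[0,Y]\<close>. The derivative is unique only up to null sets of \<open>T\<close>.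
\<close>

definition ac_deriv :: "real set \<Rightarrow> (real \<Rightarrow> complex) \<Rightarrow> real \<Rightarrow> complex" where
  "ac_deriv T g = (SOME \<phi>. \<forall>Y\<in>T. Y > 0 \<longrightarrow>
     set_integrable lebesgue {0..Y} \<phi> \<and>
     (\<exists>h. ac_rep Y g h \<and> (\<forall>x\<in>{0..Y}. h x = h 0 + (LINT t:{0..x}|lebesgue. \<phi> t))))"

definition op_prod :: "real set \<Rightarrow> (nat \<Rightarrow> real) \<Rightarrow> nat \<Rightarrow> nat \<Rightarrow> (real \<Rightarrow> complex) \<Rightarrow> real \<Rightarrow> complex" where
  "op_prod T \<gamma> i n = foldr (\<lambda>k G. rl_integral (\<gamma> k) \<circ> ac_deriv T \<circ> G) [i..<Suc n] id"

definition psum :: "(nat \<Rightarrow> real) \<Rightarrow> nat \<Rightarrow> real" where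
  "psum \<gamma> k = (\<Sum>i=1..k. \<gamma> i)"

definition nL_deriv :: "nat \<Rightarrow> real \<Rightarrow> (nat \<Rightarrow> real) \<Rightarrow> (real \<Rightarrow> complex) \<Rightarrow> real \<Rightarrow> complex" where
  "nL_deriv n \<alpha> \<gamma> f = op_prod {0..} \<gamma> 1 n (rl_integral (real n - \<alpha> - psum \<gamma> n) f)"

definition nL_space :: "nat \<Rightarrow> real \<Rightarrow> (nat \<Rightarrow> real) \<Rightarrow> real \<Rightarrow> (real \<Rightarrow> complex) set" where
  "nL_space n \<alpha> \<gamma> X =
     {f. set_integrable lebesgue {0..X} f \<and>
         (\<forall>i\<in>{2..n+1}. op_prod {0..X} \<gamma> i n (rl_integral (real n - \<alpha> - psum \<gamma> n) f) \<in> AC_space X)}"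

text \<open>
  The Laplace integral over \<open>(0,\<infinity>)\<close> is taken as an improper integral, which covers the absolutely
  convergent (Lebesgue) case and agrees with it there.
\<close>

definition laplace_exists :: "(real \<Rightarrow> complex) \<Rightarrow> complex \<Rightarrow> bool" where
  "laplace_exists f s \<longleftrightarrow>
     (\<forall>X>0. set_integrable lebesgue {0..X} (\<lambda>t. f t * exp (- s * of_real t))) \<and>
     (\<exists>L. ((\<lambda>X. LINT t:{0..X}|lebesgue. f t * exp (- s * of_real t)) \<longlongrightarrow> L) at_top)"

definition laplace :: "(real \<Rightarrow> complex) \<Rightarrow> complex \<Rightarrow> complex" where
  "laplace f s = Lim at_top (\<lambda>X. LINT t:{0..X}|lebesgue. f t * exp (- s * of_real t))"

end

theory Submission
  imports Defs
begin

text \<open>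
  Write \<open>g\<^sub>k\<close> for the operator product with indices \<open>k + 1, \<dots>, n\<close> applied to \<open>I\<^bsup>n - \<alpha> - s\<^sub>n\<^esup> f\<close>, and
  \<open>\<phi>\<^sub>k\<close> for the derivative of \<open>g\<^sub>k\<close>. Then \<open>g\<^sub>k = a\<^sub>k + I\<^sup>1 \<phi>\<^sub>k\<close> and \<open>g\<^bsub>k-1\<^esub> = I\<^bsup>\<gamma> k\<^esup> \<phi>\<^sub>k\<close>, so the semigroup law
  for fractional integrals gives, by induction on \<open>k\<close>, that \<open>I\<^bsup>s k\<^esup> g\<^sub>k\<close> is a sum of power functions
  with coefficients \<open>a\<^sub>j\<close> plus \<open>I\<^sup>k g\<^sub>0\<close>. For \<open>k = n\<close> this expresses \<open>I\<^bsup>n-\<alpha>\<^esup> f\<close> by \<open>I\<^sup>n\<close> of the level derivative,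
  and \<open>I\<^sup>a\<close> becomes division by \<open>s\<^sup>a\<close> under the Laplace transform. The Laplace integrals are only
  conditionally convergent, but the primitives \<open>I\<^sup>1 f\<close> and \<open>I\<^sup>1 g\<^sub>0\<close> are exponentially bounded, so after
  one more integration Fubini applies.

  The derivatives exist because an absolutely continuous function is the difference of two monotone
  absolutely continuous ones (positive variation), whose Stieltjes measures have Radon-Nikodym
  densities. All identities are between functions on the half-line up to null sets; they are
  proved for Borel representatives that vanish on the negative axis, where \<open>I\<^sup>a\<close> is a convolution.
\<close>

subsection \<open>Absolutely continuous functions are primitives\<close>

text \<open>Only \<open>f\<close> and the level derivative are assumed to have Laplace transforms;
  the intermediate functions need not have any. The rule for the transform of a derivative therefore
  cannot be applied factor by factor: all \<open>n\<close> steps are carried out before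
  transforming, and the transform is applied to one identity that contains only \<open>f\<close>,
  the level derivative and power functions. Existence of the transforms on a whole half-plane
  matters too: convergence at a real point strictly between \<open>s0\<close> and
  \<open>Re s\<close> supplies the exponential bound that is used at \<open>s\<close>. A second
  obstacle is that derivatives are selected by \<open>SOME\<close>, separately for each
  \<open>[0,X]\<close> in the function space and once for the half-line in the operator. The
  selections agree only almost everywhere, and this agreement has to be carried through every
  fractional integral. Finally, the complex powers of \<open>s\<close> are principal values. They
  are reached by expanding the exponential around a large real point and summing a binomial series,
  without analytic continuation.\<close>

text \<open>Degenerate intervals are excluded, unlike in \<open>abs_cont_on\<close>: every member
  has nonempty interior, so disjointness of interiors separates the members themselves when families
  are glued or cut.\<close>

definition interval_families :: "real \<Rightarrow> real \<Rightarrow> (real \<times> real) set set" where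
  "interval_families a b =
     {P. finite P \<and> (\<forall>(u, v)\<in>P. a \<le> u \<and> u < v \<and> v \<le> b) \<and>
         disjoint_family_on (\<lambda>(u, v). {u<..<v}) P}"

definition family_length :: "(real \<times> real) set \<Rightarrow> real" where
  "family_length P = (\<Sum>(u, v)\<in>P. v - u)"

text \<open>One \<delta> serves all \<open>a\<close> and \<open>b\<close>, so this is absolute
  continuity on the whole line; functions on \<open>[0, X]\<close> enter after being frozen outside
  that interval.\<close>

definition abs_cont :: "(real \<Rightarrow> real) \<Rightarrow> bool" where
  "abs_cont F \<longleftrightarrow>
     (\<forall>\<epsilon>>0. \<exists>\<delta>>0. \<forall>a b. \<forall>P\<in>interval_families a b.
        family_length P < \<delta> \<longrightarrow> (\<Sum>(u, v)\<in>P. \<bar>F v - F u\<bar>) < \<epsilon>)"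

text \<open>The trace of a family on \<open>[p, q]\<close>; members that collapse to a point are
  dropped to keep the family nondegenerate.\<close>

definition clamp_family :: "real \<Rightarrow> real \<Rightarrow> (real \<times> real) set \<Rightarrow> (real \<times> real) set" where
  "clamp_family p q P =
     (\<lambda>(u, v). (max p (min q u), max p (min q v))) `
       {(u, v)\<in>P. max p (min q u) < max p (min q v)}"

lemma empty_interval_families [simp]: "{} \<in> interval_families a b"
  by (simp add: interval_families_def disjoint_family_on_def)

lemma clamp_image_Ioo:
  fixes p q :: real
  shows "{max p (min q u)<..<max p (min q v)} \<subseteq> {u<..<v}"
  by (auto simp: max_def min_def split: if_splits)

lemma interval_families_disjointD:
  assumes "P \<in> interval_families a b" "x \<in> P" "y \<in> P" "x \<noteq> y"
  shows "{fst x<..<snd x} \<inter> {fst y<..<snd y} = {}"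
  using assms by (auto simp: interval_families_def disjoint_family_on_def case_prod_beta)

lemma interval_familiesD:
  assumes "P \<in> interval_families a b"
  shows "finite P" "x \<in> P \<Longrightarrow> a \<le> fst x" "x \<in> P \<Longrightarrow> fst x < snd x" "x \<in> P \<Longrightarrow> snd x \<le> b"
  using assms by (auto simp: interval_families_def case_prod_unfold)

lemma interval_familiesI:
  assumes "finite P"
    and "\<And>x. x \<in> P \<Longrightarrow> a \<le> fst x" "\<And>x. x \<in> P \<Longrightarrow> fst x < snd x" "\<And>x. x \<in> P \<Longrightarrow> snd x \<le> b"
    and "\<And>x y. x \<in> P \<Longrightarrow> y \<in> P \<Longrightarrow> x \<noteq> y \<Longrightarrow> {fst x<..<snd x} \<inter> {fst y<..<snd y} = {}"
  shows "P \<in> interval_families a b"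
  unfolding interval_families_def disjoint_family_on_def case_prod_unfold
  using assms by blast

text \<open>Two members with the same nondegenerate trace would both contain its interior and hence
  overlap.\<close>

lemma clamp_family_inj:
  assumes "P \<in> interval_families a b"
  shows "inj_on (\<lambda>(u, v). (max p (min q u), max p (min q v)))
           {(u, v)\<in>P. max p (min q u) < max p (min q v)}"
proof (rule inj_onI, rule ccontr)
  fix x y
  assume *: "x \<in> {(u, v)\<in>P. max p (min q u) < max p (min q v)}"
    "y \<in> {(u, v)\<in>P. max p (min q u) < max p (min q v)}"
    "(\<lambda>(u, v). (max p (min q u), max p (min q v))) x
      = (\<lambda>(u, v). (max p (min q u), max p (min q v))) y" "x \<noteq> y"
  obtain u v u' v' where xy: "x = (u, v)" "y = (u', v')" by (cases x, cases y) blast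
  have h: "(u, v) \<in> P" "(u', v') \<in> P" "max p (min q u) < max p (min q v)"
    "max p (min q u) = max p (min q u')" "max p (min q v) = max p (min q v')"
    "(u, v) \<noteq> (u', v')"
    using *[unfolded xy mem_Collect_eq prod.case prod.inject] by blast+
  have "{u<..<v} \<inter> {u'<..<v'} = {}"
    using interval_families_disjointD[OF assms h(1,2,6)] by simp
  moreover have "{max p (min q u)<..<max p (min q v)} \<subseteq> {u<..<v} \<inter> {u'<..<v'}"
    using clamp_image_Ioo[of p q u v] clamp_image_Ioo[of p q u' v']
    unfolding h(4,5) by blast
  moreover have "{max p (min q u)<..<max p (min q v)} \<noteq> {}"
    using h(3) by (simp only: greaterThanLessThan_empty_iff not_le not_not)
  ultimately show False by blast
qed

lemma clamp_family_in:
  assumes P: "P \<in> interval_families a b" and "p \<le> q"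
  shows "clamp_family p q P \<in> interval_families p q"
proof -
  have mem: "\<exists>w\<in>P. x = (max p (min q (fst w)), max p (min q (snd w))) \<and> fst x < snd x"
    if x: "x \<in> clamp_family p q P" for x
  proof -
    obtain u v where "(u, v) \<in> P" "max p (min q u) < max p (min q v)"
      "x = (max p (min q u), max p (min q v))"
      using x by (auto simp: clamp_family_def)
    then show ?thesis by (intro bexI[of _ "(u, v)"]) simp_all
  qed
  show ?thesis
  proof (rule interval_familiesI)
    have "{(u, v)\<in>P. max p (min q u) < max p (min q v)} \<subseteq> P" by blast
    then show "finite (clamp_family p q P)"
      unfolding clamp_family_def using interval_familiesD(1)[OF P]
      by (intro finite_imageI) (rule finite_subset)
  next
    fix x y assume xy: "x \<in> clamp_family p q P" "y \<in> clamp_family p q P" "x \<noteq> y"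
    obtain w where w: "w \<in> P" "x = (max p (min q (fst w)), max p (min q (snd w)))"
      using mem[OF xy(1)] by blast
    obtain w' where w': "w' \<in> P" "y = (max p (min q (fst w')), max p (min q (snd w')))"
      using mem[OF xy(2)] by blast
    have "w \<noteq> w'" using w w' xy(3) by blast
    then have "{fst w<..<snd w} \<inter> {fst w'<..<snd w'} = {}"
      using interval_families_disjointD[OF P w(1) w'(1)] by blast
    then show "{fst x<..<snd x} \<inter> {fst y<..<snd y} = {}"
      using clamp_image_Ioo[of p q "fst w" "snd w"] clamp_image_Ioo[of p q "fst w'" "snd w'"]
      unfolding w(2) w'(2) fst_conv snd_conv by blast
  next
    fix x assume "x \<in> clamp_family p q P"
    then show "p \<le> fst x" "fst x < snd x" "snd x \<le> q"
      using mem[of x] \<open>p \<le> q\<close> by auto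
  qed
qed

text \<open>Collapsed intervals contribute \<open>G x x = 0\<close>, so dropping them costs nothing.
  The general \<open>G\<close> covers lengths as well as signed and absolute increments.\<close>

lemma sum_clamp_family:
  fixes G :: "real \<Rightarrow> real \<Rightarrow> 'a :: comm_monoid_add"
  assumes P: "P \<in> interval_families a b" and G: "\<And>x. G x x = 0"
  shows "(\<Sum>(u, v)\<in>clamp_family p q P. G u v)
       = (\<Sum>(u, v)\<in>P. G (max p (min q u)) (max p (min q v)))"
proof -
  let ?Q = "{(u, v)\<in>P. max p (min q u) < max p (min q v)}"
  have fin: "finite P" using P by (simp add: interval_families_def)
  have "(\<Sum>(u, v)\<in>clamp_family p q P. G u v)
      = (\<Sum>(u, v)\<in>?Q. G (max p (min q u)) (max p (min q v)))"
    unfolding clamp_family_def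
    by (subst sum.reindex[OF clamp_family_inj[OF P]]) (simp add: case_prod_beta o_def)
  also have "\<dots> = (\<Sum>(u, v)\<in>P. G (max p (min q u)) (max p (min q v)))"
  proof (rule sum.mono_neutral_left[OF fin])
    show "\<forall>i\<in>P - ?Q. (case i of (u, v) \<Rightarrow> G (max p (min q u)) (max p (min q v))) = 0"
    proof
      fix i assume i: "i \<in> P - ?Q"
      then have "fst i < snd i" using P by (auto simp: interval_families_def case_prod_beta)
      then have "max p (min q (fst i)) \<le> max p (min q (snd i))"
        by (auto simp: max_def min_def)
      moreover have "\<not> max p (min q (fst i)) < max p (min q (snd i))"
        using i by (auto simp: case_prod_beta)
      ultimately have "max p (min q (fst i)) = max p (min q (snd i))" by (simp only: not_less order_antisym)
      then show "(case i of (u, v) \<Rightarrow> G (max p (min q u)) (max p (min q v))) = 0"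
        using G by (simp only: case_prod_beta)
    qed
  qed auto
  finally show ?thesis .
qed

text \<open>An interval that straddles \<open>b\<close> is cut there, and its increment telescopes
  through \<open>F b\<close>; any other interval has increment zero on one side.\<close>

lemma sum_split_family:
  fixes F :: "real \<Rightarrow> real"
  assumes P: "P \<in> interval_families a c" and "a \<le> b" "b \<le> c"
  shows "(\<Sum>(u, v)\<in>P. F v - F u) =
    (\<Sum>(u, v)\<in>clamp_family a b P. F v - F u) + (\<Sum>(u, v)\<in>clamp_family b c P. F v - F u)"
proof -
  have "F v - F u = (F (max a (min b v)) - F (max a (min b u)))
      + (F (max b (min c v)) - F (max b (min c u)))" if "(u, v) \<in> P" for u v
  proof -
    have "a \<le> u" "u < v" "v \<le> c" using P that by (auto simp: interval_families_def)
    then show ?thesis using assms(2,3) by (auto simp: max_def min_def)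
  qed
  then have "(\<Sum>(u, v)\<in>P. F v - F u) =
      (\<Sum>(u, v)\<in>P. (F (max a (min b v)) - F (max a (min b u)))
      + (F (max b (min c v)) - F (max b (min c u))))"
    by (intro sum.cong) auto
  then show ?thesis
    using sum_clamp_family[OF P, of "\<lambda>u v. F v - F u"]
    by (simp add: sum.distrib case_prod_beta)
qed

text \<open>Turns the combinatorial length into a measure, so that it can be bounded by enclosing
  the union in a set.\<close>

lemma family_length_measure:
  assumes P: "P \<in> interval_families a b"
  shows "family_length P = measure lborel (\<Union>x\<in>P. {fst x<..<snd x})"
proof -
  have "disjoint_family_on (\<lambda>x. {fst x<..<snd x}) P" "finite P"
    "\<And>x. x \<in> P \<Longrightarrow> fst x \<le> snd x"
    using P by (auto simp: interval_families_def case_prod_unfold)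
  then show ?thesis
    by (subst measure_finite_Union) (auto simp: family_length_def case_prod_unfold)
qed

lemma family_length_le:
  assumes P: "P \<in> interval_families a b" and "a \<le> b"
  shows "family_length P \<le> b - a"
proof -
  have fin: "finite P" and le: "\<And>x. x \<in> P \<Longrightarrow> a \<le> fst x \<and> snd x \<le> b"
    using P by (auto simp: interval_families_def)
  have "(\<Union>x\<in>P. {fst x<..<snd x}) \<subseteq> {a..b}"
  proof
    fix y assume "y \<in> (\<Union>x\<in>P. {fst x<..<snd x})"
    then obtain x where "x \<in> P" "fst x < y" "y < snd x" by auto
    then show "y \<in> {a..b}" using le[of x] by simp
  qed
  then have "measure lborel (\<Union>x\<in>P. {fst x<..<snd x}) \<le> measure lborel {a..b}"
    using fin by (intro measure_mono_fmeasurable) (auto simp: fmeasurable_def emeasure_lborel_Icc_eq)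
  then show ?thesis using assms by (simp add: family_length_measure[OF P])
qed

section \<open>Positive variation of an absolutely continuous function\<close>

text \<open>Families may leave gaps, so decreasing stretches can be skipped: the supremum of the
  signed sums is the positive variation.\<close>

definition pos_var :: "(real \<Rightarrow> real) \<Rightarrow> real \<Rightarrow> real \<Rightarrow> real" where
  "pos_var F a b = (SUP P\<in>interval_families a b. \<Sum>(u, v)\<in>P. F v - F u)"

text \<open>Boundedness is additive over adjacent intervals, and by absolute continuity with
  \<epsilon> = 1 it holds on short intervals around each point; bisection extends it to
  \<open>[a, b]\<close>.\<close>

lemma bdd_above_pos_var:
  assumes F: "abs_cont F" and "a \<le> b"
  shows "bdd_above ((\<lambda>P. \<Sum>(u, v)\<in>P. F v - F u) ` interval_families a b)"
proof (rule Bolzano[OF \<open>a \<le> b\<close>])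
  fix a b c :: real
  assume le: "a \<le> b" "b \<le> c"
    and A: "bdd_above ((\<lambda>P. \<Sum>(u, v)\<in>P. F v - F u) ` interval_families a b)"
    and B: "bdd_above ((\<lambda>P. \<Sum>(u, v)\<in>P. F v - F u) ` interval_families b c)"
  obtain K where K: "\<And>P. P \<in> interval_families a b \<Longrightarrow> (\<Sum>(u, v)\<in>P. F v - F u) \<le> K"
    using A by (auto simp: bdd_above_def)
  obtain L where L: "\<And>P. P \<in> interval_families b c \<Longrightarrow> (\<Sum>(u, v)\<in>P. F v - F u) \<le> L"
    using B by (auto simp: bdd_above_def)
  show "bdd_above ((\<lambda>P. \<Sum>(u, v)\<in>P. F v - F u) ` interval_families a c)"
  proof (rule bdd_aboveI2)
    fix P assume P: "P \<in> interval_families a c"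
    show "(\<Sum>(u, v)\<in>P. F v - F u) \<le> K + L"
      using sum_split_family[OF P le, of F] K[OF clamp_family_in[OF P le(1)]]
        L[OF clamp_family_in[OF P le(2)]] by linarith
  qed
next
  fix x :: real
  obtain d where d: "d > 0" "\<And>a b P. P \<in> interval_families a b \<Longrightarrow> family_length P < d \<Longrightarrow>
      (\<Sum>(u, v)\<in>P. \<bar>F v - F u\<bar>) < 1"
    using F[unfolded abs_cont_def, rule_format, OF zero_less_one] by auto
  have "bdd_above ((\<lambda>P. \<Sum>(u, v)\<in>P. F v - F u) ` interval_families a b)"
    if "a \<le> x" "x \<le> b" "b - a < d" for a b
  proof (rule bdd_aboveI2)
    fix P assume P: "P \<in> interval_families a b"
    have "(\<Sum>(u, v)\<in>P. F v - F u) \<le> (\<Sum>(u, v)\<in>P. \<bar>F v - F u\<bar>)"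
      by (rule sum_mono) auto
    also have "\<dots> < 1"
      using family_length_le[OF P] that by (intro d(2)[OF P]) auto
    finally show "(\<Sum>(u, v)\<in>P. F v - F u) \<le> 1" by simp
  qed
  then show "\<exists>d>0. \<forall>a b. a \<le> x \<and> x \<le> b \<and> b - a < d \<longrightarrow>
      bdd_above ((\<lambda>P. \<Sum>(u, v)\<in>P. F v - F u) ` interval_families a b)"
    using d(1) by (intro exI[of _ d]) simp
qed

lemma interval_families_mono:
  "a' \<le> a \<Longrightarrow> b \<le> b' \<Longrightarrow> interval_families a b \<subseteq> interval_families a' b'"
  by (rule subsetI, rule interval_familiesI)
    (auto dest: interval_familiesD interval_families_disjointD intro: order_trans)

lemma pos_var_nonneg:
  assumes "abs_cont F" "a \<le> b"
  shows "0 \<le> pos_var F a b"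
  unfolding pos_var_def
  by (rule cSUP_upper2[OF bdd_above_pos_var[OF assms], of "{}"]) auto

text \<open>Makes \<open>pos_var F 0\<close> vanish on the negative axis, so that it can serve as a
  function on the whole line.\<close>

lemma pos_var_empty: "b \<le> a \<Longrightarrow> pos_var F a b = 0"
proof -
  assume "b \<le> a"
  then have "P = {}" if "P \<in> interval_families a b" for P
    using that unfolding interval_families_def by fastforce
  then have "interval_families a b = {{}}" by auto
  then show ?thesis by (simp add: pos_var_def)
qed

lemma pos_var_split:
  assumes F: "abs_cont F" and le: "a \<le> b" "b \<le> c"
  shows "pos_var F a c \<le> pos_var F a b + pos_var F b c"
  unfolding pos_var_def[of F a c]
proof (rule cSUP_least)
  fix P assume P: "P \<in> interval_families a c"
  have "(\<Sum>(u, v)\<in>clamp_family a b P. F v - F u) \<le> pos_var F a b"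
    unfolding pos_var_def
    by (rule cSUP_upper[OF clamp_family_in[OF P le(1)] bdd_above_pos_var[OF F le(1)]])
  moreover have "(\<Sum>(u, v)\<in>clamp_family b c P. F v - F u) \<le> pos_var F b c"
    unfolding pos_var_def
    by (rule cSUP_upper[OF clamp_family_in[OF P le(2)] bdd_above_pos_var[OF F le(2)]])
  ultimately show "(\<Sum>(u, v)\<in>P. F v - F u) \<le> pos_var F a b + pos_var F b c"
    using sum_split_family[OF P le, of F] by linarith
qed (use empty_interval_families in blast)

text \<open>Extending a family for \<open>[a, b]\<close> by the pair \<open>(b, c)\<close>, or by
  nothing, gives the two cases of the maximum. Both \<open>pos_var F 0\<close> and
  \<open>pos_var F 0 - F\<close> owe their monotonicity to this.\<close>

lemma pos_var_increment:
  assumes F: "abs_cont F" and le: "a \<le> b" "b \<le> c"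
  shows "pos_var F a b + max 0 (F c - F b) \<le> pos_var F a c"
proof -
  have "pos_var F a b \<le> pos_var F a c - max 0 (F c - F b)"
    unfolding pos_var_def[of F a b]
  proof (rule cSUP_least)
    fix P assume P: "P \<in> interval_families a b"
    have bdd: "Q \<in> interval_families a c \<Longrightarrow> (\<Sum>(u, v)\<in>Q. F v - F u) \<le> pos_var F a c" for Q
      unfolding pos_var_def using le
      by (intro cSUP_upper bdd_above_pos_var[OF F]) auto
    have P': "P \<in> interval_families a c" using P interval_families_mono[of a a b c] le by auto
    have "(\<Sum>(u, v)\<in>P. F v - F u) + (F c - F b) \<le> pos_var F a c"
    \<comment> \<open>For \<open>b = c\<close> the pair \<open>(b, c)\<close> is degenerate and may
      not be added to the family.\<close>
    proof (cases "b = c")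
      case True then show ?thesis using bdd[OF P'] by simp
    next
      case False
      have notin: "(b, c) \<notin> P" using P False le by (auto simp: interval_families_def)
      have "insert (b, c) P \<in> interval_families a c"
        using P P' False le notin unfolding interval_families_def
        by (auto simp: disjoint_family_on_insert)
      from bdd[OF this] show ?thesis
        using notin P by (simp add: interval_families_def)
    qed
    then show "(\<Sum>(u, v)\<in>P. F v - F u) \<le> pos_var F a c - max 0 (F c - F b)"
      using bdd[OF P'] by linarith
  qed (use empty_interval_families in blast)
  then show ?thesis by simp
qed

text \<open>The variation over each interval of \<open>Q\<close> is nearly attained by a family
  inside that interval. Together these form one family no longer than \<open>Q\<close>, to which the
  absolute continuity of \<open>F\<close> applies.\<close>

lemma abs_cont_pos_var:
  assumes F: "abs_cont F" and const: "\<And>x. x \<le> 0 \<Longrightarrow> F x = F 0"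
  shows "abs_cont (pos_var F 0)"
  unfolding abs_cont_def
proof (intro allI impI)
  fix e :: real assume "e > 0"
  then obtain d where d: "d > 0" "\<And>a b P. P \<in> interval_families a b \<Longrightarrow> family_length P < d \<Longrightarrow>
      (\<Sum>(u, v)\<in>P. \<bar>F v - F u\<bar>) < e / 2"
    using F[unfolded abs_cont_def, rule_format, of "e / 2"] by auto
  have "(\<Sum>(u, v)\<in>Q. \<bar>pos_var F 0 v - pos_var F 0 u\<bar>) < e"
    if Q: "Q \<in> interval_families a b" and len: "family_length Q < d" for a b Q
  proof -
    have finQ: "finite Q" using Q by (simp add: interval_families_def)
    \<comment> \<open>The error \<open>e / 2\<close> is shared among the members of
      \<open>Q\<close>; the added 1 keeps \<open>N\<close> positive when \<open>Q\<close> is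
      empty.\<close>
    define N where "N = real (card Q) + 1"
    have N: "N > 0" by (simp add: N_def add_pos_nonneg)
    have le: "fst x < snd x" "a \<le> fst x" "snd x \<le> b" if "x \<in> Q" for x
      using Q that by (auto simp: interval_families_def)
    have "\<exists>P\<in>interval_families (fst x) (snd x).
        pos_var F (fst x) (snd x) - e / 2 / N < (\<Sum>(u, v)\<in>P. F v - F u)" if "x \<in> Q" for x
    proof -
      have "pos_var F (fst x) (snd x) - e / 2 / N < pos_var F (fst x) (snd x)"
        using \<open>e > 0\<close> N by simp
      then show ?thesis
        unfolding pos_var_def[of F "fst x" "snd x"]
        using less_cSUP_iff[OF _ bdd_above_pos_var[OF F, of "fst x" "snd x"]] le[OF that]
          empty_interval_families
        by (metis (no_types, lifting) empty_iff less_imp_le)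
    qed
    then obtain p where p: "\<And>x. x \<in> Q \<Longrightarrow> p x \<in> interval_families (fst x) (snd x)"
      "\<And>x. x \<in> Q \<Longrightarrow> pos_var F (fst x) (snd x) - e / 2 / N < (\<Sum>(u, v)\<in>p x. F v - F u)"
      by metis
    have pin: "finite (p x)" "\<And>y. y \<in> p x \<Longrightarrow> fst x \<le> fst y \<and> fst y < snd y \<and> snd y \<le> snd x"
      if "x \<in> Q" for x
      using p(1)[OF that] by (auto simp: interval_families_def)
    have disj: "{fst y<..<snd y} \<inter> {fst y'<..<snd y'} = {}"
      if "x \<in> Q" "x' \<in> Q" "x \<noteq> x'" "y \<in> p x" "y' \<in> p x'" for x x' y y'
    proof -
      have "{fst y<..<snd y} \<subseteq> {fst x<..<snd x}" "{fst y'<..<snd y'} \<subseteq> {fst x'<..<snd x'}"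
        using pin that by (fastforce simp: greaterThanLessThan_subseteq_greaterThanLessThan)+
      then show ?thesis
        using interval_families_disjointD[OF Q that(1-3)] by blast
    qed
    have pdisj: "p x \<inter> p x' = {}" if "x \<in> Q" "x' \<in> Q" "x \<noteq> x'" for x x'
    proof (rule ccontr)
      assume "p x \<inter> p x' \<noteq> {}"
      then obtain y where y: "y \<in> p x" "y \<in> p x'" by auto
      then have "{fst y<..<snd y} = {}" using disj[OF that y] by simp
      then show False using pin(2)[OF that(1) y(1)] by simp
    qed
    let ?P = "\<Union>x\<in>Q. p x"
    have P: "?P \<in> interval_families a b"
    proof (rule interval_familiesI)
      show "finite ?P" using finQ pin(1) by blast
    next
      fix y y' assume "y \<in> ?P" "y' \<in> ?P" and ne: "y \<noteq> y'"
      then obtain x x' where x: "x \<in> Q" "y \<in> p x" "x' \<in> Q" "y' \<in> p x'" by auto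
      show "{fst y<..<snd y} \<inter> {fst y'<..<snd y'} = {}"
        using disj[of x x' y y'] x ne interval_families_disjointD[OF p(1)[of x], of y y']
        by (cases "x = x'") auto
    next
      fix y assume "y \<in> ?P"
      then obtain x where x: "x \<in> Q" "y \<in> p x" by blast
      show "a \<le> fst y" "fst y < snd y" "snd y \<le> b"
        using pin(2)[OF x] le[OF x(1)] by linarith+
    qed
    have sumP: "(\<Sum>(u, v)\<in>?P. G u v) = (\<Sum>x\<in>Q. \<Sum>(u, v)\<in>p x. G u v)" for G :: "real \<Rightarrow> real \<Rightarrow> real"
      using finQ pin(1) pdisj by (intro sum.UNION_disjoint) auto
    have "family_length ?P = (\<Sum>x\<in>Q. family_length (p x))"
      unfolding family_length_def by (rule sumP)
    also have "\<dots> \<le> (\<Sum>x\<in>Q. snd x - fst x)"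
      using le p(1) by (intro sum_mono family_length_le) (auto intro: less_imp_le)
    also have "\<dots> < d" using len by (simp add: family_length_def case_prod_unfold)
    finally have lenP: "family_length ?P < d" .
    have "(\<Sum>(u, v)\<in>Q. \<bar>pos_var F 0 v - pos_var F 0 u\<bar>)
        \<le> (\<Sum>x\<in>Q. (\<Sum>(u, v)\<in>p x. F v - F u) + e / 2 / N)"
      unfolding case_prod_unfold
    proof (rule sum_mono)
      fix x assume x: "x \<in> Q"
      let ?u = "fst x" and ?v = "snd x"
      have "?u \<le> ?v" using le(1)[OF x] by simp
      have "\<bar>pos_var F 0 ?v - pos_var F 0 ?u\<bar> \<le> pos_var F ?u ?v"
      proof (cases "0 \<le> ?u")
        case True
        then show ?thesis
          using pos_var_split[OF F True \<open>?u \<le> ?v\<close>] pos_var_increment[OF F True \<open>?u \<le> ?v\<close>] by linarith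
      next
        \<comment> \<open>Left of 0 the variation is 0, so the increment is
          \<open>pos_var F 0 ?v\<close>, which is either 0 or a supremum over fewer families than in
          \<open>pos_var F ?u ?v\<close>.\<close>
        case False
        have "pos_var F 0 ?v \<le> pos_var F ?u ?v"
        proof (cases "0 \<le> ?v")
          case True
          show ?thesis unfolding pos_var_def
            using False True \<open>?u \<le> ?v\<close> empty_interval_families[of 0 ?v]
            by (intro cSUP_subset_mono bdd_above_pos_var F interval_families_mono)
              (auto simp del: empty_interval_families)
        next
          case False
          then show ?thesis using pos_var_nonneg[OF F \<open>?u \<le> ?v\<close>] by (simp add: pos_var_empty)
        qed
        moreover have "pos_var F 0 ?v \<ge> 0"
          using pos_var_nonneg[OF F, of 0 ?v] pos_var_empty[of ?v 0 F] by linarith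
        ultimately show ?thesis using False by (simp add: pos_var_empty)
      qed
      then show "\<bar>pos_var F 0 (snd x) - pos_var F 0 (fst x)\<bar>
          \<le> (\<Sum>p\<in>p x. F (snd p) - F (fst p)) + e / 2 / N"
        using p(2)[OF x] by (simp add: case_prod_unfold)
    qed
    also have "\<dots> = (\<Sum>(u, v)\<in>?P. F v - F u) + real (card Q) * (e / 2 / N)"
      by (simp add: sumP sum.distrib)
    also have "\<dots> \<le> (\<Sum>(u, v)\<in>?P. \<bar>F v - F u\<bar>) + e / 2"
    proof (rule add_mono)
      show "(\<Sum>(u, v)\<in>?P. F v - F u) \<le> (\<Sum>(u, v)\<in>?P. \<bar>F v - F u\<bar>)"
        by (rule sum_mono) auto
      show "real (card Q) * (e / 2 / N) \<le> e / 2"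
        using \<open>e > 0\<close> N by (simp add: field_simps N_def)
    qed
    also have "\<dots> < e" using d(2)[OF P lenP] by simp
    finally show ?thesis .
  qed
  then show "\<exists>\<delta>>0. \<forall>a b. \<forall>P\<in>interval_families a b. family_length P < \<delta> \<longrightarrow>
      (\<Sum>(u, v)\<in>P. \<bar>pos_var F 0 v - pos_var F 0 u\<bar>) < e"
    using d(1) by blast
qed

lemma abs_contD:
  assumes "abs_cont F" "e > 0"
  obtains d where "d > 0" "\<And>a b P. P \<in> interval_families a b \<Longrightarrow> family_length P < d \<Longrightarrow>
      (\<Sum>x\<in>P. \<bar>F (snd x) - F (fst x)\<bar>) < e"
proof -
  obtain d where "d > 0" "\<forall>a b. \<forall>P\<in>interval_families a b. family_length P < d \<longrightarrow>
      (\<Sum>x\<in>P. \<bar>F (snd x) - F (fst x)\<bar>) < e"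
    using assms unfolding abs_cont_def case_prod_unfold by blast
  then show ?thesis by (intro that[of d]) auto
qed

lemma abs_cont_diff:
  assumes "abs_cont F" "abs_cont G"
  shows "abs_cont (\<lambda>x. F x - G x)"
  unfolding abs_cont_def case_prod_unfold
proof (intro allI impI)
  fix e :: real assume "e > 0"
  then have "e / 2 > 0" by simp
  obtain d where d: "d > 0" "\<And>a b P. P \<in> interval_families a b \<Longrightarrow> family_length P < d \<Longrightarrow>
      (\<Sum>x\<in>P. \<bar>F (snd x) - F (fst x)\<bar>) < e / 2"
    using abs_contD[OF assms(1) \<open>e / 2 > 0\<close>] by blast
  obtain d' where d': "d' > 0" "\<And>a b P. P \<in> interval_families a b \<Longrightarrow> family_length P < d' \<Longrightarrow>
      (\<Sum>x\<in>P. \<bar>G (snd x) - G (fst x)\<bar>) < e / 2"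
    using abs_contD[OF assms(2) \<open>e / 2 > 0\<close>] by blast
  have "(\<Sum>x\<in>P. \<bar>F (snd x) - G (snd x) - (F (fst x) - G (fst x))\<bar>) < e"
    if P: "P \<in> interval_families a b" and len: "family_length P < min d d'" for a b P
  proof -
    have "(\<Sum>x\<in>P. \<bar>F (snd x) - G (snd x) - (F (fst x) - G (fst x))\<bar>)
      \<le> (\<Sum>x\<in>P. \<bar>F (snd x) - F (fst x)\<bar> + \<bar>G (snd x) - G (fst x)\<bar>)"
      by (rule sum_mono) linarith
    also have "\<dots> < e / 2 + e / 2"
      unfolding sum.distrib using d(2)[OF P] d'(2)[OF P] len by (intro add_strict_mono) auto
    finally show ?thesis by simp
  qed
  then show "\<exists>\<delta>>0. \<forall>a b. \<forall>P\<in>interval_families a b. family_length P < \<delta> \<longrightarrow>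
      (\<Sum>x\<in>P. \<bar>F (snd x) - G (snd x) - (F (fst x) - G (fst x))\<bar>) < e"
    using d(1) d'(1) by (intro exI[of _ "min d d'"]) simp
qed

lemma abs_cont_continuous:
  assumes "abs_cont F"
  shows "isCont F x"
  unfolding continuous_at_eps_delta
proof (intro allI impI)
  fix e :: real assume "e > 0"
  obtain d where d: "d > 0" "\<And>a b P. P \<in> interval_families a b \<Longrightarrow> family_length P < d \<Longrightarrow>
      (\<Sum>x\<in>P. \<bar>F (snd x) - F (fst x)\<bar>) < e"
    using abs_contD[OF assms \<open>e > 0\<close>] by blast
  have single: "{(u, v)} \<in> interval_families u v" if "u < v" for u v
    using that by (intro interval_familiesI) auto
  have "dist (F y) (F x) < e" if "dist y x < d" for y
  proof (cases x y rule: linorder_cases)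
    case less
    then show ?thesis using d(2)[OF single[OF less]] that
      by (simp add: family_length_def dist_real_def)
  next
    case greater
    then show ?thesis using d(2)[OF single[OF greater]] that
      by (simp add: family_length_def dist_real_def)
  qed (use \<open>e > 0\<close> in simp)
  then show "\<exists>d>0. \<forall>x'. dist x' x < d \<longrightarrow> dist (F x') (F x) < e"
    using d(1) by blast
qed

section \<open>Stieltjes measures of absolutely continuous monotone functions\<close>

text \<open>A bounded null set lies in an open set of measure below \<delta>. Finitely many
  nonoverlapping intervals inside that set have total length below \<delta>, hence
  \<open>V\<close>-mass below \<epsilon>, and continuity from below extends the bound to a countable
  cover.\<close>

lemma abs_cont_interval_measure:
  fixes V :: "real \<Rightarrow> real"
  assumes V: "abs_cont V" and "mono V"
  shows "absolutely_continuous lborel (interval_measure V)"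
proof -
  let ?\<mu> = "interval_measure V"
  have mono: "\<And>x y. x \<le> y \<Longrightarrow> V x \<le> V y" using \<open>mono V\<close> by (simp add: monoD)
  have cont: "continuous_on UNIV V"
    using abs_cont_continuous[OF V] by (simp add: continuous_on_eq_continuous_at)
  have Icc: "emeasure ?\<mu> {a..b} = V b - V a" if "a \<le> b" for a b
    using that mono cont by (intro emeasure_interval_measure_Icc) auto
  have small: "emeasure ?\<mu> (N \<inter> {-real m..real m}) \<le> ennreal e"
    if N: "N \<in> null_sets lborel" and "e > 0" "m > 0" for N m e
  proof -
    \<comment> \<open>The covering argument needs a bounded set, so \<open>N\<close> is cut to
      \<open>[-m, m]\<close>.\<close>
    define S where "S = N \<inter> {-real m..real m}"
    obtain d where d: "d > 0" "\<And>a b P. P \<in> interval_families a b \<Longrightarrow> family_length P < d \<Longrightarrow>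
        (\<Sum>x\<in>P. \<bar>V (snd x) - V (fst x)\<bar>) < e"
      using abs_contD[OF V \<open>e > 0\<close>] by blast
    have S: "S \<in> null_sets lborel"
      unfolding S_def using N by (intro null_set_Int2) auto
    then have S': "S \<in> lmeasurable" "measure lebesgue S = 0"
      using S by (auto simp: null_sets_def fmeasurable_def measure_def)
    have S'': "S \<in> sets lebesgue" using S'(1) by (simp add: fmeasurable_def)
    obtain U where U: "open U" "S \<subseteq> U" "U - S \<in> lmeasurable" "emeasure lebesgue (U - S) < ennreal d"
      by (rule sets_lebesgue_outer_open[OF S'' d(1)])
    have "emeasure lebesgue U = emeasure lebesgue (U - S)"
      using S U(1) by (intro emeasure_Diff_null_set[symmetric] null_sets_completionI) auto
    then have eU: "emeasure lebesgue U < ennreal d" using U(4) by simp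
    then have mU': "U \<in> lmeasurable"
      using U(1) order_less_trans[OF _ ennreal_less_top] by (auto intro!: fmeasurableI)
    then have mU: "measure lebesgue U < d"
      using eU d(1) by (simp add: emeasure_eq_measure2 ennreal_less_iff)
    have "S \<subseteq> cbox (-real m) (real m)" by (auto simp: S_def)
    moreover have "box (-real m) (real m) \<noteq> {}" using \<open>m > 0\<close> by (simp add: box_real)
    \<comment> \<open>The gauge assigns \<open>U\<close> to the points of \<open>U\<close>. Each
      covering interval is tagged by a point of \<open>S\<close>, so it must lie in
      \<open>U\<close>.\<close>
    moreover have "gauge (\<lambda>x. if x \<in> U then U else UNIV)"
      using \<open>open U\<close> by (auto simp: gauge_def)
    ultimately obtain \<D> where \<D>: "countable \<D>"
      "\<And>K. K \<in> \<D> \<Longrightarrow> interior K \<noteq> {} \<and> (\<exists>c d. K = cbox c d)"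
      "pairwise (\<lambda>A B. interior A \<inter> interior B = {}) \<D>"
      "\<And>K. K \<in> \<D> \<Longrightarrow> \<exists>x\<in>S \<inter> K. K \<subseteq> (if x \<in> U then U else UNIV)"
      "S \<subseteq> \<Union>\<D>"
      by (rule covering_lemma) (assumption | blast)+
    have KU: "K \<subseteq> U" if "K \<in> \<D>" for K
      using \<D>(4)[OF that] U(2) by (auto split: if_splits)
    have "\<exists>p. K = {fst p..snd p} \<and> fst p < snd p" if K: "K \<in> \<D>" for K
    proof -
      obtain a b where "K = cbox a b" "interior K \<noteq> {}" using \<D>(2)[OF K] by blast
      then show ?thesis by (intro exI[of _ "(a, b)"]) (auto simp: box_real)
    qed
    then obtain p where p: "\<And>K. K \<in> \<D> \<Longrightarrow> K = {fst (p K)..snd (p K)} \<and> fst (p K) < snd (p K)"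
      by metis
    have int_p: "interior K = {fst (p K)<..<snd (p K)}" if "K \<in> \<D>" for K
      using p[OF that] interior_atLeastAtMost_real by metis
    have fin: "emeasure ?\<mu> (\<Union>E) \<le> ennreal e" if E: "E \<subseteq> \<D>" "finite E" for E
    proof -
      have inj: "inj_on p E"
        by (rule inj_onI) (metis E(1) p subsetD)
      have P: "p ` E \<in> interval_families (Min (fst ` p ` E)) (Max (snd ` p ` E))"
      proof (rule interval_familiesI)
        fix x assume x: "x \<in> p ` E"
        show "Min (fst ` p ` E) \<le> fst x" "snd x \<le> Max (snd ` p ` E)"
          using x E(2) by (auto intro!: Min_le Max_ge)
        show "fst x < snd x" using x E p by auto
      next
        fix x y assume "x \<in> p ` E" "y \<in> p ` E" "x \<noteq> y"
        then obtain K L where KL: "K \<in> E" "L \<in> E" "K \<noteq> L" "x = p K" "y = p L" by blast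
        have "interior K \<inter> interior L = {}" using \<D>(3) KL E(1) by (auto simp: pairwise_def)
        moreover have "interior K = {fst x<..<snd x}" "interior L = {fst y<..<snd y}"
          using int_p[of K] int_p[of L] KL E(1) by auto
        ultimately show "{fst x<..<snd x} \<inter> {fst y<..<snd y} = {}" by blast
      qed (use E in auto)
      have "family_length (p ` E) = measure lborel (\<Union>x\<in>p ` E. {fst x<..<snd x})"
        by (rule family_length_measure[OF P])
      also have "\<dots> = measure lebesgue (\<Union>x\<in>p ` E. {fst x<..<snd x})"
        using E(2) by (intro measure_completion[symmetric]) auto
      also have "\<dots> \<le> measure lebesgue U"
      proof (rule measure_mono_fmeasurable[OF _ _ mU'])
        show "(\<Union>x\<in>p ` E. {fst x<..<snd x}) \<subseteq> U"
        proof
          fix y assume "y \<in> (\<Union>x\<in>p ` E. {fst x<..<snd x})"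
          then obtain K where K: "K \<in> E" "fst (p K) < y" "y < snd (p K)" by auto
          then have "y \<in> K"
            using p[of K] E(1) by (metis atLeastAtMost_iff less_imp_le subsetD)
          then show "y \<in> U" using KU[of K] K(1) E(1) by blast
        qed
      qed (use E(2) in \<open>auto intro!: sets.finite_UN\<close>)
      finally have len: "family_length (p ` E) < d" using mU by simp
      have "emeasure ?\<mu> (\<Union>E) \<le> (\<Sum>K\<in>E. emeasure ?\<mu> K)"
        using emeasure_subadditive_finite[OF E(2), of "\<lambda>K. K" ?\<mu>] \<D>(2) E(1)
        by (force simp: subset_eq)
      also have "\<dots> = (\<Sum>K\<in>E. ennreal \<bar>V (snd (p K)) - V (fst (p K))\<bar>)"
      proof (rule sum.cong)
        fix K assume "K \<in> E"
        then have K: "K = {fst (p K)..snd (p K)}" "fst (p K) < snd (p K)" using p E(1) by auto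
        have "emeasure ?\<mu> K = emeasure ?\<mu> {fst (p K)..snd (p K)}" using K(1) by simp
        then show "emeasure ?\<mu> K = ennreal \<bar>V (snd (p K)) - V (fst (p K))\<bar>"
          using Icc[of "fst (p K)" "snd (p K)"] mono[of "fst (p K)" "snd (p K)"] K(2) by simp
      qed simp
      also have "\<dots> = ennreal (\<Sum>x\<in>p ` E. \<bar>V (snd x) - V (fst x)\<bar>)"
        by (simp add: sum.reindex[OF inj])
      also have "\<dots> \<le> ennreal e" using d(2)[OF P len] by (intro ennreal_leI) simp
      finally show ?thesis .
    qed
    have sets: "K \<in> sets ?\<mu>" if "K \<in> \<D>" for K using \<D>(2)[OF that] by auto
    have "emeasure ?\<mu> S \<le> emeasure ?\<mu> (\<Union>\<D>)"
      using \<D>(5,1) sets by (intro emeasure_mono sets.countable_Union) auto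
    also have "\<dots> \<le> ennreal e"
    proof (cases "\<D> = {}")
      case False
      then obtain f :: "nat \<Rightarrow> real set" where f: "range f = \<D>"
        using range_from_nat_into \<D>(1) by metis
      \<comment> \<open>Finite unions increase to the whole cover, so the uniform bound for finite
        subfamilies survives in the limit.\<close>
      define A where "A n = \<Union>(f ` {..n})" for n
      have f': "f n \<in> \<D>" for n using f by blast
      have un: "\<Union>\<D> = (\<Union>n. A n)"
      proof (intro equalityI subsetI)
        fix x assume "x \<in> \<Union>\<D>"
        then obtain n where "x \<in> f n" unfolding f[symmetric] by blast
        then have "x \<in> A n" by (auto simp: A_def)
        then show "x \<in> (\<Union>n. A n)" by blast
      next
        fix x assume "x \<in> (\<Union>n. A n)"
        then obtain n where "x \<in> f n" by (auto simp: A_def)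
        then show "x \<in> \<Union>\<D>" using f'[of n] by blast
      qed
      have sup: "(SUP n. emeasure ?\<mu> (A n)) = emeasure ?\<mu> (\<Union>n. A n)"
      proof (rule SUP_emeasure_incseq)
        have "A n \<in> sets ?\<mu>" for n
          unfolding A_def using sets[OF f'] by (intro sets.finite_UN) auto
        then show "range A \<subseteq> sets ?\<mu>" by blast
        show "incseq A" unfolding A_def incseq_def by (meson Union_mono atMost_subset_iff image_mono)
      qed
      have "emeasure ?\<mu> (A n) \<le> ennreal e" for n
        unfolding A_def using f' by (intro fin) auto
      then show ?thesis unfolding un sup[symmetric] by (rule SUP_least)
    qed simp
    finally show ?thesis by (simp add: S_def)
  qed
  have "N \<in> null_sets ?\<mu>" if N: "N \<in> null_sets lborel" for N
  proof -
    have sets: "N \<in> sets borel" using N by (simp add: null_sets_def)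
    have "N \<inter> {-real (Suc m)..real (Suc m)} \<in> null_sets ?\<mu>" for m
    proof (rule null_setsI)
      show "emeasure ?\<mu> (N \<inter> {-real (Suc m)..real (Suc m)}) = 0"
      proof (rule ccontr)
        assume *: "emeasure ?\<mu> (N \<inter> {-real (Suc m)..real (Suc m)}) \<noteq> 0"
        have "emeasure ?\<mu> (N \<inter> {-real (Suc m)..real (Suc m)}) \<le> 0"
          by (rule ennreal_le_epsilon) (use small[OF N, of _ "Suc m"] in \<open>simp del: of_nat_Suc\<close>)
        with * show False by simp
      qed
    qed (use sets in auto)
    then have "(\<Union>m. N \<inter> {-real (Suc m)..real (Suc m)}) \<in> null_sets ?\<mu>"
      by (intro null_sets_UN) auto
    moreover have "(\<Union>m. N \<inter> {-real (Suc m)..real (Suc m)}) = N"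
    proof -
      have "\<exists>m. x \<in> {-real (Suc m)..real (Suc m)}" for x :: real
      proof -
        obtain m where "\<bar>x\<bar> \<le> real m" using real_arch_simple by blast
        then show ?thesis by (intro exI[of _ m]) auto
      qed
      then show ?thesis by blast
    qed
    ultimately show ?thesis by simp
  qed
  then show ?thesis by (auto simp: absolutely_continuous_def)
qed

lemma abs_cont_mono_density:
  fixes V :: "real \<Rightarrow> real"
  assumes V: "abs_cont V" and "mono V"
  obtains \<psi> :: "real \<Rightarrow> real" where "\<psi> \<in> borel_measurable borel"
    "\<And>a b. a \<le> b \<Longrightarrow> has_bochner_integral lborel (\<lambda>x. indicator {a..b} x * \<psi> x) (V b - V a)"
proof -
  let ?\<mu> = "interval_measure V"
  have mono: "\<And>x y. x \<le> y \<Longrightarrow> V x \<le> V y" using \<open>mono V\<close> by (simp add: monoD)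
  have cont: "continuous_on UNIV V"
    using abs_cont_continuous[OF V] by (simp add: continuous_on_eq_continuous_at)
  have Icc: "emeasure ?\<mu> {a..b} = V b - V a" if "a \<le> b" for a b
    using that mono cont by (intro emeasure_interval_measure_Icc) auto
  have ac: "absolutely_continuous lborel ?\<mu>" by (rule abs_cont_interval_measure[OF assms])
  have sf: "sigma_finite_measure ?\<mu>"
    using mono cont by (intro sigma_finite_interval_measure)
      (auto simp: continuous_on_eq_continuous_within intro: continuous_within_subset)
  define g where "g = RN_deriv lborel ?\<mu>"
  have g: "g \<in> borel_measurable borel" unfolding g_def by simp
  have dens: "density lborel g = ?\<mu>"
    unfolding g_def using ac by (intro sigma_finite_measure.density_RN_deriv[OF sigma_finite_lborel]) auto
  \<comment> \<open>Sigma-finiteness of the Stieltjes measure confines the infinite values of the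
    density to a null set, so passing to \<open>enn2real\<close> changes no integral.\<close>
  have fin: "AE x in lborel. g x \<noteq> \<infinity>"
    unfolding g_def using ac sf
    by (intro sigma_finite_measure.RN_deriv_finite[OF sigma_finite_lborel]) auto
  show ?thesis
  proof (rule that[of "\<lambda>x. enn2real (g x)"])
    fix a b :: real assume ab: "a \<le> b"
    show "has_bochner_integral lborel (\<lambda>x. indicator {a..b} x * enn2real (g x)) (V b - V a)"
    proof (rule has_bochner_integral_nn_integral)
      have "(\<integral>\<^sup>+x. ennreal (indicator {a..b} x * enn2real (g x)) \<partial>lborel)
          = (\<integral>\<^sup>+x. g x * indicator {a..b} x \<partial>lborel)"
        using fin by (intro nn_integral_cong_AE) (auto elim!: eventually_mono split: split_indicator simp: less_top)
      also have "\<dots> = emeasure (density lborel g) {a..b}"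
        using g by (subst emeasure_density) auto
      also have "\<dots> = ennreal (V b - V a)" unfolding dens by (rule Icc[OF ab])
      finally show "(\<integral>\<^sup>+x. ennreal (indicator {a..b} x * enn2real (g x)) \<partial>lborel) = ennreal (V b - V a)" .
    qed (use g mono[OF ab] in auto)
  qed (use g in auto)
qed

text \<open>The function \<open>pos_var F 0\<close> ignores \<open>F\<close> left of 0, so
  \<open>pos_var F 0 - F\<close> is monotone there because \<open>F\<close> is constant; functions
  frozen outside \<open>[0, X]\<close> have this property.\<close>

lemma abs_cont_density:
  fixes F :: "real \<Rightarrow> real"
  assumes F: "abs_cont F" and const: "\<And>x. x \<le> 0 \<Longrightarrow> F x = F 0"
  obtains \<psi> :: "real \<Rightarrow> real" where "\<psi> \<in> borel_measurable borel"
    "\<And>a b. a \<le> b \<Longrightarrow> has_bochner_integral lborel (\<lambda>x. indicator {a..b} x * \<psi> x) (F b - F a)"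
proof -
  let ?V = "pos_var F 0" and ?U = "\<lambda>x. pos_var F 0 x - F x"
  have incr: "?V x \<le> ?V y \<and> ?U x \<le> ?U y" if "x \<le> y" for x y
  proof (cases "0 \<le> x")
    case True
    then show ?thesis using pos_var_increment[OF F True that] by linarith
  next
    case False
    then have "?V x = 0" by (simp add: pos_var_empty)
    moreover have "F x = F 0" using False const[of x] by simp
    moreover have "?V y \<ge> 0 \<and> ?V y \<ge> F y - F 0"
    proof (cases "0 \<le> y")
      case True
      then show ?thesis using pos_var_increment[OF F order.refl True] by (simp add: pos_var_empty)
    next
      case False
      then show ?thesis using const[of y] by (simp add: pos_var_empty)
    qed
    ultimately show ?thesis by simp
  qed
  have V: "abs_cont ?V" by (rule abs_cont_pos_var[OF F const])
  have "mono ?V" "mono ?U" using incr by (auto simp: mono_def)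
  obtain v where v: "v \<in> borel_measurable borel"
    "\<And>a b. a \<le> b \<Longrightarrow> has_bochner_integral lborel (\<lambda>x. indicator {a..b} x * v x) (?V b - ?V a)"
    using abs_cont_mono_density[OF V \<open>mono ?V\<close>] by blast
  obtain u where u: "u \<in> borel_measurable borel"
    "\<And>a b. a \<le> b \<Longrightarrow> has_bochner_integral lborel (\<lambda>x. indicator {a..b} x * u x) (?U b - ?U a)"
    using abs_cont_mono_density[OF abs_cont_diff[OF V F] \<open>mono ?U\<close>] by blast
  show ?thesis
  proof (rule that[of "\<lambda>x. v x - u x"])
    fix a b :: real assume "a \<le> b"
    from has_bochner_integral_diff[OF v(2)[OF this] u(2)[OF this]]
    show "has_bochner_integral lborel (\<lambda>x. indicator {a..b} x * (v x - u x)) (F b - F a)"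
      by (simp add: algebra_simps)
  qed (use u v in auto)
qed

text \<open>The clamp freezes \<open>h\<close> outside \<open>[0, X]\<close>, where intervals
  contribute nothing. The 1-Lipschitz map \<open>L\<close> stands for the real or the imaginary
  part.\<close>

lemma abs_cont_clamp:
  assumes h: "abs_cont_on 0 X h" and X: "0 \<le> X"
    and L: "\<And>x y. \<bar>L x - L y\<bar> \<le> norm (x - y)"
  shows "abs_cont (\<lambda>x. L (h (max 0 (min X x))))"
  unfolding abs_cont_def
proof (intro allI impI)
  fix e :: real assume "e > 0"
  then have "\<exists>d>0. \<forall>P. finite P \<longrightarrow> (\<forall>(u, v)\<in>P. 0 \<le> u \<and> u \<le> v \<and> v \<le> X) \<longrightarrow>
        disjoint_family_on (\<lambda>(u, v). {u<..<v}) P \<longrightarrow>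
        (\<Sum>(u, v)\<in>P. v - u) < d \<longrightarrow> (\<Sum>(u, v)\<in>P. norm (h v - h u)) < e"
    using h unfolding abs_cont_on_def by blast
  then obtain d where d: "d > 0" "\<forall>P. finite P \<longrightarrow> (\<forall>(u, v)\<in>P. 0 \<le> u \<and> u \<le> v \<and> v \<le> X) \<longrightarrow>
        disjoint_family_on (\<lambda>(u, v). {u<..<v}) P \<longrightarrow>
        (\<Sum>(u, v)\<in>P. v - u) < d \<longrightarrow> (\<Sum>(u, v)\<in>P. norm (h v - h u)) < e"
    by blast
  have "(\<Sum>(u, v)\<in>P. \<bar>L (h (max 0 (min X v))) - L (h (max 0 (min X u)))\<bar>) < e"
    if P: "P \<in> interval_families a b" and len: "family_length P < d" for a b P
  proof -
    let ?Q = "clamp_family 0 X P"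
    note Q = clamp_family_in[OF P X]
    have "(\<Sum>(u, v)\<in>?Q. v - u) = (\<Sum>(u, v)\<in>P. max 0 (min X v) - max 0 (min X u))"
      by (rule sum_clamp_family[OF P]) simp
    also have "\<dots> \<le> family_length P"
      unfolding family_length_def case_prod_unfold
      by (rule sum_mono) (use interval_familiesD(3)[OF P] in \<open>smt (verit)\<close>)
    finally have len': "(\<Sum>(u, v)\<in>?Q. v - u) < d" using len by simp
    have "(\<Sum>(u, v)\<in>P. \<bar>L (h (max 0 (min X v))) - L (h (max 0 (min X u)))\<bar>)
        = (\<Sum>(u, v)\<in>?Q. \<bar>L (h v) - L (h u)\<bar>)"
      by (rule sum_clamp_family[OF P, symmetric]) simp
    also have "\<dots> \<le> (\<Sum>(u, v)\<in>?Q. norm (h v - h u))"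
      unfolding case_prod_unfold by (rule sum_mono) (rule L)
    also have "\<dots> < e"
    proof (rule d(2)[rule_format])
      show "case x of (u, v) \<Rightarrow> 0 \<le> u \<and> u \<le> v \<and> v \<le> X" if "x \<in> ?Q" for x
        using interval_familiesD[OF Q] that by (auto simp: case_prod_unfold less_imp_le)
    qed (use Q len' in \<open>auto simp: interval_families_def\<close>)
    finally show ?thesis .
  qed
  then show "\<exists>\<delta>>0. \<forall>a b. \<forall>P\<in>interval_families a b. family_length P < \<delta> \<longrightarrow>
      (\<Sum>(u, v)\<in>P. \<bar>L (h (max 0 (min X v))) - L (h (max 0 (min X u)))\<bar>) < e"
    using d(1) by (intro exI[of _ d]) simp
qed

text \<open>The hard half of the fundamental theorem of calculus for the Lebesgue integral,
  assembled from the real and the imaginary part.\<close>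

lemma abs_cont_on_imp_integral:
  fixes h :: "real \<Rightarrow> complex"
  assumes h: "abs_cont_on 0 X h" and X: "0 \<le> X"
  obtains \<phi> where "\<phi> \<in> borel_measurable borel" "set_integrable lebesgue {0..X} \<phi>"
    "\<And>x. x \<in> {0..X} \<Longrightarrow> h x = h 0 + (LINT t:{0..x}|lebesgue. \<phi> t)"
proof -
  let ?c = "\<lambda>x. max 0 (min X x)"
  have ac: "abs_cont (\<lambda>x. Re (h (?c x)))" "abs_cont (\<lambda>x. Im (h (?c x)))"
    by (rule abs_cont_clamp[OF h X]; use abs_Re_le_cmod abs_Im_le_cmod in \<open>simp flip: minus_complex.sel\<close>)+
  obtain r where r: "r \<in> borel_measurable borel"
    "\<And>a b. a \<le> b \<Longrightarrow> has_bochner_integral lborel (\<lambda>x. indicator {a..b} x * r x) (Re (h (?c b)) - Re (h (?c a)))"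
    by (rule abs_cont_density[OF ac(1)]) (use X in auto)
  obtain i where i: "i \<in> borel_measurable borel"
    "\<And>a b. a \<le> b \<Longrightarrow> has_bochner_integral lborel (\<lambda>x. indicator {a..b} x * i x) (Im (h (?c b)) - Im (h (?c a)))"
    by (rule abs_cont_density[OF ac(2)]) (use X in auto)
  let ?\<phi> = "\<lambda>x. Complex (r x) (i x)"
  have meas: "?\<phi> \<in> borel_measurable borel"
    unfolding Complex_eq using r(1) i(1) by measurable
  have *: "has_bochner_integral lebesgue (\<lambda>t. indicator {0..x} t *\<^sub>R ?\<phi> t) (h x - h 0)"
    if x: "x \<in> {0..X}" for x
  proof -
    have cx: "?c x = x" "?c 0 = 0" using x by auto
    have "has_bochner_integral lborel (\<lambda>t. complex_of_real (indicator {0..x} t * r t)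
        + \<i> * complex_of_real (indicator {0..x} t * i t))
        (complex_of_real (Re (h x) - Re (h 0)) + \<i> * complex_of_real (Im (h x) - Im (h 0)))"
      using r(2)[of 0 x] i(2)[of 0 x] x unfolding cx
      by (intro has_bochner_integral_add has_bochner_integral_mult_right has_bochner_integral_of_real) auto
    moreover have "complex_of_real (Re (h x) - Re (h 0)) + \<i> * complex_of_real (Im (h x) - Im (h 0)) = h x - h 0"
      by (simp add: complex_eq_iff)
    moreover have "(\<lambda>t. complex_of_real (indicator {0..x} t * r t)
        + \<i> * complex_of_real (indicator {0..x} t * i t)) = (\<lambda>t. indicator {0..x} t *\<^sub>R ?\<phi> t)"
      by (auto simp: complex_eq_iff)
    ultimately have "has_bochner_integral lborel (\<lambda>t. indicator {0..x} t *\<^sub>R ?\<phi> t) (h x - h 0)"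
      by simp
    moreover have "(\<lambda>t. indicator {0..x} t *\<^sub>R ?\<phi> t) \<in> borel_measurable lborel"
      using meas by simp
    ultimately show ?thesis
      unfolding has_bochner_integral_iff by (simp add: integrable_completion integral_completion)
  qed
  show ?thesis
  proof (rule that[OF meas])
    show "set_integrable lebesgue {0..X} ?\<phi>"
      using *[of X] X unfolding set_integrable_def by (simp add: has_bochner_integral_iff)
    show "h x = h 0 + (LINT t:{0..x}|lebesgue. ?\<phi> t)" if "x \<in> {0..X}" for x
      using *[OF that] unfolding set_lebesgue_integral_def by (simp add: has_bochner_integral_iff)
  qed
qed

section \<open>Borel versions and functions with vanishing integrals\<close>

text \<open>Convolutions treat \<open>f (x - t)\<close> as a function of two variables, which is
  product measurable for Borel \<open>f\<close>; hence the passage to Borel versions.\<close>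

lemma lebesgue_borel_rep:
  fixes f :: "real \<Rightarrow> complex"
  assumes "f \<in> borel_measurable lebesgue"
  obtains g where "g \<in> borel_measurable borel" "AE x in lborel. f x = g x"
proof -
  have "(\<lambda>x. Re (f x)) \<in> borel_measurable (completion lborel)"
    "(\<lambda>x. Im (f x)) \<in> borel_measurable (completion lborel)"
    using assms by measurable
  then obtain r i where ri: "r \<in> borel_measurable lborel" "i \<in> borel_measurable lborel"
    and ae: "AE x in lborel. Re (f x) = r x" "AE x in lborel. Im (f x) = i x"
    using completion_ex_borel_measurable_real by metis
  show ?thesis
  proof (rule that[of "\<lambda>x. Complex (r x) (i x)"])
    show "(\<lambda>x. Complex (r x) (i x)) \<in> borel_measurable borel"
      unfolding Complex_eq using ri by measurable
    show "AE x in lborel. f x = Complex (r x) (i x)"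
      using ae by eventually_elim (simp add: complex_eq_iff)
  qed
qed

text \<open>The positive and the negative part are densities of two measures that agree on all rays
  \<open>{x<..}\<close> and are finite there, so the measures and then the densities coincide. At
  each point one of the two parts is 0, so both are 0 almost everywhere.\<close>

lemma AE_zero_if_tail_integrals_zero_real:
  fixes f :: "real \<Rightarrow> real"
  assumes f: "integrable lborel f" and z: "\<And>x. (LINT t|lborel. indicator {x<..} t * f t) = 0"
  shows "AE x in lborel. f x = 0"
proof -
  have meas: "f \<in> borel_measurable borel" using borel_measurable_integrable[OF f] by simp
  have nn: "(\<integral>\<^sup>+t. ennreal (g t) * indicator {x<..} t \<partial>lborel) = ennreal (LINT t|lborel. indicator {x<..} t * g t)"
    if "integrable lborel g" "\<And>t. g t \<ge> 0" for g :: "real \<Rightarrow> real" and x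
  proof -
    have "(\<integral>\<^sup>+t. ennreal (g t) * indicator {x<..} t \<partial>lborel) = (\<integral>\<^sup>+t. ennreal (indicator {x<..} t * g t) \<partial>lborel)"
      by (intro nn_integral_cong) (auto split: split_indicator)
    also have "\<dots> = ennreal (LINT t|lborel. indicator {x<..} t * g t)"
      using that integrable_real_mult_indicator[of "{x<..}" lborel g]
      by (intro nn_integral_eq_integral) (auto simp: mult.commute)
    finally show ?thesis .
  qed
  let ?p = "\<lambda>t. max 0 (f t)" and ?n = "\<lambda>t. max 0 (- f t)"
  have pn: "integrable lborel ?p" "integrable lborel ?n" using f by auto
  have pn': "integrable lborel (\<lambda>t. indicator {x<..} t * ?p t)" "integrable lborel (\<lambda>t. indicator {x<..} t * ?n t)" for x
    using integrable_real_mult_indicator[OF _ pn(1), of "{x<..}"]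
      integrable_real_mult_indicator[OF _ pn(2), of "{x<..}"] by (auto simp: mult.commute)
  have "(LINT t|lborel. indicator {x<..} t * ?p t) - (LINT t|lborel. indicator {x<..} t * ?n t) = 0" for x
  proof -
    have "(LINT t|lborel. indicator {x<..} t * ?p t) - (LINT t|lborel. indicator {x<..} t * ?n t)
      = (LINT t|lborel. indicator {x<..} t * ?p t - indicator {x<..} t * ?n t)"
      using pn' by simp
    also have "\<dots> = (LINT t|lborel. indicator {x<..} t * f t)"
      by (intro Bochner_Integration.integral_cong) (auto split: split_indicator)
    finally show ?thesis by (simp add: z)
  qed
  then have eq: "(\<integral>\<^sup>+t. ennreal (?p t) * indicator {x<..} t \<partial>lborel) = (\<integral>\<^sup>+t. ennreal (?n t) * indicator {x<..} t \<partial>lborel)" for x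
    using nn[OF pn(1), of x] nn[OF pn(2), of x] by simp
  have "density lborel (\<lambda>t. ennreal (?p t)) = density lborel (\<lambda>t. ennreal (?n t))"
  proof (rule measure_eqI_lessThan)
    fix x
    show "emeasure (density lborel (\<lambda>t. ennreal (?p t))) {x<..} < \<infinity>"
      using meas nn[OF pn(1), of x] by (simp add: emeasure_density)
    show "emeasure (density lborel (\<lambda>t. ennreal (?p t))) {x<..} = emeasure (density lborel (\<lambda>t. ennreal (?n t))) {x<..}"
      using meas eq by (simp add: emeasure_density)
  qed auto
  then have "AE t in lborel. ennreal (?p t) = ennreal (?n t)"
    using meas by (subst (asm) sigma_finite_measure.density_unique_iff[OF sigma_finite_lborel]) auto
  then show ?thesis
    by eventually_elim (auto simp: max_def split: if_splits)
qed

text \<open>After extension by zero outside \<open>[0, X]\<close>, a tail integral is the total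
  integral minus an initial one, so it vanishes as well.\<close>

lemma AE_zero_if_integrals_zero:
  fixes f :: "real \<Rightarrow> complex"
  assumes f: "set_integrable lebesgue {0..X} f"
    and z: "\<And>x. x \<in> {0..X} \<Longrightarrow> (LINT t:{0..x}|lebesgue. f t) = 0"
  shows "AE x in lebesgue. x \<in> {0..X} \<longrightarrow> f x = 0"
proof -
  define F where "F t = indicator {0..X} t *\<^sub>R f t" for t
  have int: "integrable lebesgue F" using f by (simp add: set_integrable_def F_def[abs_def])
  then obtain g where g: "g \<in> borel_measurable borel" and ae: "AE x in lborel. F x = g x"
    using lebesgue_borel_rep[of F] borel_measurable_integrable by blast
  have ae': "AE x in lebesgue. F x = g x" by (rule AE_completion[OF ae])
  have ig: "integrable lebesgue g"
    using integrable_cong_AE_imp[OF int _ ae'] g by (simp add: measurable_completion)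
  then have ig': "integrable lborel g" using g by (simp add: integrable_completion)
  have zero: "(LINT t|lborel. indicator {x<..} t *\<^sub>R g t) = 0" for x
  proof -
    define y where "y = max 0 (min X x)"
    have L: "(LINT t|lborel. indicator A t *\<^sub>R g t) = (LINT t|lebesgue. indicator A t *\<^sub>R F t)"
      if A: "A \<in> sets borel" for A
    proof -
      have "(LINT t|lborel. indicator A t *\<^sub>R g t) = (LINT t|lebesgue. indicator A t *\<^sub>R g t)"
        using g A by (intro integral_completion[symmetric]) auto
      also have "\<dots> = (LINT t|lebesgue. indicator A t *\<^sub>R F t)"
      proof (rule integral_cong_AE)
        show "(\<lambda>t. indicator A t *\<^sub>R F t) \<in> borel_measurable lebesgue"
          using A by (intro borel_measurable_scaleR borel_measurable_integrable[OF int] borel_measurable_indicator) auto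
        show "(\<lambda>t. indicator A t *\<^sub>R g t) \<in> borel_measurable lebesgue"
          using A g by (intro measurable_completion) auto
        show "AE t in lebesgue. indicator A t *\<^sub>R g t = indicator A t *\<^sub>R F t"
          using ae' by eventually_elim simp
      qed
      finally show ?thesis .
    qed
    have zf: "(LINT t|lebesgue. indicator {0..u} t *\<^sub>R f t) = 0" if "u \<le> X" for u
    proof (cases "0 \<le> u")
      case True then show ?thesis using z[of u] that by (simp add: set_lebesgue_integral_def)
    qed (simp)
    have "(LINT t|lborel. indicator UNIV t *\<^sub>R g t) = 0"
      using L[of UNIV] zf[of X] by (simp add: F_def)
    moreover have "(LINT t|lborel. indicator {..x} t *\<^sub>R g t) = 0"
    proof -
      have "(\<lambda>t. indicator {..x} t *\<^sub>R F t) = (\<lambda>t. indicator {0..min x X} t *\<^sub>R f t)"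
        by (rule ext) (simp add: F_def indicator_def)
      then show ?thesis using L[of "{..x}"] zf[of "min x X"] by simp
    qed
    moreover have "(LINT t|lborel. indicator {..x} t *\<^sub>R g t) + (LINT t|lborel. indicator {x<..} t *\<^sub>R g t)
        = (LINT t|lborel. indicator UNIV t *\<^sub>R g t)"
    proof -
      have "(LINT t|lborel. indicator {..x} t *\<^sub>R g t) + (LINT t|lborel. indicator {x<..} t *\<^sub>R g t)
        = (LINT t|lborel. indicator {..x} t *\<^sub>R g t + indicator {x<..} t *\<^sub>R g t)"
        by (intro Bochner_Integration.integral_add[symmetric] integrable_mult_indicator ig') auto
      also have "\<dots> = (LINT t|lborel. indicator UNIV t *\<^sub>R g t)"
        by (intro Bochner_Integration.integral_cong) (auto simp: indicator_def)
      finally show ?thesis .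
    qed
    ultimately show ?thesis by simp
  qed
  have "AE x in lborel. Re (g x) = 0"
  proof (rule AE_zero_if_tail_integrals_zero_real)
    show "(LINT t|lborel. indicator {x<..} t * Re (g t)) = 0" for x
      using integral_Re[of lborel "\<lambda>t. indicator {x<..} t *\<^sub>R g t"] zero[of x]
        integrable_mult_indicator[OF _ ig', of "{x<..}"] by simp
  qed (use ig' in auto)
  moreover have "AE x in lborel. Im (g x) = 0"
  proof (rule AE_zero_if_tail_integrals_zero_real)
    show "(LINT t|lborel. indicator {x<..} t * Im (g t)) = 0" for x
      using integral_Im[of lborel "\<lambda>t. indicator {x<..} t *\<^sub>R g t"] zero[of x]
        integrable_mult_indicator[OF _ ig', of "{x<..}"] by simp
  qed (use ig' in auto)
  ultimately have "AE x in lborel. x \<in> {0..X} \<longrightarrow> f x = 0"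
    using ae by eventually_elim (auto simp: complex_eq_iff F_def)
  then show ?thesis by (rule AE_completion)
qed

subsection \<open>Convolution\<close>

text \<open>Where the integrand is not integrable the value is 0 by convention of the integral; this
  is why additivity and associativity are claimed only almost everywhere.\<close>

definition conv :: "(real \<Rightarrow> complex) \<Rightarrow> (real \<Rightarrow> complex) \<Rightarrow> real \<Rightarrow> complex" where
  "conv f g x = (LINT t|lborel. f (x - t) * g t)"

lemma nn_integral_lborel_translate:
  fixes f :: "real \<Rightarrow> ennreal"
  assumes "f \<in> borel_measurable borel"
  shows "(\<integral>\<^sup>+x. f (x - t) \<partial>lborel) = (\<integral>\<^sup>+x. f x \<partial>lborel)"
  using nn_integral_real_affine[OF assms, of 1 "-t"] by (simp add: one_ennreal_def[symmetric])

text \<open>Tonelli with the inner integration over \<open>x\<close>: by translation invariance the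
  inner integral is the \<open>L1\<close> norm of \<open>f\<close>, independent of
  \<open>t\<close>.\<close>

lemma integrable_conv_kernel:
  fixes f g :: "real \<Rightarrow> complex"
  assumes f: "integrable lborel f" and g: "integrable lborel g"
  shows "integrable (lborel \<Otimes>\<^sub>M lborel) (\<lambda>(x, t). f (x - t) * g t)"
proof (rule integrableI_bounded)
  have [measurable]: "f \<in> borel_measurable borel" "g \<in> borel_measurable borel"
    using f g borel_measurable_integrable by fastforce+
  show "(\<lambda>(x, t). f (x - t) * g t) \<in> borel_measurable (lborel \<Otimes>\<^sub>M lborel)"
    by measurable
  have "(\<integral>\<^sup>+z. ennreal (norm (case z of (x, t) \<Rightarrow> f (x - t) * g t)) \<partial>(lborel \<Otimes>\<^sub>M lborel))
      = (\<integral>\<^sup>+t. \<integral>\<^sup>+x. ennreal (norm (f (x - t))) * ennreal (norm (g t)) \<partial>lborel \<partial>lborel)"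
    by (subst lborel_pair.nn_integral_snd[symmetric]) (auto simp: norm_mult ennreal_mult)
  also have "\<dots> = (\<integral>\<^sup>+t. (\<integral>\<^sup>+x. ennreal (norm (f x)) \<partial>lborel) * ennreal (norm (g t)) \<partial>lborel)"
    using nn_integral_lborel_translate[of "\<lambda>x. ennreal (norm (f x))"]
    by (simp add: nn_integral_multc)
  also have "\<dots> = (\<integral>\<^sup>+x. ennreal (norm (f x)) \<partial>lborel) * (\<integral>\<^sup>+x. ennreal (norm (g x)) \<partial>lborel)"
    by (simp add: nn_integral_cmult)
  also have "\<dots> < \<infinity>"
    using f g by (auto simp: integrable_iff_bounded ennreal_mult_less_top)
  finally show "(\<integral>\<^sup>+z. ennreal (norm (case z of (x, t) \<Rightarrow> f (x - t) * g t)) \<partial>(lborel \<Otimes>\<^sub>M lborel)) < \<infinity>" .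
qed

lemma
  fixes f g :: "real \<Rightarrow> complex"
  assumes f: "integrable lborel f" and g: "integrable lborel g"
  shows AE_integrable_conv: "AE x in lborel. integrable lborel (\<lambda>t. f (x - t) * g t)"
    and integrable_conv: "integrable lborel (conv f g)"
    and integral_conv: "(LINT x|lborel. conv f g x) = (LINT x|lborel. f x) * (LINT x|lborel. g x)"
proof -
  note k = integrable_conv_kernel[OF f g]
  show "AE x in lborel. integrable lborel (\<lambda>t. f (x - t) * g t)"
    by (rule lborel_pair.AE_integrable_fst[OF k])
  show "integrable lborel (conv f g)"
    unfolding conv_def[abs_def] by (rule lborel_pair.integrable_fst[OF k])
  have "(LINT x|lborel. conv f g x) = (LINT t|lborel. LINT x|lborel. f (x - t) * g t)"
    unfolding conv_def by (rule lborel_pair.Fubini_integral[OF k, symmetric])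
  also have "\<dots> = (LINT t|lborel. (LINT x|lborel. f x) * g t)"
  proof (rule Bochner_Integration.integral_cong[OF refl])
    fix t
    have "(LINT x|lborel. f x) = (LINT x|lborel. f (x - t))"
      using lborel_integral_real_affine[of 1 f "-t"] by simp
    then show "(LINT x|lborel. f (x - t) * g t) = (LINT x|lborel. f x) * g t" by simp
  qed
  finally show "(LINT x|lborel. conv f g x) = (LINT x|lborel. f x) * (LINT x|lborel. g x)" by simp
qed

lemma conv_commute: "conv f g x = conv g f x"
  using lborel_integral_real_affine[of "-1" "\<lambda>t. f (x - t) * g t" x]
  by (simp add: conv_def mult.commute)

text \<open>For almost every \<open>x\<close> the slice of the triple kernel is integrable over the
  \<open>(t, u)\<close> plane, and at such \<open>x\<close> associativity is the exchange of the two
  integrations.\<close>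

lemma conv_assoc_integrable:
  fixes f g h :: "real \<Rightarrow> complex"
  assumes f: "integrable lborel f" and g: "integrable lborel g" and h: "integrable lborel h"
  shows "AE x in lborel. conv f (conv g h) x = conv (conv f g) h x"
proof -
  have [measurable]: "f \<in> borel_measurable borel" "g \<in> borel_measurable borel" "h \<in> borel_measurable borel"
    using f g h borel_measurable_integrable by fastforce+
  \<comment> \<open>The triple product is split as \<open>x\<close> against the pair
    \<open>(t, u)\<close>, which yields slices in \<open>(t, u)\<close>.\<close>
  interpret P: pair_sigma_finite "lborel :: real measure" "lborel \<Otimes>\<^sub>M lborel :: (real \<times> real) measure"
    by (intro pair_sigma_finite.intro) (simp_all add: lborel_prod sigma_finite_lborel)
  let ?k = "\<lambda>(x, t, u). f (x - t) * (g (t - u) * h u)"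
  have "integrable (lborel \<Otimes>\<^sub>M (lborel \<Otimes>\<^sub>M lborel)) ?k"
  proof (rule integrableI_bounded)
    show "?k \<in> borel_measurable (lborel \<Otimes>\<^sub>M (lborel \<Otimes>\<^sub>M lborel))" by measurable
    have gh: "(\<integral>\<^sup>+y. ennreal (norm (case y of (t, u) \<Rightarrow> g (t - u) * h u)) \<partial>(lborel \<Otimes>\<^sub>M lborel)) < \<infinity>"
      using integrable_conv_kernel[OF g h] by (auto simp: integrable_iff_bounded)
    have "(\<integral>\<^sup>+z. ennreal (norm (?k z)) \<partial>(lborel \<Otimes>\<^sub>M (lborel \<Otimes>\<^sub>M lborel)))
        = (\<integral>\<^sup>+y. \<integral>\<^sup>+x. ennreal (norm (?k (x, y))) \<partial>lborel \<partial>(lborel \<Otimes>\<^sub>M lborel))"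
      by (rule P.nn_integral_snd[symmetric]) measurable
    also have "\<dots> = (\<integral>\<^sup>+y. (\<integral>\<^sup>+x. ennreal (norm (f x)) \<partial>lborel) * ennreal (norm (case y of (t, u) \<Rightarrow> g (t - u) * h u)) \<partial>(lborel \<Otimes>\<^sub>M lborel))"
    proof (rule nn_integral_cong)
      fix y :: "real \<times> real"
      obtain t u where y: "y = (t, u)" by (cases y)
      have "(\<integral>\<^sup>+x. ennreal (norm (?k (x, y))) \<partial>lborel)
        = (\<integral>\<^sup>+x. ennreal (norm (f (x - t))) * ennreal (norm (g (t - u) * h u)) \<partial>lborel)"
        unfolding y by (simp add: norm_mult ennreal_mult mult.assoc)
      also have "\<dots> = (\<integral>\<^sup>+x. ennreal (norm (f x)) \<partial>lborel) * ennreal (norm (g (t - u) * h u))"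
        using nn_integral_lborel_translate[of "\<lambda>x. ennreal (norm (f x))" t]
        by (subst nn_integral_multc) auto
      finally show "(\<integral>\<^sup>+x. ennreal (norm (?k (x, y))) \<partial>lborel)
        = (\<integral>\<^sup>+x. ennreal (norm (f x)) \<partial>lborel) * ennreal (norm (case y of (t, u) \<Rightarrow> g (t - u) * h u))"
        by (simp add: y)
    qed
    also have "\<dots> = (\<integral>\<^sup>+x. ennreal (norm (f x)) \<partial>lborel) * (\<integral>\<^sup>+y. ennreal (norm (case y of (t, u) \<Rightarrow> g (t - u) * h u)) \<partial>(lborel \<Otimes>\<^sub>M lborel))"
      by (rule nn_integral_cmult) measurable
    also have "\<dots> < \<infinity>"
      using f gh by (auto simp: integrable_iff_bounded ennreal_mult_less_top)
    finally show "(\<integral>\<^sup>+z. ennreal (norm (?k z)) \<partial>(lborel \<Otimes>\<^sub>M (lborel \<Otimes>\<^sub>M lborel))) < \<infinity>" .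
  qed
  then have "AE x in lborel. integrable (lborel \<Otimes>\<^sub>M lborel) (\<lambda>y. ?k (x, y))"
    by (rule P.AE_integrable_fst')
  then show ?thesis
  proof eventually_elim
    case (elim x)
    then have k: "integrable (lborel \<Otimes>\<^sub>M lborel) (\<lambda>(t, u). f (x - t) * (g (t - u) * h u))"
      by (simp add: case_prod_unfold)
    have "conv f (conv g h) x = (LINT t|lborel. LINT u|lborel. f (x - t) * (g (t - u) * h u))"
      unfolding conv_def by simp
    also have "\<dots> = (LINT u|lborel. LINT t|lborel. f (x - t) * (g (t - u) * h u))"
      by (rule lborel_pair.Fubini_integral[OF k, symmetric])
    also have "\<dots> = (LINT u|lborel. conv f g (x - u) * h u)"
    proof (rule Bochner_Integration.integral_cong[OF refl])
      fix u
      have "(LINT t|lborel. f (x - t) * (g (t - u) * h u)) = (LINT t|lborel. f (x - t) * g (t - u)) * h u"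
        by (simp add: mult.assoc[symmetric])
      also have "(LINT t|lborel. f (x - t) * g (t - u)) = conv f g (x - u)"
        using lborel_integral_real_affine[of 1 "\<lambda>t. f (x - t) * g (t - u)" u]
        by (simp add: conv_def algebra_simps)
      finally show "(LINT t|lborel. f (x - t) * (g (t - u) * h u)) = conv f g (x - u) * h u" .
    qed
    finally show ?case by (simp add: conv_def)
  qed
qed

text \<open>Changing \<open>g\<close> on a null set affects none of the integrals, so no exceptional
  \<open>x\<close> arises.\<close>

lemma conv_cong_AE:
  assumes "AE t in lborel. g t = g' t"
    and [measurable]: "f \<in> borel_measurable borel" "g \<in> borel_measurable borel" "g' \<in> borel_measurable borel"
  shows "conv f g = conv f g'"
proof
  fix x
  show "conv f g x = conv f g' x"
    unfolding conv_def using assms(1) by (intro integral_cong_AE) (auto elim!: eventually_mono)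
qed

subsection \<open>Causal functions\<close>

definition trunc :: "real \<Rightarrow> (real \<Rightarrow> complex) \<Rightarrow> real \<Rightarrow> complex" where
  "trunc X f t = (if t \<le> X then f t else 0)"

text \<open>Borel, locally integrable functions on the half-line, extended by zero. Cutting on the
  right alone expresses local integrability because the left part vanishes.\<close>

definition causal :: "(real \<Rightarrow> complex) \<Rightarrow> bool" where
  "causal f \<longleftrightarrow> f \<in> borel_measurable borel \<and> (\<forall>t\<le>0. f t = 0) \<and> (\<forall>X. integrable lborel (trunc X f))"

lemma causalD:
  assumes "causal f"
  shows "f \<in> borel_measurable borel" "t \<le> 0 \<Longrightarrow> f t = 0" "integrable lborel (trunc X f)"
  using assms by (auto simp: causal_def)

lemma causal_add: "causal f \<Longrightarrow> causal g \<Longrightarrow> causal (\<lambda>t. f t + g t)"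
proof -
  assume fg: "causal f" "causal g"
  have "trunc X (\<lambda>t. f t + g t) = (\<lambda>t. trunc X f t + trunc X g t)" for X by (auto simp: trunc_def)
  then show ?thesis using fg by (auto simp: causal_def)
qed

lemma causal_zero: "causal (\<lambda>t. 0)"
proof -
  have "trunc X (\<lambda>t. 0) = (\<lambda>t. 0)" for X by (auto simp: trunc_def)
  then show ?thesis by (simp add: causal_def)
qed

lemma causal_mult:
  assumes f: "causal f" and e: "continuous_on UNIV e"
  shows "causal (\<lambda>t. e t * f t)"
  unfolding causal_def
proof (intro conjI allI impI)
  have e': "e \<in> borel_measurable borel" using e by (rule borel_measurable_continuous_onI)
  then show "(\<lambda>t. e t * f t) \<in> borel_measurable borel" using causalD(1)[OF f] by measurable
  show "e t * f t = 0" if "t \<le> 0" for t using causalD(2)[OF f that] by simp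
  fix X
  have "bounded (e ` {0..X})"
    by (rule compact_imp_bounded) (intro compact_continuous_image continuous_on_subset[OF e]; simp)
  then obtain B where B: "\<And>t. t \<in> {0..X} \<Longrightarrow> norm (e t) \<le> B" by (meson bounded_iff imageI)
  show "integrable lborel (trunc X (\<lambda>t. e t * f t))"
  proof (rule Bochner_Integration.integrable_bound)
    show "integrable lborel (\<lambda>t. B * norm (trunc X f t))"
      using causalD(3)[OF f, of X] by simp
    show "trunc X (\<lambda>t. e t * f t) \<in> borel_measurable lborel"
      unfolding trunc_def[abs_def] using e' causalD(1)[OF f] by measurable
    show "AE t in lborel. norm (trunc X (\<lambda>t. e t * f t) t) \<le> norm (B * norm (trunc X f t))"
    proof (rule AE_I2)
      fix t
      show "norm (trunc X (\<lambda>t. e t * f t) t) \<le> norm (B * norm (trunc X f t))"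
      proof (cases "0 \<le> t \<and> t \<le> X")
        case True
        then have "norm (e t) \<le> B" by (intro B) auto
        then show ?thesis
          by (auto simp: trunc_def norm_mult abs_mult intro!: mult_right_mono)
      next
        case False
        then show ?thesis using causalD(2)[OF f, of t] by (auto simp: trunc_def)
      qed
    qed
  qed
qed

text \<open>At \<open>x\<close> only arguments in \<open>(0, x)\<close> contribute, so cutting both
  factors beyond \<open>X\<close> is invisible and results for integrable functions apply.\<close>

lemma conv_eq_trunc:
  assumes "causal f" "causal g" "x \<le> X"
  shows "conv f g x = conv (trunc X f) (trunc X g) x"
  unfolding conv_def
proof (rule Bochner_Integration.integral_cong[OF refl])
  fix t show "f (x - t) * g t = trunc X f (x - t) * trunc X g t"
    using causalD(2)[OF assms(1), of "x - t"] causalD(2)[OF assms(2), of t] \<open>x \<le> X\<close>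
    by (auto simp: trunc_def)
qed

lemma causal_conv:
  assumes f: "causal f" and g: "causal g"
  shows "causal (conv f g)"
  unfolding causal_def
proof (intro conjI allI impI)
  have [measurable]: "f \<in> borel_measurable borel" "g \<in> borel_measurable borel"
    using causalD(1) f g by auto
  show "conv f g \<in> borel_measurable borel"
    unfolding conv_def[abs_def] by measurable
  show "conv f g t = 0" if "t \<le> 0" for t
  proof -
    have "f (t - u) * g u = 0" for u
      using causalD(2)[OF f, of "t - u"] causalD(2)[OF g, of u] that by (cases "u \<le> 0") auto
    then have "(\<lambda>u. f (t - u) * g u) = (\<lambda>u. 0)" by blast
    then show ?thesis by (simp add: conv_def)
  qed
  fix X
  have "trunc X (conv f g) = (\<lambda>t. indicator {..X} t *\<^sub>R conv (trunc X f) (trunc X g) t)"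
    by (auto simp: trunc_def conv_eq_trunc[OF f g] indicator_def)
  then show "integrable lborel (trunc X (conv f g))"
    by (auto intro!: integrable_mult_indicator integrable_conv causalD f g)
qed

lemma AE_lborel_le:
  assumes "\<And>X. AE x in lborel. x \<le> X \<longrightarrow> P x"
  shows "AE x in lborel. P (x::real)"
proof -
  have "AE x in lborel. \<forall>n. x \<le> real n \<longrightarrow> P x"
    unfolding AE_all_countable using assms by blast
  then show ?thesis
    by eventually_elim (use real_arch_simple in blast)
qed

lemma conv_assoc:
  assumes f: "causal f" and g: "causal g" and h: "causal h"
  shows "AE x in lborel. conv f (conv g h) x = conv (conv f g) h x"
proof (rule AE_lborel_le)
  fix X
  \<comment> \<open>At \<open>x \<le> X\<close> the convolution sees its second factor only up to
    \<open>X\<close>. This exchanges a truncated convolution for the convolution of truncations; the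
    two differ beyond \<open>X\<close>.\<close>
  have tr: "conv (trunc X u) v x = conv (trunc X u) w x"
    if "\<And>t. t \<le> X \<Longrightarrow> v t = w t" "causal u" "x \<le> X" for u v w x
    unfolding conv_def
  proof (rule Bochner_Integration.integral_cong[OF refl])
    fix t show "trunc X u (x - t) * v t = trunc X u (x - t) * w t"
      using that(1)[of t] causalD(2)[OF that(2), of "x - t"] that(3)
      by (cases "t \<le> X") (auto simp: trunc_def)
  qed
  have "AE x in lborel. conv (trunc X f) (conv (trunc X g) (trunc X h)) x
      = conv (conv (trunc X f) (trunc X g)) (trunc X h) x"
    by (intro conv_assoc_integrable causalD f g h)
  then show "AE x in lborel. x \<le> X \<longrightarrow> conv f (conv g h) x = conv (conv f g) h x"
  proof eventually_elim
    case (elim x)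
    show ?case
    proof
      assume x: "x \<le> X"
      have "conv f (conv g h) x = conv (trunc X f) (trunc X (conv g h)) x"
        by (rule conv_eq_trunc[OF f causal_conv[OF g h] x])
      also have "\<dots> = conv (trunc X f) (conv (trunc X g) (trunc X h)) x"
        by (rule tr[OF _ f x]) (simp add: trunc_def[of _ "conv g h"] conv_eq_trunc[OF g h])
      also have "\<dots> = conv (conv (trunc X f) (trunc X g)) (trunc X h) x" by (rule elim)
      also have "\<dots> = conv (trunc X h) (conv (trunc X f) (trunc X g)) x" by (rule conv_commute)
      also have "\<dots> = conv (trunc X h) (trunc X (conv f g)) x"
        by (rule tr[OF _ h x]) (simp add: trunc_def[of _ "conv f g"] conv_eq_trunc[OF f g])
      also have "\<dots> = conv h (conv f g) x"
        by (rule conv_eq_trunc[OF h causal_conv[OF f g] x, symmetric])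
      also have "\<dots> = conv (conv f g) h x" by (rule conv_commute)
      finally show "conv f (conv g h) x = conv (conv f g) h x" .
    qed
  qed
qed

lemma AE_integrable_conv_causal:
  assumes f: "causal f" and g: "causal g"
  shows "AE x in lborel. integrable lborel (\<lambda>t. f (x - t) * g t)"
proof (rule AE_lborel_le)
  fix X
  have "AE x in lborel. integrable lborel (\<lambda>t. trunc X f (x - t) * trunc X g t)"
    by (intro AE_integrable_conv causalD f g)
  then show "AE x in lborel. x \<le> X \<longrightarrow> integrable lborel (\<lambda>t. f (x - t) * g t)"
  proof eventually_elim
    case (elim x)
    have "f (x - t) * g t = trunc X f (x - t) * trunc X g t" if "x \<le> X" for t
      using causalD(2)[OF f, of "x - t"] causalD(2)[OF g, of t] that by (auto simp: trunc_def)
    with elim show ?case by simp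
  qed
qed

lemma conv_add:
  assumes f: "causal f" and g: "causal g" and h: "causal h"
  shows "AE x in lborel. conv f (\<lambda>t. g t + h t) x = conv f g x + conv f h x"
  using AE_integrable_conv_causal[OF f g] AE_integrable_conv_causal[OF f h]
  by eventually_elim (simp add: conv_def distrib_left)

lemma conv_cmult: "conv f (\<lambda>t. c * g t) x = c * conv f g x"
  by (simp add: conv_def mult.left_commute)


subsection \<open>The Riemann-Liouville kernel\<close>

text \<open>\<open>rl_kernel 1\<close> is the unit step, so convolution with it is integration from
  0.\<close>

definition rl_kernel :: "real \<Rightarrow> real \<Rightarrow> complex" where
  "rl_kernel a t = (if t > 0 then of_real (t powr (a - 1) / Gamma a) else 0)"

text \<open>Convolution with this function is the solution operator of \<open>y' = c * y + h\<close>
  with \<open>y(0) = 0\<close>.\<close>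

definition exp_step :: "complex \<Rightarrow> real \<Rightarrow> complex" where
  "exp_step c t = (if t > 0 then exp (c * of_real t) else 0)"

lemma borel_measurable_rl_kernel [measurable]: "rl_kernel a \<in> borel_measurable borel"
  unfolding rl_kernel_def[abs_def] by measurable

lemma causal_exp_step: "causal (exp_step c)"
proof -
  have *: "causal (\<lambda>t. if t > 0 then 1 else 0)"
    unfolding causal_def
  proof (intro conjI allI impI)
    fix X :: real
    have "trunc X (\<lambda>t. if t > 0 then 1 else 0) = (\<lambda>t. complex_of_real (indicator {0<..X} t))"
      by (auto simp: trunc_def indicator_def)
    then show "integrable lborel (trunc X (\<lambda>t. if t > 0 then 1 else 0))"
      by (simp only:, intro integrable_of_real integrable_real_indicator; cases "0 \<le> X") auto
  qed auto
  have "causal (\<lambda>t. exp (c * of_real t) * (if t > 0 then 1 else 0))"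
    by (rule causal_mult[OF *]) (intro continuous_intros)
  moreover have "(\<lambda>t. exp (c * of_real t) * (if t > 0 then 1 else 0)) = exp_step c"
    by (auto simp: exp_step_def)
  ultimately show ?thesis by simp
qed

text \<open>The exponential is multiplicative over \<open>x = (x - t) + t\<close>. With
  \<open>c = - z\<close> this reduces the transform of a convolution to the integral of a
  convolution.\<close>

lemma exp_mult_conv:
  "exp (c * of_real x) * conv f g x = conv (\<lambda>t. exp (c * of_real t) * f t) (\<lambda>t. exp (c * of_real t) * g t) x"
proof -
  have "exp (c * of_real x) * (f (x - t) * g t)
      = exp (c * of_real (x - t)) * f (x - t) * (exp (c * of_real t) * g t)" for t
    by (simp add: algebra_simps exp_diff)
  then show ?thesis unfolding conv_def by (simp only: integral_mult_right_zero[symmetric])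
qed

text \<open>Euler's integral scaled by \<open>R\<close>. Besides giving the real transform it
  provides the dominating exponential (\<open>a = 1\<close>) and local integrability of the kernel
  (\<open>R = 1\<close>).\<close>

lemma has_bochner_integral_rl_kernel_real:
  fixes a R :: real
  assumes a: "a > 0" and R: "R > 0"
  shows "has_bochner_integral lborel
    (\<lambda>t. indicator {0<..} t * (t powr (a - 1) * exp (- R * t))) (Gamma a * R powr (- a))"
proof (rule has_bochner_integral_nn_integral)
  let ?F = "\<lambda>t::real. ennreal (indicator {0..} t * t powr (a - 1) / exp t)"
  let ?G = "\<lambda>t::real. ennreal (indicator {0<..} t * (t powr (a - 1) * exp (- R * t)))"
  have "ennreal (Gamma a) = (\<integral>\<^sup>+t. ?F t \<partial>lborel)" by (rule Gamma_conv_nn_integral_real[OF a])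
  also have "\<dots> = ennreal R * (\<integral>\<^sup>+t. ?F (R * t) \<partial>lborel)"
    using R by (subst nn_integral_real_affine[of _ R 0]) auto
  also have "(\<integral>\<^sup>+t. ?F (R * t) \<partial>lborel) = (\<integral>\<^sup>+t. ennreal (R powr (a - 1)) * ?G t \<partial>lborel)"
  proof (rule nn_integral_cong_AE)
    have "AE t in lborel. t \<noteq> (0::real)" by (rule AE_lborel_singleton)
    then show "AE t in lborel. ?F (R * t) = ennreal (R powr (a - 1)) * ?G t"
    proof eventually_elim
      case (elim t)
      show ?case
      proof (cases "t > 0")
        case True
        then have "ennreal (R powr (a - 1)) * ?G t = ennreal (R powr (a - 1) * (t powr (a - 1) * exp (- R * t)))"
          using True by (simp add: ennreal_mult)
        with True R show ?thesis
          by (simp add: powr_mult exp_minus field_simps)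
      next
        case False
        then have "t < 0" using elim by simp
        then show ?thesis using R by (simp add: mult_pos_neg not_le)
      qed
    qed
  qed
  also have "\<dots> = ennreal (R powr (a - 1)) * (\<integral>\<^sup>+t. ?G t \<partial>lborel)"
    by (rule nn_integral_cmult) measurable
  finally have "ennreal (Gamma a) = ennreal (R powr a) * (\<integral>\<^sup>+t. ?G t \<partial>lborel)"
    using R by (simp add: mult.assoc[symmetric] ennreal_mult[symmetric] powr_mult_base)
  then have "ennreal (R powr (- a)) * ennreal (Gamma a)
      = ennreal (R powr (- a)) * ennreal (R powr a) * (\<integral>\<^sup>+t. ?G t \<partial>lborel)"
    by (simp add: mult.assoc)
  also have "ennreal (R powr (- a)) * ennreal (R powr a) = 1"
    using R by (simp add: ennreal_mult[symmetric] powr_add[symmetric])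
  finally show "(\<integral>\<^sup>+t. ?G t \<partial>lborel) = ennreal (Gamma a * R powr (- a))"
    using a by (simp add: ennreal_mult mult.commute less_imp_le Gamma_real_pos)
qed (use a R in \<open>auto simp: Gamma_real_pos less_imp_le\<close>)

lemma causal_rl_kernel:
  assumes a: "a > 0"
  shows "causal (rl_kernel a)"
  unfolding causal_def
proof (intro conjI allI impI)
  fix X
  show "integrable lborel (trunc X (rl_kernel a))"
  proof (rule Bochner_Integration.integrable_bound)
    \<comment> \<open>Since \<open>exp (X - t) \<ge> 1\<close> for \<open>t \<le> X\<close>, the
      Gamma integrand with this constant dominates the truncated kernel.\<close>
    show "integrable lborel (\<lambda>t. exp X / Gamma a * (indicator {0<..} t * (t powr (a - 1) * exp (- 1 * t))))"
      using has_bochner_integral_rl_kernel_real[OF a zero_less_one]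
      by (intro integrable_mult_right) (simp add: has_bochner_integral_iff)
    show "trunc X (rl_kernel a) \<in> borel_measurable lborel"
      unfolding trunc_def[abs_def] by measurable
    show "AE t in lborel. norm (trunc X (rl_kernel a) t)
        \<le> norm (exp X / Gamma a * (indicator {0<..} t * (t powr (a - 1) * exp (- 1 * t))))"
    proof (rule AE_I2)
      fix t
      show "norm (trunc X (rl_kernel a) t)
        \<le> norm (exp X / Gamma a * (indicator {0<..} t * (t powr (a - 1) * exp (- 1 * t))))"
      proof (cases "0 < t \<and> t \<le> X")
        case True
        have "t powr (a - 1) / Gamma a * 1 \<le> t powr (a - 1) / Gamma a * exp (X - t)"
          using True a by (intro mult_left_mono) (auto simp: Gamma_real_pos less_imp_le)
        then show ?thesis
          using True a Gamma_real_pos[OF a]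
          by (simp add: trunc_def rl_kernel_def norm_divide abs_mult exp_diff exp_minus field_simps)
      qed (auto simp: trunc_def rl_kernel_def)
    qed
  qed
qed (auto simp: rl_kernel_def)

text \<open>The substitution \<open>t = x * u\<close> turns the convolution into a Beta integral.
  This is the source of the semigroup law, and it holds at every point.\<close>

lemma conv_rl_kernel:
  assumes a: "a > 0" and b: "b > 0"
  shows "conv (rl_kernel a) (rl_kernel b) = rl_kernel (a + b)"
proof
  fix x
  show "conv (rl_kernel a) (rl_kernel b) x = rl_kernel (a + b) x"
  proof (cases "x > 0")
    case False
    then show ?thesis
      using causalD(2)[OF causal_conv[OF causal_rl_kernel[OF a] causal_rl_kernel[OF b]], of x]
      by (simp add: rl_kernel_def)
  next
    case True
    have pos: "Gamma a > 0" "Gamma b > 0" "Gamma (a + b) > 0" using a b by (auto simp: Gamma_real_pos)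
    let ?B = "\<lambda>t. t powr (b - 1) * (1 - t) powr (a - 1)"
    let ?C = "x powr (a + b - 2) / (Gamma a * Gamma b)"
    have "conv (rl_kernel a) (rl_kernel b) x = x *\<^sub>R (LINT u|lborel. rl_kernel a (x - x * u) * rl_kernel b (x * u))"
      unfolding conv_def using True
      by (subst lborel_integral_real_affine[of x _ 0]) auto
    also have "(LINT u|lborel. rl_kernel a (x - x * u) * rl_kernel b (x * u))
        = (LINT u|lborel. complex_of_real (?C * (indicator {0..1} u *\<^sub>R ?B u)))"
    proof (rule Bochner_Integration.integral_cong[OF refl])
      fix u
      have *: "x - x * u = x * (1 - u)" by (simp add: algebra_simps)
      show "rl_kernel a (x - x * u) * rl_kernel b (x * u) = complex_of_real (?C * (indicator {0..1} u *\<^sub>R ?B u))"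
      proof (cases "0 < u \<and> u < 1")
        case True
        have "(x * (1 - u)) powr (a - 1) * (x * u) powr (b - 1)
            = x powr (a - 1) * x powr (b - 1) * ?B u"
          using True \<open>x > 0\<close> by (simp add: powr_mult)
        also have "x powr (a - 1) * x powr (b - 1) = x powr (a + b - 2)"
          by (simp add: powr_add[symmetric])
        finally have "(x * (1 - u)) powr (a - 1) / Gamma a * ((x * u) powr (b - 1) / Gamma b) = ?C * ?B u"
          by simp
        moreover have "x * (1 - u) > 0" "x * u > 0" using True \<open>x > 0\<close> by auto
        ultimately show ?thesis
          using True unfolding * rl_kernel_def by (simp flip: of_real_mult)
      next
        case False
        then have "u \<le> 0 \<or> u \<ge> 1" by auto
        then show ?thesis using \<open>x > 0\<close> unfolding *
          by (auto simp: rl_kernel_def zero_less_mult_iff indicator_def)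
      qed
    qed
    also have "\<dots> = complex_of_real (?C * (LINT u:{0..1}|lborel. ?B u))"
      unfolding set_lebesgue_integral_def
      by (simp only: integral_complex_of_real integral_mult_right_zero)
    also have "(LINT u:{0..1}|lborel. ?B u) = Beta b a"
      using set_borel_integral_eq_integral(2)[OF integrable_Beta[OF b a]]
        integral_unique[OF has_integral_Beta_real[OF b a]] by simp
    also have "x *\<^sub>R complex_of_real (?C * Beta b a) = rl_kernel (a + b) x"
    proof -
      have "x * x powr (a + b - 2) = x powr (a + b - 1)"
        using True powr_mult_base[of x "a + b - 2"] by (simp add: algebra_simps)
      then have e: "x * (?C * Beta b a) = x powr (a + b - 1) / Gamma (a + b)"
        using pos by (simp add: Beta_def field_simps)
      show ?thesis
        unfolding scaleR_conv_of_real of_real_mult[symmetric] e using True by (simp add: rl_kernel_def)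
    qed
    finally show ?thesis .
  qed
qed

subsection \<open>Laplace transforms\<close>

lemma laplace_conv:
  assumes f: "has_bochner_integral lborel (\<lambda>t. exp (- z * of_real t) * f t) F"
    and g: "has_bochner_integral lborel (\<lambda>t. exp (- z * of_real t) * g t) G"
  shows "has_bochner_integral lborel (\<lambda>t. exp (- z * of_real t) * conv f g t) (F * G)"
proof -
  have "has_bochner_integral lborel
      (conv (\<lambda>t. exp (- z * of_real t) * f t) (\<lambda>t. exp (- z * of_real t) * g t)) (F * G)"
    using f g integrable_conv integral_conv by (auto simp: has_bochner_integral_iff)
  then show ?thesis by (simp only: exp_mult_conv)
qed

section \<open>Transform of the Riemann-Liouville kernel\<close>

text \<open>With \<open>y = (R - z) / R\<close> this is the binomial series of
  \<open>(1 - y) powr (- a)\<close>, because \<open>Gamma (a + k) / (Gamma a * fact k)\<close> is a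
  binomial coefficient up to sign. Its terms arise from integrating the series of
  \<open>exp ((R - z) * t)\<close> against \<open>t powr (a - 1) * exp (- R * t)\<close>; the second
  claim is the same series at the modulus of \<open>R - z\<close>.\<close>

lemma powr_binomial_series:
  fixes z :: complex and a R :: real
  assumes a: "a > 0" and R: "cmod (of_real R - z) < R"
  shows "(\<lambda>k. of_real (Gamma (a + real k) * R powr (- (a + real k)) / fact k) * (of_real R - z) ^ k)
    sums (of_real (Gamma a) * z powr (- of_real a))"
    and "summable (\<lambda>k. Gamma (a + real k) * R powr (- (a + real k)) / fact k * cmod (of_real R - z) ^ k)"
proof -
  have Rp: "R > 0" using R norm_ge_zero[of "of_real R - z"] by linarith
  have coeff: "Gamma (a + real k) * R powr (- (a + real k)) / fact k
      = Gamma a * R powr (- a) * ((- 1) ^ k * ((- a) gchoose k)) / R ^ k" for k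
  proof -
    have "a \<notin> \<int>\<^sub>\<le>\<^sub>0" using a by (auto elim!: nonpos_Ints_cases)
    then have "Gamma (a + real k) = Gamma a * pochhammer a k"
      using pochhammer_Gamma[of a k] Gamma_real_pos[OF a] by simp
    moreover have "R powr (- (a + real k)) = R powr (- a) / R ^ k"
      using Rp powr_add[of R "- a" "- real k"] by (simp add: powr_minus powr_realpow divide_simps)
    moreover have "(- 1) ^ k * ((- a) gchoose k) = pochhammer a k / fact k"
      by (simp add: gbinomial_pochhammer)
    ultimately show ?thesis by (simp add: mult_ac)
  qed
  let ?y = "(of_real R - z) / of_real R"
  have ny: "cmod ?y < 1" using R Rp by (simp add: norm_divide)
  have "(\<lambda>k. of_real (Gamma a * R powr (- a)) * (((- of_real a) gchoose k) * (- ?y) ^ k)) sums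
      (of_real (Gamma a * R powr (- a)) * (1 + (- ?y)) powr (- of_real a))"
    using ny by (intro sums_mult gen_binomial_complex) simp
  also have "(\<lambda>k. of_real (Gamma a * R powr (- a)) * (((- of_real a) gchoose k) * (- ?y) ^ k))
      = (\<lambda>k. of_real (Gamma (a + real k) * R powr (- (a + real k)) / fact k) * (of_real R - z) ^ k)"
  proof
    fix k
    have *: "(- ?y) ^ k = (- 1) ^ k * (of_real R - z) ^ k / of_real R ^ k"
      by (simp add: power_divide power_minus[of ?y])
    have "complex_of_real (((- a) gchoose k)) = (- of_real a) gchoose k"
      by (simp add: gbinomial_prod_rev)
    then show "of_real (Gamma a * R powr (- a)) * (((- of_real a) gchoose k) * (- ?y) ^ k)
        = of_real (Gamma (a + real k) * R powr (- (a + real k)) / fact k) * (of_real R - z) ^ k"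
      unfolding coeff * by simp
  qed
  also have "1 + (- ?y) = z / of_real R" using Rp by (simp add: field_simps)
  also have "of_real (Gamma a * R powr (- a)) * (z / of_real R) powr (- of_real a)
      = of_real (Gamma a) * z powr (- of_real a)"
  proof -
    have "z \<noteq> 0" using R Rp by auto
    \<comment> \<open>As \<open>R\<close> is a positive real, the principal logarithm splits without
      a branch correction.\<close>
    then have "Ln z = Ln (of_real R * (z / of_real R))" using Rp by simp
    also have "\<dots> = of_real (ln R) + Ln (z / of_real R)"
      using Rp \<open>z \<noteq> 0\<close> Ln_times_of_real[of R "z / of_real R"] by (simp add: Ln_of_real)
    finally have "z powr (- of_real a) = of_real (R powr (- a)) * (z / of_real R) powr (- of_real a)"
      using Rp \<open>z \<noteq> 0\<close>
      by (simp add: powr_def exp_add[symmetric] exp_of_real[symmetric] algebra_simps del: exp_of_real)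
    then show ?thesis by simp
  qed
  finally show "(\<lambda>k. of_real (Gamma (a + real k) * R powr (- (a + real k)) / fact k) * (of_real R - z) ^ k)
    sums (of_real (Gamma a) * z powr (- of_real a))" .
  let ?q = "cmod (of_real R - z) / R"
  have "(\<lambda>k. Gamma a * R powr (- a) * (((- a) gchoose k) * (- ?q) ^ k)) sums
      (Gamma a * R powr (- a) * (1 + (- ?q)) powr (- a))"
    using R Rp by (intro sums_mult gen_binomial_real) simp
  also have "(\<lambda>k. Gamma a * R powr (- a) * (((- a) gchoose k) * (- ?q) ^ k))
      = (\<lambda>k. Gamma (a + real k) * R powr (- (a + real k)) / fact k * cmod (of_real R - z) ^ k)"
  proof
    fix k
    have *: "(- ?q) ^ k = (- 1) ^ k * cmod (of_real R - z) ^ k / R ^ k"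
      by (simp add: power_divide power_minus[of ?q])
    show "Gamma a * R powr (- a) * (((- a) gchoose k) * (- ?q) ^ k)
        = Gamma (a + real k) * R powr (- (a + real k)) / fact k * cmod (of_real R - z) ^ k"
      unfolding coeff * by simp
  qed
  finally show "summable (\<lambda>k. Gamma (a + real k) * R powr (- (a + real k)) / fact k * cmod (of_real R - z) ^ k)"
    by (rule sums_summable)
qed

text \<open>Writes \<open>exp (- z * t)\<close> as \<open>exp (- R * t)\<close> times the power
  series of \<open>exp ((R - z) * t)\<close> and integrates term by term.\<close>

lemma laplace_rl_kernel:
  assumes a: "a > 0" and z: "Re z > 0"
  shows "has_bochner_integral lborel (\<lambda>t. exp (- z * of_real t) * rl_kernel a t) (z powr (- of_real a))"
proof -
  obtain R where R: "cmod (of_real R - z) < R"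
  proof -
    \<comment> \<open>With this choice the squared distance of \<open>R\<close> and \<open>z\<close>
      is \<open>R^2 - (cmod z)^2\<close>; any \<open>R\<close> above half this value would
      do.\<close>
    define R where "R = (cmod z)\<^sup>2 / Re z"
    have "z \<noteq> 0" using z by auto
    then have "R > 0" using z by (simp add: R_def)
    have "R * Re z = (cmod z)\<^sup>2" using z by (simp add: R_def)
    have "(cmod (of_real R - z))\<^sup>2 = R\<^sup>2 - 2 * (R * Re z) + (cmod z)\<^sup>2"
      unfolding cmod_power2 by (simp add: power2_eq_square algebra_simps)
    also have "\<dots> < R\<^sup>2" unfolding \<open>R * Re z = (cmod z)\<^sup>2\<close> using \<open>z \<noteq> 0\<close> by simp
    finally have "cmod (of_real R - z) < R"
      by (rule power2_less_imp_less) (use \<open>R > 0\<close> in simp)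
    then show ?thesis by (rule that)
  qed
  have Rp: "R > 0" using R norm_ge_zero[of "of_real R - z"] by linarith
  note ser = powr_binomial_series[OF a R]
  let ?w = "\<lambda>(k::nat) (t::real). indicator {0<..} t * (t powr (a + real k - 1) * exp (- R * t))"
  let ?c = "\<lambda>k::nat. (of_real R - z) ^ k / fact k"
  let ?u = "\<lambda>(k::nat) (t::real). ?c k * complex_of_real (?w k t)"
  have w: "has_bochner_integral lborel (?w k) (Gamma (a + real k) * R powr (- (a + real k)))" for k
    using a Rp by (intro has_bochner_integral_rl_kernel_real) auto
  have w_nonneg: "?w k t \<ge> 0" for k t by simp
  have u: "has_bochner_integral lborel (?u k) (?c k * of_real (Gamma (a + real k) * R powr (- (a + real k))))" for k
    by (intro has_bochner_integral_mult_right has_bochner_integral_of_real w)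
  have nu: "norm (?u k t) = cmod (of_real R - z) ^ k / fact k * ?w k t" for k t
    using w_nonneg[of t k] by (simp only: norm_mult norm_divide norm_power norm_fact norm_of_real abs_of_nonneg)
  have uk: "?u k t = of_real (?w 0 t) * (((of_real R - z) * of_real t) ^ k /\<^sub>R fact k)" for k t
    unfolding power_mult_distrib
    by (auto simp: indicator_def powr_add powr_diff powr_realpow scaleR_conv_of_real field_simps)
  have sums_u: "(\<lambda>k. ?u k t) sums (of_real (?w 0 t) * exp ((of_real R - z) * of_real t))" for t
    unfolding uk by (intro sums_mult exp_converges)
  have "has_bochner_integral lborel (\<lambda>t. \<Sum>k. ?u k t) (\<Sum>k. integral\<^sup>L lborel (?u k))"
  proof -
    have int: "integrable lborel (?u k)" for k using u by (simp only: has_bochner_integral_iff)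
    have sum1: "AE t in lborel. summable (\<lambda>k. norm (?u k t))"
    proof (rule AE_I2)
      fix t
      have "summable (\<lambda>k. norm (((of_real R - z) * of_real t) ^ k /\<^sub>R fact k))"
        by (rule summable_norm_exp)
      then show "summable (\<lambda>k. norm (?u k t))"
        unfolding uk norm_mult by (rule summable_mult)
    qed
    have "(LINT t|lborel. norm (?u k t)) = Gamma (a + real k) * R powr (- (a + real k)) / fact k * cmod (of_real R - z) ^ k" for k
      unfolding nu using has_bochner_integral_integral_eq[OF w[of k]]
      by (simp only: integral_mult_right_zero) simp
    \<comment> \<open>The \<open>L1\<close> norms of the terms sum to the absolute binomial series,
      which justifies integrating term by term.\<close>
    then have sum2: "summable (\<lambda>k. LINT t|lborel. norm (?u k t))"
      using ser(2) by (simp only:)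
    show ?thesis
      using integrable_suminf[OF int sum1 sum2] integral_suminf[OF int sum1 sum2]
      by (simp only: has_bochner_integral_iff)
  qed
  moreover have "(\<Sum>k. integral\<^sup>L lborel (?u k)) = of_real (Gamma a) * z powr (- of_real a)"
  proof -
    have "integral\<^sup>L lborel (?u k) = of_real (Gamma (a + real k) * R powr (- (a + real k)) / fact k) * (of_real R - z) ^ k" for k
      unfolding has_bochner_integral_integral_eq[OF u] by simp
    then show ?thesis using sums_unique[OF ser(1)] by (simp only:)
  qed
  moreover have "(\<Sum>k. ?u k t) = of_real (Gamma a) * (exp (- z * of_real t) * rl_kernel a t)" for t
  proof -
    have "(\<Sum>k. ?u k t) = of_real (?w 0 t) * exp ((of_real R - z) * of_real t)"
      by (rule sums_unique[OF sums_u, symmetric])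
    also have "\<dots> = of_real (Gamma a) * (exp (- z * of_real t) * rl_kernel a t)"
    proof (cases "t > 0")
      case True
      have "complex_of_real (exp (- R * t)) * exp ((of_real R - z) * of_real t) = exp (- z * of_real t)"
        by (simp add: exp_of_real[symmetric] exp_add[symmetric] algebra_simps del: exp_of_real)
      then show ?thesis using True Gamma_real_pos[OF a] by (simp add: rl_kernel_def)
    qed (simp add: rl_kernel_def)
    finally show ?thesis .
  qed
  ultimately have "has_bochner_integral lborel (\<lambda>t. of_real (Gamma a) * (exp (- z * of_real t) * rl_kernel a t))
      (of_real (Gamma a) * z powr (- of_real a))"
    by (simp only:)
  then have "has_bochner_integral lborel (\<lambda>t. inverse (of_real (Gamma a)) * (of_real (Gamma a) * (exp (- z * of_real t) * rl_kernel a t)))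
      (inverse (of_real (Gamma a)) * (of_real (Gamma a) * z powr (- of_real a)))"
    by (rule has_bochner_integral_mult_right)
  then show ?thesis using Gamma_real_pos[OF a] by (simp add: mult.assoc[symmetric])
qed

section \<open>Transforms of primitives under conditional convergence\<close>

lemma conv_rl_kernel_1:
  assumes "g \<in> borel_measurable borel"
  shows "conv (rl_kernel 1) g x = (LINT t|lborel. indicator {..x} t *\<^sub>R g t)"
  unfolding conv_def
proof (rule integral_cong_AE)
  show "(\<lambda>t. rl_kernel 1 (x - t) * g t) \<in> borel_measurable lborel"
    using assms by measurable
  show "(\<lambda>t. indicator {..x} t *\<^sub>R g t) \<in> borel_measurable lborel"
    using assms by measurable
  have "AE t in lborel. t \<noteq> x" by (rule AE_lborel_singleton)
  then show "AE t in lborel. rl_kernel 1 (x - t) * g t = indicator {..x} t *\<^sub>R g t"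
    by eventually_elim (auto simp: rl_kernel_def indicator_def)
qed

text \<open>The integral form of \<open>y' = c * y\<close>, \<open>y(0) = 1\<close>; an integral
  equation can be convolved with functions that are merely locally integrable.\<close>

lemma exp_step_eq: "exp_step c x = rl_kernel 1 x + c * conv (rl_kernel 1) (exp_step c) x"
proof (cases "x > 0")
  case False
  then show ?thesis
    using causalD(2)[OF causal_conv[OF causal_rl_kernel[OF zero_less_one] causal_exp_step[of c]], of x]
    by (simp add: exp_step_def rl_kernel_def)
next
  case True
  have "c * conv (rl_kernel 1) (exp_step c) x = (LINT t|lborel. indicator {..x} t *\<^sub>R (c * exp_step c t))"
    using causalD(1)[OF causal_exp_step[of c]]
    by (subst conv_rl_kernel_1) (auto simp: mult_scaleR_right[symmetric] simp del: mult_scaleR_right)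
  also have "\<dots> = (LINT t|lborel. indicator {0..x} t *\<^sub>R (c * exp (c * of_real t)))"
  proof (rule integral_cong_AE)
    have "AE t in lborel. t \<noteq> (0::real)" by (rule AE_lborel_singleton)
    then show "AE t in lborel. indicator {..x} t *\<^sub>R (c * exp_step c t) = indicator {0..x} t *\<^sub>R (c * exp (c * of_real t))"
      by eventually_elim (auto simp: exp_step_def indicator_def)
  qed (use causalD(1)[OF causal_exp_step[of c]] in measurable)
  also have "\<dots> = exp (c * of_real x) - exp (c * of_real 0)"
  proof (rule integral_FTC_Icc)
    show "0 \<le> x" using True by simp
    show "((\<lambda>t. exp (c * of_real t)) has_vector_derivative c * exp (c * of_real t)) (at t within {0..x})" for t
      by (rule has_vector_derivative_real_field)
        (auto intro!: derivative_eq_intros simp: mult.commute)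
    show "continuous_on {0..x} (\<lambda>t. c * exp (c * of_real t))" by (intro continuous_intros)
  qed
  finally show ?thesis using True by (simp add: exp_step_def rl_kernel_def)
qed

text \<open>The integral equation of \<open>exp_step c\<close>, convolved with \<open>h\<close>. It
  acts as integration by parts: at a positive \<open>c\<close> it bounds a primitive, at
  \<open>c = - z\<close> it produces the factor \<open>z\<close>.\<close>

lemma conv_exp_step:
  assumes h: "causal h"
  shows "AE x in lborel. conv (exp_step c) h x
    = conv (rl_kernel 1) h x + c * conv (rl_kernel 1) (conv (exp_step c) h) x"
proof -
  let ?p = "rl_kernel 1" and ?e = "exp_step c"
  have p: "causal ?p" by (rule causal_rl_kernel) simp
  note e = causal_exp_step[of c]
  have pe: "causal (conv ?p ?e)" by (rule causal_conv[OF p e])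
  have cpe: "causal (\<lambda>t. c * conv ?p ?e t)" by (rule causal_mult[OF pe]) simp
  have *: "conv ?e h x = conv h (\<lambda>t. ?p t + c * conv ?p ?e t) x" for x
    unfolding exp_step_eq[symmetric] by (rule conv_commute)
  show ?thesis
    using conv_add[OF h p cpe] conv_assoc[OF p e h]
  proof eventually_elim
    case (elim x)
    then show ?case
      unfolding * conv_cmult by (simp add: conv_commute[of h ?p] conv_commute[of h "conv ?p ?e"] *[symmetric])
  qed
qed

text \<open>A set of full measure meets \<open>[a, a + 1]\<close>, so identities that hold almost
  everywhere can be evaluated along points tending to infinity.\<close>

lemma AE_lborel_witness:
  assumes "AE x in lborel. P (x::real)"
  obtains x where "x \<ge> a" "P x"
proof -
  have "\<not> (\<forall>x\<ge>a. \<not> P x)"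
  proof
    assume *: "\<forall>x\<ge>a. \<not> P x"
    from assms have "AE x in lborel. x \<notin> {a..a + 1}"
      by eventually_elim (use * in auto)
    then have "{a..a + 1} \<in> null_sets lborel"
      by (subst AE_iff_null_sets) auto
    then show False by (simp add: null_sets_def)
  qed
  then show ?thesis using that by blast
qed

text \<open>The integral of the exponential bound over \<open>[0, x]\<close> is read off from the
  integral equation of \<open>exp_step\<close>.\<close>

lemma norm_conv_rl_kernel_1_le:
  assumes g: "causal g" and B: "\<And>t. t > 0 \<Longrightarrow> norm (g t) \<le> B * exp (s * t)" and s: "s > 0" and x: "x > 0"
  shows "s * norm (conv (rl_kernel 1) g x) \<le> B * exp (s * x)"
proof -
  have "0 \<le> norm (g 1)" by simp
  also have "\<dots> \<le> B * exp s" using B[of 1] by simp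
  finally have Bnn: "B \<ge> 0" by (simp add: zero_le_mult_iff)
  let ?e = "\<lambda>t. B * Re (indicator {..x} t *\<^sub>R exp_step (of_real s) t)"
  have int: "integrable lborel (\<lambda>t. indicator {..x} t *\<^sub>R exp_step (of_real s) t)"
  proof -
    have "trunc x (exp_step (of_real s)) = (\<lambda>t. indicator {..x} t *\<^sub>R exp_step (of_real s) t)"
      by (auto simp: trunc_def indicator_def)
    then show ?thesis using causalD(3)[OF causal_exp_step[of "of_real s"], of x] by simp
  qed
  have "norm (conv (rl_kernel 1) g x) \<le> (LINT t|lborel. ?e t)"
    unfolding conv_rl_kernel_1[OF causalD(1)[OF g]]
  proof (rule Bochner_Integration.integral_norm_bound_integral)
    have "trunc x g = (\<lambda>t. indicator {..x} t *\<^sub>R g t)"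
      by (auto simp: trunc_def indicator_def)
    then show "integrable lborel (\<lambda>t. indicator {..x} t *\<^sub>R g t)" using causalD(3)[OF g, of x] by simp
    show "integrable lborel ?e" by (intro integrable_mult_right integrable_Re int)
    fix t
    show "norm (indicator {..x} t *\<^sub>R g t) \<le> ?e t"
    proof (cases "t > 0")
      case True
      have "Re (exp (of_real s * of_real t)) = exp (s * t)"
        by (simp add: Re_exp)
      then show ?thesis using B[OF True] True by (simp add: indicator_def exp_step_def)
    qed (use causalD(2)[OF g, of t] in \<open>simp add: exp_step_def\<close>)
  qed
  also have "(LINT t|lborel. ?e t) = B * Re (conv (rl_kernel 1) (exp_step (of_real s)) x)"
    using int causalD(1)[OF causal_exp_step[of "of_real s"]]
    by (simp only: integral_mult_right_zero integral_Re conv_rl_kernel_1)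
  finally have "s * norm (conv (rl_kernel 1) g x) \<le> B * (s * Re (conv (rl_kernel 1) (exp_step (of_real s)) x))"
    using s by (simp add: mult.left_commute mult_left_mono)
  also have "s * Re (conv (rl_kernel 1) (exp_step (of_real s)) x) = exp (s * x) - 1"
  proof -
    have "Re (exp_step (of_real s) x) = Re (rl_kernel 1 x + of_real s * conv (rl_kernel 1) (exp_step (of_real s)) x)"
      using exp_step_eq[of "of_real s" x] by simp
    then show ?thesis using x by (simp add: exp_step_def rl_kernel_def Re_exp)
  qed
  also have "B * (exp (s * x) - 1) \<le> B * exp (s * x)" using Bnn by (intro mult_left_mono) auto
  finally show ?thesis .
qed

text \<open>Beyond some \<open>X\<close> the limit bounds the primitive; before \<open>X\<close> the
  integral of \<open>norm g\<close> up to \<open>X\<close> does.\<close>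

lemma bounded_conv_rl_kernel_1:
  assumes g: "causal g" and lim: "(conv (rl_kernel 1) g \<longlongrightarrow> L) at_top"
  obtains M where "\<And>x. norm (conv (rl_kernel 1) g x) \<le> M"
proof -
  have "\<forall>\<^sub>F x in at_top. dist (conv (rl_kernel 1) g x) L < 1"
    using tendstoD[OF lim zero_less_one] .
  then obtain X where X: "\<And>x. x \<ge> X \<Longrightarrow> dist (conv (rl_kernel 1) g x) L < 1"
    by (auto simp: eventually_at_top_linorder)
  define K where "K = (LINT t|lborel. norm (trunc X g t))"
  have "norm (conv (rl_kernel 1) g x) \<le> max (norm L + 1) K" for x
  proof (cases "x \<ge> X")
    case True
    have "norm (conv (rl_kernel 1) g x) \<le> norm L + dist (conv (rl_kernel 1) g x) L"
      unfolding dist_norm by (metis add.commute diff_add_cancel norm_triangle_ineq)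
    then show ?thesis using X[OF True] by linarith
  next
    case False
    have "norm (conv (rl_kernel 1) g x) \<le> K"
      unfolding conv_rl_kernel_1[OF causalD(1)[OF g]] K_def
    proof (rule Bochner_Integration.integral_norm_bound_integral)
      have "trunc x g = (\<lambda>t. indicator {..x} t *\<^sub>R g t)"
        by (auto simp: trunc_def indicator_def)
      then show "integrable lborel (\<lambda>t. indicator {..x} t *\<^sub>R g t)" using causalD(3)[OF g, of x] by simp
      show "integrable lborel (\<lambda>t. norm (trunc X g t))" using causalD(3)[OF g, of X] by simp
      show "norm (indicator {..x} t *\<^sub>R g t) \<le> norm (trunc X g t)" for t
        using False by (auto simp: trunc_def indicator_def)
    qed
    then show ?thesis by simp
  qed
  then show ?thesis by (rule that)
qed

text \<open>Convergence at \<open>s\<close> bounds the weighted primitive of \<open>f\<close>, and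
  integration by parts converts this into a bound of order \<open>exp (s * x)\<close> for the plain
  primitive, whose transform at \<open>z\<close> is then absolutely convergent. Integration by parts
  at \<open>z\<close>, with vanishing boundary term, identifies its value.\<close>

lemma laplace_primitive:
  assumes f: "causal f" and s: "0 < s" "s < Re z"
    and lim_s: "(conv (rl_kernel 1) (\<lambda>t. exp (- of_real s * of_real t) * f t) \<longlongrightarrow> L') at_top"
    and lim_z: "(conv (rl_kernel 1) (\<lambda>t. exp (- z * of_real t) * f t) \<longlongrightarrow> L) at_top"
  shows "has_bochner_integral lborel (\<lambda>t. exp (- z * of_real t) * conv (rl_kernel 1) f t) (L / z)"
proof -
  let ?p = "rl_kernel 1" and ?G = "conv (rl_kernel 1) f"
  have p: "causal ?p" by (rule causal_rl_kernel) simp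
  have G: "causal ?G" by (rule causal_conv[OF p f])
  have ex: "causal (\<lambda>t. exp (c * of_real t) * g t)" if "causal g" for c g
    by (rule causal_mult[OF that]) (intro continuous_intros)
  have step: "(\<lambda>t. exp (c * of_real t) * ?p t) = exp_step c" for c
    by (auto simp: exp_step_def rl_kernel_def)
  \<comment> \<open>The weighted primitive, multiplied back by its exponential, becomes a
    convolution to which \<open>conv_exp_step\<close> applies.\<close>
  have shift: "exp (c * of_real x) * conv ?p (\<lambda>t. exp (- c * of_real t) * f t) x = conv (exp_step c) f x" for c x
    unfolding exp_mult_conv step by (simp add: mult.assoc[symmetric] exp_add[symmetric])
  obtain M where M: "\<And>x. norm (conv ?p (\<lambda>t. exp (- of_real s * of_real t) * f t) x) \<le> M"
    using bounded_conv_rl_kernel_1[OF ex[OF f] lim_s] by blast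
  have bnd_E: "norm (conv (exp_step (of_real s)) f x) \<le> M * exp (s * x)" for x
    unfolding shift[symmetric] using M[of x] by (simp add: norm_mult mult.commute)
  have bnd_G: "AE x in lborel. x > 0 \<longrightarrow> norm (?G x) \<le> 2 * M * exp (s * x)"
    using conv_exp_step[OF f, of "of_real s"]
  proof eventually_elim
    case (elim x)
    show ?case
    proof
      assume x: "x > 0"
      have "?G x = conv (exp_step (of_real s)) f x - of_real s * conv ?p (conv (exp_step (of_real s)) f) x"
        using elim by simp
      then have "norm (?G x) \<le> norm (conv (exp_step (of_real s)) f x)
          + norm (of_real s * conv ?p (conv (exp_step (of_real s)) f) x)"
        by (simp only: norm_triangle_ineq4)
      also have "\<dots> \<le> M * exp (s * x) + M * exp (s * x)"
        using bnd_E norm_conv_rl_kernel_1_le[OF causal_conv[OF causal_exp_step f] _ s(1) x, of "of_real s" M] s(1)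
        by (intro add_mono) (auto simp: norm_mult)
      finally show "norm (?G x) \<le> 2 * M * exp (s * x)" by simp
    qed
  qed
  \<comment> \<open>The factor \<open>x powr (1 - 1)\<close> is 1 on the positive axis; it gives the
    bound the shape of the Gamma integrand with \<open>a = 1\<close>.\<close>
  have bnd_H: "AE x in lborel. norm (exp (- z * of_real x) * ?G x)
      \<le> 2 * M * (indicator {0<..} x * (x powr (1 - 1) * exp (- (Re z - s) * x)))"
    using bnd_G
  proof eventually_elim
    case (elim x)
    show ?case
    proof (cases "x > 0")
      case True
      have "norm (exp (- z * of_real x) * ?G x) = exp (- Re z * x) * norm (?G x)"
        by (simp add: norm_mult)
      also have "\<dots> \<le> exp (- Re z * x) * (2 * M * exp (s * x))"
        using elim True by (intro mult_left_mono) auto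
      also have "\<dots> = 2 * M * exp (- (Re z - s) * x)"
        by (simp add: exp_add[symmetric] algebra_simps)
      finally show ?thesis using True by simp
    qed (use causalD(2)[OF G, of x] in simp)
  qed
  have intH: "integrable lborel (\<lambda>t. exp (- z * of_real t) * ?G t)"
  proof (rule Bochner_Integration.integrable_bound)
    show "integrable lborel (\<lambda>x. 2 * M * (indicator {0<..} x * (x powr (1 - 1) * exp (- (Re z - s) * x))))"
      using has_bochner_integral_rl_kernel_real[of 1 "Re z - s"] s
      by (intro integrable_mult_right) (simp add: has_bochner_integral_iff)
    show "(\<lambda>t. exp (- z * of_real t) * ?G t) \<in> borel_measurable lborel"
      using causalD(1)[OF ex[OF G, of "- z"]] by simp
    show "AE x in lborel. norm (exp (- z * of_real x) * ?G x)
      \<le> norm (2 * M * (indicator {0<..} x * (x powr (1 - 1) * exp (- (Re z - s) * x))))"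
      using bnd_H by eventually_elim (unfold real_norm_def, erule order_trans, rule abs_ge_self)
  qed
  define I where "I = (LINT t|lborel. exp (- z * of_real t) * ?G t)"
  let ?H = "\<lambda>t. exp (- z * of_real t) * ?G t"
  let ?P = "\<lambda>x. norm (?H x) \<le> 2 * M * exp (- (Re z - s) * x) \<and>
      conv ?p (\<lambda>t. exp (- z * of_real t) * f t) x = ?H x + z * conv ?p ?H x"
  have "AE x in lborel. x > 0 \<longrightarrow> norm (?H x) \<le> 2 * M * exp (- (Re z - s) * x) \<and>
      conv ?p (\<lambda>t. exp (- z * of_real t) * f t) x = ?H x + z * conv ?p ?H x"
    using bnd_H conv_exp_step[OF ex[OF f], of "- z" "- z"]
  proof eventually_elim
    case (elim x)
    have "conv (exp_step (- z)) (\<lambda>t. exp (- z * of_real t) * f t) = ?H"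
      unfolding exp_mult_conv step ..
    then show ?case using elim by auto
  qed
  then have ae: "AE x in lborel. x > 0 \<longrightarrow> ?P x" .
  \<comment> \<open>The formula may fail on a null set, so it is evaluated on a sequence of good
    points; this suffices because both limits at infinity exist.\<close>
  have "\<exists>x. x \<ge> real n + 1 \<and> ?P x" for n
  proof -
    obtain x where "x \<ge> real n + 1" "x > 0 \<longrightarrow> ?P x"
      using AE_lborel_witness[OF ae] by blast
    then show ?thesis by (intro exI[of _ x]) auto
  qed
  then have "\<exists>X. \<forall>n. X n \<ge> real n + 1 \<and> ?P (X n)" by (intro choice) blast
  then obtain X where X: "\<And>n. X n \<ge> real n + 1"
    "\<And>n. norm (?H (X n)) \<le> 2 * M * exp (- (Re z - s) * X n)"
    "\<And>n. conv ?p (\<lambda>t. exp (- z * of_real t) * f t) (X n) = ?H (X n) + z * conv ?p ?H (X n)"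
    by blast
  have X_top: "filterlim X at_top sequentially"
  proof (rule filterlim_at_top_mono[OF filterlim_real_sequentially])
    have "real n \<le> X n" for n using X(1)[of n] by simp
    then show "\<forall>\<^sub>F n in sequentially. real n \<le> X n" by simp
  qed
  have "filterlim (\<lambda>x::real. - (Re z - s) * x) at_bot at_top"
    by (rule filterlim_tendsto_neg_mult_at_bot[OF tendsto_const _ filterlim_ident]) (use s in simp)
  then have "((\<lambda>x::real. exp (- (Re z - s) * x)) \<longlongrightarrow> 0) at_top"
    by (rule filterlim_compose[OF exp_at_bot])
  then have "(\<lambda>n. exp (- (Re z - s) * X n)) \<longlonglongrightarrow> 0"
    by (rule filterlim_compose[OF _ X_top])
  then have "(\<lambda>n. 2 * M * exp (- (Re z - s) * X n)) \<longlonglongrightarrow> 0"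
    by (rule tendsto_mult_right_zero)
  then have H0: "(\<lambda>n. ?H (X n)) \<longlonglongrightarrow> 0"
    by (rule Lim_null_comparison[rotated]) (use X(2) in auto)
  have "((\<lambda>x. conv ?p ?H x) \<longlongrightarrow> I) at_top"
    unfolding conv_rl_kernel_1[OF causalD(1)[OF ex[OF G]]] I_def
    by (rule tendsto_integral_at_top) (use intH in auto)
  then have "(\<lambda>n. ?H (X n) + z * conv ?p ?H (X n)) \<longlonglongrightarrow> 0 + z * I"
    by (intro tendsto_add H0 tendsto_mult[OF tendsto_const] filterlim_compose[OF _ X_top])
  moreover have "(\<lambda>n. conv ?p (\<lambda>t. exp (- z * of_real t) * f t) (X n)) \<longlonglongrightarrow> L"
    by (rule filterlim_compose[OF lim_z X_top])
  ultimately have "L = z * I"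
    unfolding X(3) by (auto dest: LIMSEQ_unique)
  moreover have "z \<noteq> 0" using s by auto
  ultimately show ?thesis using intH by (simp add: has_bochner_integral_iff I_def)
qed

section \<open>Causal representatives of functions on the half-line\<close>

definition causal_rep :: "(real \<Rightarrow> complex) \<Rightarrow> (real \<Rightarrow> complex) \<Rightarrow> bool" where
  "causal_rep g g' \<longleftrightarrow> causal g' \<and> (AE x in lebesgue. 0 < x \<longrightarrow> g x = g' x)"

lemma AE_lebesgue_iff: "(AE x in lebesgue. P x) \<longleftrightarrow> (AE x in lborel. P x)"
  by (rule AE_completion_iff)

lemma AE_lebesgue_neq: "AE x in lebesgue. x \<noteq> (c::real)"
  by (simp add: AE_lebesgue_iff AE_lborel_singleton)

lemma
  fixes F F' :: "real \<Rightarrow> complex"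
  assumes F': "F' \<in> borel_measurable borel" and ae: "AE x in lebesgue. F x = F' x"
  shows lebesgue_integral_rep: "(LINT x|lebesgue. F x) = (LINT x|lborel. F' x)"
    and lebesgue_integrable_rep: "integrable lebesgue F \<longleftrightarrow> integrable lborel F'"
proof -
  have m': "F' \<in> borel_measurable lebesgue" using F' by (simp add: measurable_completion)
  have m: "F \<in> borel_measurable lebesgue"
    by (rule borel_measurable_AE[OF m']) (use ae in \<open>eventually_elim, simp\<close>)
  show "(LINT x|lebesgue. F x) = (LINT x|lborel. F' x)"
    using integral_cong_AE[OF m m' ae] F' by (simp add: integral_completion)
  show "integrable lebesgue F \<longleftrightarrow> integrable lborel F'"
    using integrable_cong_AE[OF m m' ae] F' by (simp add: integrable_completion)
qed

text \<open>Local integrability gives measurability on bounded intervals only; on the half-line the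
  function is the pointwise limit of its cut-offs.\<close>

lemma causal_rep_exists:
  assumes "\<And>X. X > 0 \<Longrightarrow> set_integrable lebesgue {0..X} g"
  obtains g' where "causal_rep g g'"
proof -
  have m: "(\<lambda>t. indicator {0..real (Suc n)} t *\<^sub>R g t) \<in> borel_measurable lebesgue" for n
    using assms[of "real (Suc n)"] unfolding set_integrable_def
    by (intro borel_measurable_integrable) simp
  have "(\<lambda>t. indicator {0..} t *\<^sub>R g t) \<in> borel_measurable lebesgue"
  proof (rule borel_measurable_LIMSEQ_metric[OF m])
    fix t
    obtain N where N: "t \<le> real N" using real_arch_simple by blast
    have "\<forall>\<^sub>F n in sequentially. indicator {0..real (Suc n)} t *\<^sub>R g t = indicator {0..} t *\<^sub>R g t"
      using eventually_ge_at_top[of N]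
    proof eventually_elim
      case (elim n)
      then have "t \<le> real (Suc n)" using N by linarith
      then show ?case by (simp add: indicator_def)
    qed
    then show "(\<lambda>n. indicator {0..real (Suc n)} t *\<^sub>R g t) \<longlonglongrightarrow> indicator {0..} t *\<^sub>R g t"
      by (rule tendsto_eventually)
  qed
  then obtain b where b: "b \<in> borel_measurable borel"
    and ae: "AE t in lborel. indicator {0..} t *\<^sub>R g t = b t"
    by (rule lebesgue_borel_rep)
  define g' where "g' t = (if t > 0 then b t else 0)" for t
  have g': "g' \<in> borel_measurable borel" unfolding g'_def[abs_def] using b by measurable
  have ae': "AE t in lebesgue. 0 < t \<longrightarrow> g t = g' t"
    unfolding AE_lebesgue_iff using ae by eventually_elim (auto simp: g'_def indicator_def)
  have "causal g'"
    unfolding causal_def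
  proof (intro conjI allI impI g')
    show "g' t = 0" if "t \<le> 0" for t using that by (simp add: g'_def)
    fix X
    have ae_tr: "AE t in lebesgue. indicator {..X} t *\<^sub>R (indicator {0..max 1 X} t *\<^sub>R g t) = trunc X g' t"
      using ae' AE_lebesgue_neq[of 0]
      by eventually_elim (auto simp: indicator_def trunc_def g'_def)
    have m_tr: "trunc X g' \<in> borel_measurable borel"
      unfolding trunc_def[abs_def] using g' by measurable
    have "integrable lebesgue (\<lambda>t. indicator {..X} t *\<^sub>R (indicator {0..max 1 X} t *\<^sub>R g t))"
      using assms[of "max 1 X"] unfolding set_integrable_def
      by (intro integrable_mult_indicator[of "{..X}"]) simp_all
    then show "integrable lborel (trunc X g')"
      using lebesgue_integrable_rep[OF m_tr ae_tr] by blast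
  qed
  with ae' show ?thesis by (intro that) (simp add: causal_rep_def)
qed

lemma causal_rep_unique:
  assumes "causal_rep g g'" "causal_rep g g''"
  shows "AE x in lborel. g' x = g'' x"
proof -
  have c: "causal g'" "causal g''"
    and ae: "AE x in lborel. 0 < x \<longrightarrow> g x = g' x" "AE x in lborel. 0 < x \<longrightarrow> g x = g'' x"
    using assms by (auto simp: causal_rep_def AE_lebesgue_iff)
  from ae show ?thesis
  proof eventually_elim
    case (elim x)
    then show ?case using causalD(2)[OF c(1), of x] causalD(2)[OF c(2), of x] by (cases "0 < x") auto
  qed
qed

text \<open>With an exponential weight this is a truncated Laplace integral, with weight 1 a
  primitive.\<close>

lemma causal_rep_weighted_integral:
  assumes g: "causal_rep g g'" and e: "continuous_on UNIV e"
  shows "(LINT t:{0..X}|lebesgue. g t * e t) = conv (rl_kernel 1) (\<lambda>t. e t * g' t) X"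
proof -
  have c: "causal g'" and ae: "AE x in lebesgue. 0 < x \<longrightarrow> g x = g' x"
    using g by (auto simp: causal_rep_def)
  have m: "(\<lambda>t. e t * g' t) \<in> borel_measurable borel"
    by (rule causalD(1)[OF causal_mult[OF c e]])
  show ?thesis
    unfolding conv_rl_kernel_1[OF m] set_lebesgue_integral_def
  proof (rule lebesgue_integral_rep)
    show "(\<lambda>t. indicator {..X} t *\<^sub>R (e t * g' t)) \<in> borel_measurable borel" using m by measurable
    show "AE t in lebesgue. indicator {0..X} t *\<^sub>R (g t * e t) = indicator {..X} t *\<^sub>R (e t * g' t)"
      using ae AE_lebesgue_neq[of 0]
      by eventually_elim (use causalD(2)[OF c] in \<open>auto simp: indicator_def not_le\<close>)
  qed
qed

text \<open>Order 0 is treated apart because the formula for the kernel does not produce a point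
  mass at \<open>a = 0\<close>.\<close>

definition rl_op :: "real \<Rightarrow> (real \<Rightarrow> complex) \<Rightarrow> real \<Rightarrow> complex" where
  "rl_op a f = (if a = 0 then f else conv (rl_kernel a) f)"

lemma causal_rl_op: "0 \<le> a \<Longrightarrow> causal f \<Longrightarrow> causal (rl_op a f)"
  by (auto simp: rl_op_def intro!: causal_conv causal_rl_kernel)

text \<open>For \<open>b > 0\<close> the two sides agree at every \<open>x\<close>, since their
  integrands agree almost everywhere; only \<open>b = 0\<close> inherits an exceptional set.\<close>

lemma causal_rep_rl_integral:
  assumes g: "causal_rep g g'" and b: "0 \<le> b"
  shows "causal_rep (rl_integral b g) (rl_op b g')"
proof (cases "b = 0")
  case True
  then show ?thesis using g by (simp add: rl_integral_def rl_op_def)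
next
  case False
  with b have b: "b > 0" by simp
  have c: "causal g'" and ae: "AE x in lebesgue. 0 < x \<longrightarrow> g x = g' x"
    using g by (auto simp: causal_rep_def)
  have [measurable]: "g' \<in> borel_measurable borel" by (rule causalD(1)[OF c])
  have "rl_integral b g x = rl_op b g' x" for x
  proof -
    have G: "Gamma b > 0" by (rule Gamma_real_pos[OF b])
    have "(LINT t:{0..x}|lebesgue. ((x - t) powr (b - 1)) *\<^sub>R g t)
        = (LINT t|lborel. of_real (Gamma b) * (rl_kernel b (x - t) * g' t))"
      unfolding set_lebesgue_integral_def
    proof (rule lebesgue_integral_rep)
      show "(\<lambda>t. of_real (Gamma b) * (rl_kernel b (x - t) * g' t)) \<in> borel_measurable borel" by measurable
      show "AE t in lebesgue. indicator {0..x} t *\<^sub>R ((x - t) powr (b - 1)) *\<^sub>R g t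
          = of_real (Gamma b) * (rl_kernel b (x - t) * g' t)"
        using ae AE_lebesgue_neq[of 0] AE_lebesgue_neq[of x]
      proof eventually_elim
        case (elim t)
        then show ?case
          using causalD(2)[OF c, of t] G
          by (cases "0 < t \<and> t < x") (auto simp: rl_kernel_def scaleR_conv_of_real)
      qed
    qed
    then show ?thesis
      using False G by (simp add: rl_integral_def rl_op_def conv_def scaleR_conv_of_real)
  qed
  then show ?thesis
    using causal_rl_op[OF less_imp_le[OF b] c] by (simp add: causal_rep_def)
qed

subsection \<open>Absolutely continuous representatives\<close>

lemma abs_cont_on_subset: "abs_cont_on a b h \<Longrightarrow> b' \<le> b \<Longrightarrow> abs_cont_on a b' h"
proof -
  assume h: "abs_cont_on a b h" and le: "b' \<le> b"
  have *: "(\<forall>(u, v)\<in>P. a \<le> u \<and> u \<le> v \<and> v \<le> b') \<Longrightarrow> (\<forall>(u, v)\<in>P. a \<le> u \<and> u \<le> v \<and> v \<le> b)" for P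
    using le by fastforce
  show ?thesis
    unfolding abs_cont_on_def
  proof (intro allI impI)
    fix e :: real assume "e > 0"
    then obtain d where "d > 0" and d: "\<forall>P. finite P \<longrightarrow> (\<forall>(u, v)\<in>P. a \<le> u \<and> u \<le> v \<and> v \<le> b) \<longrightarrow>
        disjoint_family_on (\<lambda>(u, v). {u<..<v}) P \<longrightarrow>
        (\<Sum>(u, v)\<in>P. v - u) < d \<longrightarrow> (\<Sum>(u, v)\<in>P. norm (h v - h u)) < e"
      using h unfolding abs_cont_on_def by blast
    then show "\<exists>d>0. \<forall>P. finite P \<longrightarrow> (\<forall>(u, v)\<in>P. a \<le> u \<and> u \<le> v \<and> v \<le> b') \<longrightarrow>
        disjoint_family_on (\<lambda>(u, v). {u<..<v}) P \<longrightarrow>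
        (\<Sum>(u, v)\<in>P. v - u) < d \<longrightarrow> (\<Sum>(u, v)\<in>P. norm (h v - h u)) < e"
      using * by (intro exI[of _ d]) simp
  qed
qed

lemma abs_cont_on_imp_continuous:
  assumes h: "abs_cont_on a b h"
  shows "continuous_on {a..b} h"
  unfolding continuous_on_iff
proof (intro ballI allI impI)
  fix x and e :: real assume x: "x \<in> {a..b}" and "e > 0"
  then obtain d where "d > 0" and d: "\<forall>P. finite P \<longrightarrow> (\<forall>(u, v)\<in>P. a \<le> u \<and> u \<le> v \<and> v \<le> b) \<longrightarrow>
        disjoint_family_on (\<lambda>(u, v). {u<..<v}) P \<longrightarrow>
        (\<Sum>(u, v)\<in>P. v - u) < d \<longrightarrow> (\<Sum>(u, v)\<in>P. norm (h v - h u)) < e"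
    using h unfolding abs_cont_on_def by blast
  have single: "norm (h v - h u) < e" if "a \<le> u" "u \<le> v" "v \<le> b" "v - u < d" for u v
    using d[rule_format, of "{(u, v)}"] that by (simp add: disjoint_family_on_def)
  have "dist (h y) (h x) < e" if "y \<in> {a..b}" "dist y x < d" for y
    using single[of x y] single[of y x] that x
    by (cases "x \<le> y") (auto simp: dist_norm norm_minus_commute)
  then show "\<exists>d>0. \<forall>y\<in>{a..b}. dist y x < d \<longrightarrow> dist (h y) (h x) < e"
    using \<open>d > 0\<close> by blast
qed

text \<open>A continuous difference that is nonzero at one point stays nonzero on a relative
  neighbourhood, which has positive measure.\<close>

lemma continuous_on_eq_if_AE_eq:
  fixes h h' :: "real \<Rightarrow> complex"
  assumes c: "continuous_on {0..Z} h" "continuous_on {0..Z} h'"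
    and ae: "AE x in lebesgue. x \<in> {0<..<Z} \<longrightarrow> h x = h' x" and Z: "0 < Z" and x: "x \<in> {0..Z}"
  shows "h x = h' x"
proof (rule ccontr)
  assume ne: "h x \<noteq> h' x"
  let ?d = "\<lambda>x. norm (h x - h' x)"
  have "continuous_on {0..Z} ?d" by (intro continuous_intros c)
  moreover have "?d x > 0" using ne by simp
  ultimately obtain \<delta> where \<delta>: "\<delta> > 0" "\<And>y. y \<in> {0..Z} \<Longrightarrow> dist y x < \<delta> \<Longrightarrow> dist (?d y) (?d x) < ?d x"
    using x unfolding continuous_on_iff by blast
  \<comment> \<open>This part of the neighbourhood inside \<open>(0, Z)\<close> is nonempty even
    when \<open>x\<close> is an end point.\<close>
  let ?I = "{max 0 (x - \<delta>)<..<min Z (x + \<delta>)}"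
  have "h y \<noteq> h' y" if "y \<in> ?I" for y
  proof
    assume "h y = h' y"
    moreover have "dist y x < \<delta>" "y \<in> {0..Z}" using that by (auto simp: dist_real_def abs_less_iff)
    then have "dist (?d y) (?d x) < ?d x" by (intro \<delta>(2))
    ultimately show False by (simp add: dist_real_def)
  qed
  then have "AE y in lborel. y \<notin> ?I"
    using ae unfolding AE_lebesgue_iff by (auto elim!: eventually_mono)
  then have "?I \<in> null_sets lborel" by (subst AE_iff_null_sets) auto
  then have "emeasure lborel ?I = 0" by (simp add: null_sets_def)
  moreover have less: "max 0 (x - \<delta>) < min Z (x + \<delta>)" using \<delta>(1) Z x by auto
  ultimately have "min Z (x + \<delta>) - max 0 (x - \<delta>) \<le> 0"
    using emeasure_lborel_Ioo[OF less_imp_le[OF less]] by (simp only: ennreal_eq_0_iff)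
  then show False using less by linarith
qed

text \<open>Different end points are allowed so that \<open>ac_value_0\<close> does not depend on
  the interval; by continuity the equality includes the point 0.\<close>

lemma ac_rep_unique:
  assumes "ac_rep X g h" "ac_rep X' g' h'" "0 < Z" "Z \<le> X" "Z \<le> X'"
    and ae: "AE x in lebesgue. x \<in> {0<..<Z} \<longrightarrow> g x = g' x" and x: "x \<in> {0..Z}"
  shows "h x = h' x"
proof (rule continuous_on_eq_if_AE_eq[OF _ _ _ \<open>0 < Z\<close> x])
  show "continuous_on {0..Z} h" "continuous_on {0..Z} h'"
    using assms by (auto simp: ac_rep_def intro!: abs_cont_on_imp_continuous intro: abs_cont_on_subset)
  have "AE x in lebesgue. x \<in> {0<..<X} \<longrightarrow> g x = h x" "AE x in lebesgue. x \<in> {0<..<X'} \<longrightarrow> g' x = h' x"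
    using assms by (auto simp: ac_rep_def)
  with ae show "AE x in lebesgue. x \<in> {0<..<Z} \<longrightarrow> h x = h' x"
    by eventually_elim (use assms in auto)
qed

lemma ac_rep_subset:
  assumes "ac_rep X g h" "Y \<le> X"
  shows "ac_rep Y g h"
  unfolding ac_rep_def
proof
  show "abs_cont_on 0 Y h" using assms by (auto simp: ac_rep_def intro: abs_cont_on_subset)
  have "AE x in lebesgue. x \<in> {0<..<X} \<longrightarrow> g x = h x" using assms by (simp add: ac_rep_def)
  then show "AE x in lebesgue. x \<in> {0<..<Y} \<longrightarrow> g x = h x"
    by eventually_elim (use assms(2) in auto)
qed

lemma ac_value_0_eq:
  assumes "ac_rep X g h" "X > 0"
  shows "ac_value_0 g = h 0"
  unfolding ac_value_0_def
proof (rule the_equality)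
  show "\<exists>X>0. \<exists>h'. ac_rep X g h' \<and> h' 0 = h 0" using assms by blast
  fix c assume "\<exists>X>0. \<exists>h. ac_rep X g h \<and> h 0 = c"
  then obtain X' h' where "X' > 0" "ac_rep X' g h'" "h' 0 = c" by blast
  then show "c = h 0"
    using ac_rep_unique[of X g h X' g h' "min X X'" 0] assms by simp
qed

text \<open>The condition that \<open>ac_deriv\<close> imposes for a single
  \<open>Y\<close>.\<close>

definition is_ac_deriv :: "real \<Rightarrow> (real \<Rightarrow> complex) \<Rightarrow> (real \<Rightarrow> complex) \<Rightarrow> bool" where
  "is_ac_deriv Y g \<phi> \<longleftrightarrow> set_integrable lebesgue {0..Y} \<phi> \<and>
     (\<exists>h. ac_rep Y g h \<and> (\<forall>x\<in>{0..Y}. h x = h 0 + (LINT t:{0..x}|lebesgue. \<phi> t)))"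

lemma is_ac_deriv_subset:
  assumes "is_ac_deriv X g \<phi>" "Y \<le> X"
  shows "is_ac_deriv Y g \<phi>"
proof -
  obtain h where h: "set_integrable lebesgue {0..X} \<phi>" "ac_rep X g h"
    "\<And>x. x \<in> {0..X} \<Longrightarrow> h x = h 0 + (LINT t:{0..x}|lebesgue. \<phi> t)"
    using assms(1) unfolding is_ac_deriv_def by blast
  have "set_integrable lebesgue {0..Y} \<phi>"
    by (rule set_integrable_subset[OF h(1)]) (use assms(2) in auto)
  moreover have "\<forall>x\<in>{0..Y}. h x = h 0 + (LINT t:{0..x}|lebesgue. \<phi> t)"
    using assms(2) by (intro ballI h(3)) auto
  ultimately show ?thesis
    using ac_rep_subset[OF h(2) assms(2)] unfolding is_ac_deriv_def by blast
qed

lemma is_ac_deriv_exists: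
  assumes "g \<in> AC_space X" "X > 0"
  obtains \<phi> where "is_ac_deriv X g \<phi>"
proof -
  obtain h where h: "ac_rep X g h" using assms by (auto simp: AC_space_def)
  then have "abs_cont_on 0 X h" by (simp add: ac_rep_def)
  then obtain \<phi> where "set_integrable lebesgue {0..X} \<phi>"
    "\<And>x. x \<in> {0..X} \<Longrightarrow> h x = h 0 + (LINT t:{0..x}|lebesgue. \<phi> t)"
    using abs_cont_on_imp_integral[of X h] assms(2) by (metis less_imp_le)
  then have "is_ac_deriv X g \<phi>" using h unfolding is_ac_deriv_def by blast
  then show ?thesis by (rule that)
qed

text \<open>The representatives agree at every point, so the difference of the derivatives
  integrates to 0 over each \<open>[0, x]\<close>.\<close>

lemma is_ac_deriv_unique:
  assumes d: "is_ac_deriv X g \<phi>" "is_ac_deriv X g' \<phi>'" and X: "X > 0"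
    and ae: "AE x in lebesgue. x \<in> {0<..<X} \<longrightarrow> g x = g' x"
  shows "AE x in lebesgue. x \<in> {0..X} \<longrightarrow> \<phi> x = \<phi>' x"
proof -
  obtain h where h: "ac_rep X g h" "\<And>x. x \<in> {0..X} \<Longrightarrow> h x = h 0 + (LINT t:{0..x}|lebesgue. \<phi> t)"
    using d unfolding is_ac_deriv_def by blast+
  obtain h' where h': "ac_rep X g' h'" "\<And>x. x \<in> {0..X} \<Longrightarrow> h' x = h' 0 + (LINT t:{0..x}|lebesgue. \<phi>' t)"
    using d unfolding is_ac_deriv_def by blast+
  have i: "set_integrable lebesgue {0..X} \<phi>" "set_integrable lebesgue {0..X} \<phi>'"
    using d unfolding is_ac_deriv_def by blast+
  have "AE x in lebesgue. x \<in> {0..X} \<longrightarrow> \<phi> x - \<phi>' x = 0"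
  proof (rule AE_zero_if_integrals_zero)
    show "set_integrable lebesgue {0..X} (\<lambda>x. \<phi> x - \<phi>' x)" using i by (rule set_integral_diff)
    fix x assume x: "x \<in> {0..X}"
    have "set_integrable lebesgue {0..x} \<phi>" "set_integrable lebesgue {0..x} \<phi>'"
      using i x by (auto intro: set_integrable_subset)
    then have "(LINT t:{0..x}|lebesgue. \<phi> t - \<phi>' t) = (LINT t:{0..x}|lebesgue. \<phi> t) - (LINT t:{0..x}|lebesgue. \<phi>' t)"
      by (rule set_integral_diff)
    also have "\<dots> = (h x - h 0) - (h' x - h' 0)" using h(2)[OF x] h'(2)[OF x] by simp
    also have "\<dots> = 0"
      using ac_rep_unique[OF h(1) h'(1) X _ _ ae] x by simp
    finally show "(LINT t:{0..x}|lebesgue. \<phi> t - \<phi>' t) = 0" .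
  qed
  then show ?thesis by eventually_elim simp
qed

lemma ac_deriv_interval:
  assumes "g \<in> AC_space X" "X > 0"
  shows "is_ac_deriv X g (ac_deriv {0..X} g)"
proof -
  obtain \<phi> where "is_ac_deriv X g \<phi>" by (rule is_ac_deriv_exists[OF assms])
  then have "\<exists>\<phi>. \<forall>Y\<in>{0..X}. Y > 0 \<longrightarrow> is_ac_deriv Y g \<phi>"
    by (intro exI[of _ \<phi>]) (auto intro: is_ac_deriv_subset)
  then have "\<forall>Y\<in>{0..X}. Y > 0 \<longrightarrow> is_ac_deriv Y g (ac_deriv {0..X} g)"
    unfolding ac_deriv_def is_ac_deriv_def by (rule someI_ex)
  then show ?thesis using assms(2) by simp
qed

text \<open>The choice by \<open>SOME\<close> needs one function that works for all \<open>Y\<close>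
  at once. Derivatives on the intervals \<open>[0, n + 1]\<close> are pasted together; they are
  compatible up to null sets, and only countably many comparisons occur.\<close>

lemma ac_deriv_half_line:
  assumes g: "\<And>X. X > 0 \<Longrightarrow> g \<in> AC_space X" and X: "X > 0"
  shows "is_ac_deriv X g (ac_deriv {0..} g)"
proof -
  have "\<exists>\<phi>. is_ac_deriv (real (Suc n)) g \<phi>" for n
    using is_ac_deriv_exists[OF g, of "real (Suc n)"] by (metis of_nat_0_less_iff zero_less_Suc)
  then obtain p where p: "\<And>n. is_ac_deriv (real (Suc n)) g (p n)" by metis
  define \<phi> where "\<phi> t = p (nat \<lceil>t\<rceil>) t" for t
  have "is_ac_deriv (real (Suc N)) g \<phi>" for N
  proof -
    \<comment> \<open>For \<open>t \<le> Suc N\<close> the index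
      \<open>nat \<lceil>t\<rceil>\<close> can be as large as \<open>Suc N\<close>, hence the
      comparison with \<open>p (Suc N)\<close> rather than \<open>p N\<close>.\<close>
    have "AE t in lebesgue. t \<in> {0..real (Suc m)} \<longrightarrow> p m t = p (Suc N) t" if "m \<le> Suc N" for m
      using is_ac_deriv_unique[OF p[of m] is_ac_deriv_subset[OF p[of "Suc N"]], of] that by simp
    then have "AE t in lebesgue. \<forall>m. m \<le> Suc N \<longrightarrow> t \<in> {0..real (Suc m)} \<longrightarrow> p m t = p (Suc N) t"
      unfolding AE_all_countable by auto
    then have ae: "AE t in lebesgue. t \<in> {0..real (Suc N)} \<longrightarrow> \<phi> t = p (Suc N) t"
    proof eventually_elim
      case (elim t)
      show ?case
      proof
        assume t: "t \<in> {0..real (Suc N)}"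
        have "nat \<lceil>t\<rceil> \<le> Suc N" "t \<le> real (Suc (nat \<lceil>t\<rceil>))"
          using t by (auto simp: nat_le_iff ceiling_le_iff) linarith+
        then show "\<phi> t = p (Suc N) t"
          unfolding \<phi>_def using elim[rule_format, of "nat \<lceil>t\<rceil>"] t by (simp only: atLeastAtMost_iff)
      qed
    qed
    have d: "is_ac_deriv (real (Suc N)) g (p (Suc N))" by (rule is_ac_deriv_subset[OF p]) simp
    have ae_x: "AE t in lebesgue. indicator {0..x} t *\<^sub>R \<phi> t = indicator {0..x} t *\<^sub>R p (Suc N) t"
      if "x \<le> real (Suc N)" for x
      using ae by eventually_elim (use that in \<open>auto simp: indicator_def\<close>)
    have m: "(\<lambda>t. indicator {0..x} t *\<^sub>R p (Suc N) t) \<in> borel_measurable lebesgue"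
      if "x \<le> real (Suc N)" for x
    proof -
      have "set_integrable lebesgue {0..x} (p (Suc N))"
        by (rule set_integrable_subset[of lebesgue "{0..real (Suc N)}"])
          (use d that in \<open>unfold is_ac_deriv_def, auto\<close>)
      then show ?thesis unfolding set_integrable_def by (rule borel_measurable_integrable)
    qed
    have m': "(\<lambda>t. indicator {0..x} t *\<^sub>R \<phi> t) \<in> borel_measurable lebesgue" if "x \<le> real (Suc N)" for x
      by (rule borel_measurable_AE[OF m[OF that]]) (rule eventually_mono[OF ae_x[OF that]], rule sym)
    obtain h where h: "set_integrable lebesgue {0..real (Suc N)} (p (Suc N))" "ac_rep (real (Suc N)) g h"
      "\<And>x. x \<in> {0..real (Suc N)} \<Longrightarrow> h x = h 0 + (LINT t:{0..x}|lebesgue. p (Suc N) t)"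
      using d unfolding is_ac_deriv_def by blast
    have "set_integrable lebesgue {0..real (Suc N)} \<phi>"
      using h(1) unfolding set_integrable_def
      by (subst integrable_cong_AE[OF m' m ae_x]) auto
    moreover have eq: "(LINT t:{0..x}|lebesgue. \<phi> t) = (LINT t:{0..x}|lebesgue. p (Suc N) t)"
      if "x \<in> {0..real (Suc N)}" for x
      unfolding set_lebesgue_integral_def using that
      by (intro integral_cong_AE m m' ae_x) auto
    have "\<forall>x\<in>{0..real (Suc N)}. h x = h 0 + (LINT t:{0..x}|lebesgue. \<phi> t)"
      using h(3) by (intro ballI) (simp only: eq)
    ultimately show ?thesis using h(2) unfolding is_ac_deriv_def by blast
  qed
  then have "is_ac_deriv Y g \<phi>" for Y
  proof -
    obtain N where "Y \<le> real N" using real_arch_simple by blast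
    then have "Y \<le> real (Suc N)" by simp
    with \<open>\<And>N. is_ac_deriv (real (Suc N)) g \<phi>\<close> show ?thesis by (rule is_ac_deriv_subset)
  qed
  then have "\<exists>\<phi>. \<forall>Y\<in>{0..}. Y > 0 \<longrightarrow> is_ac_deriv Y g \<phi>" by blast
  then have "\<forall>Y\<in>{0..}. Y > 0 \<longrightarrow> is_ac_deriv Y g (ac_deriv {0..} g)"
    unfolding ac_deriv_def is_ac_deriv_def by (rule someI_ex)
  then show ?thesis using X by simp
qed

subsection \<open>The operator identity\<close>

lemma rl_op_cong_AE:
  assumes "AE x in lborel. f x = g x" "causal f" "causal g"
  shows "AE x in lborel. rl_op a f x = rl_op a g x"
  using assms(1) conv_cong_AE[OF assms(1), of "rl_kernel a"] causalD(1)[OF assms(2)] causalD(1)[OF assms(3)]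
  by (auto simp: rl_op_def)

lemma rl_op_add:
  assumes "0 \<le> a" "causal f" "causal g"
  shows "AE x in lborel. rl_op a (\<lambda>t. f t + g t) x = rl_op a f x + rl_op a g x"
  using conv_add[OF causal_rl_kernel assms(2,3), of a] assms(1) by (auto simp: rl_op_def)

lemma rl_op_cmult: "rl_op a (\<lambda>t. c * f t) = (\<lambda>t. c * rl_op a f t)"
  by (auto simp: rl_op_def conv_cmult)

lemma rl_op_kernel: "0 \<le> a \<Longrightarrow> 0 < b \<Longrightarrow> rl_op a (rl_kernel b) = rl_kernel (a + b)"
  by (auto simp: rl_op_def conv_rl_kernel)

lemma rl_op_rl_op:
  assumes a: "0 \<le> a" and b: "0 \<le> b" and f: "causal f"
  shows "AE x in lborel. rl_op a (rl_op b f) x = rl_op (a + b) f x"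
proof (cases "a = 0 \<or> b = 0")
  case True
  then show ?thesis by (auto simp: rl_op_def)
next
  case False
  then have "a > 0" "b > 0" using a b by auto
  then show ?thesis
    using conv_assoc[OF causal_rl_kernel causal_rl_kernel f, of a b]
    by (simp add: rl_op_def conv_rl_kernel)
qed

lemma causal_cmult: "causal f \<Longrightarrow> causal (\<lambda>t. c * f t)"
  by (rule causal_mult) simp_all

lemma causal_sum: "(\<And>i. i \<in> A \<Longrightarrow> causal (f i)) \<Longrightarrow> causal (\<lambda>t. \<Sum>i\<in>A. f i t)"
  by (induction A rule: infinite_finite_induct) (auto intro: causal_zero causal_add)

lemma rl_op_sum:
  assumes "0 \<le> a" "finite A" "\<And>i. i \<in> A \<Longrightarrow> causal (f i)"
  shows "AE x in lborel. rl_op a (\<lambda>t. \<Sum>i\<in>A. f i t) x = (\<Sum>i\<in>A. rl_op a (f i) x)"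
  using assms(2,3)
proof (induction A rule: finite_induct)
  case empty
  then show ?case by (simp add: rl_op_def conv_def)
next
  case (insert i A)
  have "AE x in lborel. rl_op a (\<lambda>t. f i t + (\<Sum>i\<in>A. f i t)) x = rl_op a (f i) x + rl_op a (\<lambda>t. \<Sum>i\<in>A. f i t) x"
    using insert.prems by (intro rl_op_add assms(1) causal_sum) (simp_all only: insertI1 insertI2)
  moreover have "AE x in lborel. rl_op a (\<lambda>t. \<Sum>i\<in>A. f i t) x = (\<Sum>i\<in>A. rl_op a (f i) x)"
    using insert by auto
  ultimately show ?case
    by eventually_elim (use insert in simp)
qed

lemma rl_op_kernel_sum:
  assumes "0 \<le> a" "finite A" "\<And>i. i \<in> A \<Longrightarrow> 0 < b i"
  shows "AE x in lborel. rl_op a (\<lambda>t. \<Sum>i\<in>A. c i * rl_kernel (b i) t) x = (\<Sum>i\<in>A. c i * rl_kernel (a + b i) x)"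
proof -
  have "AE x in lborel. rl_op a (\<lambda>t. \<Sum>i\<in>A. c i * rl_kernel (b i) t) x
      = (\<Sum>i\<in>A. rl_op a (\<lambda>t. c i * rl_kernel (b i) t) x)"
    using assms by (intro rl_op_sum causal_cmult causal_rl_kernel) auto
  then show ?thesis
    by eventually_elim (use assms in \<open>simp add: rl_op_cmult rl_op_kernel\<close>)
qed

lemma psum_Suc: "psum \<gamma> (Suc k) = psum \<gamma> k + \<gamma> (Suc k)"
  by (simp add: psum_def)

text \<open>In the induction step the outer primitive in \<open>prim\<close> is moved to the front
  by commuting fractional integrals, and \<open>step\<close> turns the remaining integral of the
  derivative into the previous \<open>H k\<close>. The constant \<open>a j\<close> enters as the
  integral of order \<open>psum \<gamma> j\<close> of the unit step, that is the kernel of order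
  \<open>psum \<gamma> j + 1\<close>, and is integrated once more in each of the
  \<open>k - j\<close> later steps.\<close>

lemma rl_op_iterated_derivative:
  assumes nonneg: "\<And>k. k \<in> {1..n} \<Longrightarrow> 0 \<le> \<gamma> k"
    and H: "\<And>k. k \<le> n \<Longrightarrow> causal (H k)" and \<phi>: "\<And>k. k \<in> {1..n} \<Longrightarrow> causal (\<phi> k)"
    and prim: "\<And>k. k \<in> {1..n} \<Longrightarrow>
      AE x in lborel. H k x = a k * rl_kernel 1 x + rl_op 1 (\<phi> k) x"
    and step: "\<And>k. k \<in> {1..n} \<Longrightarrow> AE x in lborel. H (k - 1) x = rl_op (\<gamma> k) (\<phi> k) x"
    and "k \<le> n"
  shows "AE x in lborel. rl_op (psum \<gamma> k) (H k) x
    = (\<Sum>j=1..k. a j * rl_kernel (psum \<gamma> j + real k - real j + 1) x) + rl_op (real k) (H 0) x"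
  using \<open>k \<le> n\<close>
proof (induction k)
  case 0
  then show ?case by (simp add: psum_def rl_op_def)
next
  case (Suc k)
  let ?s = "psum \<gamma> k" and ?g = "\<gamma> (Suc k)"
  have k: "Suc k \<in> {1..n}" "k \<le> n" using Suc by auto
  have psum_nonneg: "0 \<le> psum \<gamma> j" if "j \<le> n" for j
    unfolding psum_def using nonneg that by (intro sum_nonneg) auto
  have s: "0 \<le> ?s" and g: "0 \<le> ?g" using psum_nonneg nonneg k by auto
  have c: "causal (H (Suc k))" "causal (H k)" "causal (H 0)" "causal (\<phi> (Suc k))"
    using H \<phi> k Suc.prems by auto
  have p: "causal (rl_kernel 1)" by (rule causal_rl_kernel) simp
  have c1: "causal (rl_op 1 (\<phi> (Suc k)))" "causal (rl_op ?g (\<phi> (Suc k)))"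
    "causal (rl_op ?s (\<phi> (Suc k)))"
    using c s g by (auto intro: causal_rl_op)
  have ca: "causal (\<lambda>x. a (Suc k) * rl_kernel 1 x)" by (rule causal_cmult[OF p])
  let ?S = "\<lambda>x. \<Sum>j=1..k. a j * rl_kernel (psum \<gamma> j + real k - real j + 1) x"
  have Spos: "0 < psum \<gamma> j + real k - real j + 1" if "j \<in> {1..k}" for j
    using psum_nonneg[of j] that k by auto
  have cS: "causal ?S" using Spos by (intro causal_sum causal_cmult causal_rl_kernel)
  have "AE x in lborel. rl_op (?s + ?g) (H (Suc k)) x
      = rl_op (?s + ?g) (\<lambda>x. a (Suc k) * rl_kernel 1 x + rl_op 1 (\<phi> (Suc k)) x) x"
    by (rule rl_op_cong_AE[OF prim[OF k(1)] c(1) causal_add[OF ca c1(1)]])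
  moreover have "AE x in lborel. rl_op (?s + ?g) (\<lambda>x. a (Suc k) * rl_kernel 1 x + rl_op 1 (\<phi> (Suc k)) x) x
      = rl_op (?s + ?g) (\<lambda>x. a (Suc k) * rl_kernel 1 x) x + rl_op (?s + ?g) (rl_op 1 (\<phi> (Suc k))) x"
    using s g by (intro rl_op_add ca c1) auto
  moreover have "AE x in lborel. rl_op (?s + ?g) (rl_op 1 (\<phi> (Suc k))) x = rl_op (?s + ?g + 1) (\<phi> (Suc k)) x"
    using s g by (intro rl_op_rl_op c) auto
  moreover have "AE x in lborel. rl_op (1 + ?s) (rl_op ?g (\<phi> (Suc k))) x = rl_op (1 + ?s + ?g) (\<phi> (Suc k)) x"
    using s g by (intro rl_op_rl_op c) auto
  moreover have "AE x in lborel. rl_op (1 + ?s) (H k) x = rl_op (1 + ?s) (rl_op ?g (\<phi> (Suc k))) x"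
    using step[OF k(1)] by (intro rl_op_cong_AE c c1) simp
  moreover have "AE x in lborel. rl_op 1 (rl_op ?s (H k)) x = rl_op (1 + ?s) (H k) x"
    using s by (intro rl_op_rl_op c) auto
  moreover have "AE x in lborel. rl_op 1 (rl_op ?s (H k)) x
      = rl_op 1 (\<lambda>x. ?S x + rl_op (real k) (H 0) x) x"
  proof (rule rl_op_cong_AE[OF Suc.IH[OF k(2)]])
    show "causal (rl_op ?s (H k))" by (rule causal_rl_op[OF s c(2)])
    show "causal (\<lambda>x. ?S x + rl_op (real k) (H 0) x)"
      by (intro causal_add cS causal_rl_op c(3)) simp
  qed
  moreover have "AE x in lborel. rl_op 1 (\<lambda>x. ?S x + rl_op (real k) (H 0) x) x
      = rl_op 1 ?S x + rl_op 1 (rl_op (real k) (H 0)) x"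
    by (intro rl_op_add cS causal_rl_op c) auto
  moreover have "AE x in lborel. rl_op 1 ?S x
      = (\<Sum>j=1..k. a j * rl_kernel (1 + (psum \<gamma> j + real k - real j + 1)) x)"
    using Spos by (intro rl_op_kernel_sum) auto
  moreover have "AE x in lborel. rl_op 1 (rl_op (real k) (H 0)) x = rl_op (1 + real k) (H 0) x"
    by (intro rl_op_rl_op c) auto
  ultimately show ?case
  proof eventually_elim
    case (elim x)
    have *: "?s + ?g + 1 = 1 + ?s + ?g" by simp
    have K: "rl_op (?s + ?g) (\<lambda>x. a (Suc k) * rl_kernel 1 x) x = a (Suc k) * rl_kernel (?s + ?g + 1) x"
      using s g by (simp add: rl_op_cmult rl_op_kernel)
    have 1: "psum \<gamma> j + real (Suc k) - real j + 1 = 1 + (psum \<gamma> j + real k - real j + 1)" for j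
      by simp
    have 2: "1 + (psum \<gamma> (Suc k) + real k - real (Suc k) + 1) = ?s + ?g + 1"
      by (simp add: psum_Suc)
    have sum_eq: "(\<Sum>j=1..Suc k. a j * rl_kernel (psum \<gamma> j + real (Suc k) - real j + 1) x)
        = (\<Sum>j=1..k. a j * rl_kernel (1 + (psum \<gamma> j + real k - real j + 1)) x)
          + a (Suc k) * rl_kernel (?s + ?g + 1) x"
      unfolding 1 sum.cl_ivl_Suc 2 by simp
    have "rl_op (?s + ?g) (H (Suc k)) x = a (Suc k) * rl_kernel (?s + ?g + 1) x
      + ((\<Sum>j=1..k. a j * rl_kernel (1 + (psum \<gamma> j + real k - real j + 1)) x)
         + rl_op (1 + real k) (H 0) x)"
      using elim K unfolding * by simp
    then show ?case
      unfolding sum_eq unfolding psum_Suc of_nat_Suc by (simp only: ac_simps)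
  qed
qed

subsection \<open>Transforming the identity\<close>

text \<open>The absolutely convergent transform, for which Fubini turns convolutions into products,
  as opposed to the improper integral in \<open>laplace\<close>.\<close>

definition has_laplace :: "(real \<Rightarrow> complex) \<Rightarrow> complex \<Rightarrow> complex \<Rightarrow> bool" where
  "has_laplace f z F \<longleftrightarrow> has_bochner_integral lborel (\<lambda>t. exp (- z * of_real t) * f t) F"

lemma has_laplace_rl_op:
  assumes "has_laplace f z F" "0 \<le> a" "Re z > 0"
  shows "has_laplace (rl_op a f) z (z powr (- of_real a) * F)"
proof (cases "a = 0")
  case True
  have "z \<noteq> 0" using assms(3) by auto
  then show ?thesis using True assms(1) by (simp add: rl_op_def)
next
  case False
  then show ?thesis
    using assms laplace_conv[OF laplace_rl_kernel[of a z]] by (simp add: has_laplace_def rl_op_def)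
qed

lemma has_laplace_add:
  "has_laplace f z F \<Longrightarrow> has_laplace g z G \<Longrightarrow> has_laplace (\<lambda>t. f t + g t) z (F + G)"
  unfolding has_laplace_def distrib_left by (rule has_bochner_integral_add)

lemma has_laplace_kernel_sum:
  assumes "\<And>i. i \<in> A \<Longrightarrow> 0 < b i" "Re z > 0"
  shows "has_laplace (\<lambda>t. \<Sum>i\<in>A. c i * rl_kernel (b i) t) z (\<Sum>i\<in>A. c i * z powr (- of_real (b i)))"
  unfolding has_laplace_def sum_distrib_left
proof (rule has_bochner_integral_sum)
  fix i assume i: "i \<in> A"
  have "has_bochner_integral lborel (\<lambda>t. c i * (exp (- z * of_real t) * rl_kernel (b i) t)) (c i * z powr (- of_real (b i)))"
    by (rule has_bochner_integral_mult_right[OF laplace_rl_kernel]) (use assms i in auto)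
  then show "has_bochner_integral lborel (\<lambda>t. exp (- z * of_real t) * (c i * rl_kernel (b i) t)) (c i * z powr (- of_real (b i)))"
    by (simp add: mult.left_commute)
qed

lemma has_laplace_unique:
  assumes "has_laplace f z F" "has_laplace g z G" "AE x in lborel. f x = g x" "causal f" "causal g"
  shows "F = G"
proof -
  have "(LINT t|lborel. exp (- z * of_real t) * f t) = (LINT t|lborel. exp (- z * of_real t) * g t)"
    using assms(3) causalD(1)[OF assms(4)] causalD(1)[OF assms(5)]
    by (intro integral_cong_AE) (auto elim!: eventually_mono)
  then show ?thesis using assms(1,2) by (simp add: has_laplace_def has_bochner_integral_iff)
qed

lemma has_laplace_rep:
  assumes f: "causal_rep f f'" and s0: "0 \<le> s0" "s0 < Re z"
    and ex: "\<And>w. Re w > s0 \<Longrightarrow> laplace_exists f w"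
  shows "has_laplace (rl_op 1 f') z (laplace f z / z)"
proof -
  have c: "causal f'" using f by (simp add: causal_rep_def)
  have cont: "continuous_on UNIV (\<lambda>t. exp (- w * of_real t))" for w :: complex
    by (intro continuous_intros)
  have lim: "(conv (rl_kernel 1) (\<lambda>t. exp (- w * of_real t) * f' t) \<longlongrightarrow> laplace f w) at_top"
    if w: "Re w > s0" for w
  proof -
    have "(\<lambda>X. LINT t:{0..X}|lebesgue. f t * exp (- w * of_real t))
        = conv (rl_kernel 1) (\<lambda>t. exp (- w * of_real t) * f' t)"
      using causal_rep_weighted_integral[OF f cont] by blast
    moreover obtain L where L: "((\<lambda>X. LINT t:{0..X}|lebesgue. f t * exp (- w * of_real t)) \<longlongrightarrow> L) at_top"
      using ex[OF w] by (auto simp: laplace_exists_def)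
    moreover have "laplace f w = L"
      unfolding laplace_def by (rule tendsto_Lim[OF _ L]) simp
    ultimately show ?thesis by simp
  qed
  \<comment> \<open>A real point strictly between \<open>s0\<close> and \<open>Re z\<close>,
    positive because \<open>Re z > s0 \<ge> 0\<close>; convergence there controls the growth of the
    primitive.\<close>
  define s where "s = (s0 + Re z) / 2"
  have s: "s0 < s" "s < Re z" "0 < s" using s0 by (auto simp: s_def)
  show ?thesis
    unfolding has_laplace_def
    using laplace_primitive[OF c s(3,2) lim[of "of_real s"] lim[OF s0(2)]] s(1) by (simp add: rl_op_def)
qed

subsection \<open>The level derivatives\<close>

lemma op_prod_Suc:
  "op_prod T \<gamma> (Suc n) n g = g"
  by (simp add: op_prod_def)

lemma op_prod_step:
  assumes "k \<le> n"
  shows "op_prod T \<gamma> k n g = rl_integral (\<gamma> k) (ac_deriv T (op_prod T \<gamma> (Suc k) n g))"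
  using assms by (simp add: op_prod_def upt_conv_Cons del: upt_Suc)

text \<open>For \<open>x < X\<close> only values on \<open>[0, x]\<close> enter. Measurability
  passes from one integrand to the other because Lebesgue measure is complete.\<close>

lemma rl_integral_cong_AE:
  assumes ae: "AE x in lebesgue. x \<in> {0..X} \<longrightarrow> \<phi> x = \<psi> x"
    and i: "set_integrable lebesgue {0..X} \<phi>"
  shows "AE x in lebesgue. x \<in> {0<..<X} \<longrightarrow> rl_integral b \<phi> x = rl_integral b \<psi> x"
proof (cases "b = 0")
  case True
  then show ?thesis using ae by (auto simp: rl_integral_def elim!: eventually_mono)
next
  case False
  have "rl_integral b \<phi> x = rl_integral b \<psi> x" if x: "x \<in> {0<..<X}" for x
  proof -
    have m: "(\<lambda>t. indicator {0..x} t *\<^sub>R ((x - t) powr (b - 1)) *\<^sub>R \<phi> t) \<in> borel_measurable lebesgue"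
    proof -
      have 1: "(\<lambda>t. indicator {0..X} t *\<^sub>R \<phi> t) \<in> borel_measurable lebesgue"
        using i unfolding set_integrable_def by (rule borel_measurable_integrable)
      have "(\<lambda>t. indicator {0..x} t * ((x - t) powr (b - 1))) \<in> borel_measurable borel"
        by measurable
      then have 2: "(\<lambda>t. indicator {0..x} t * ((x - t) powr (b - 1))) \<in> borel_measurable lebesgue"
        by (simp add: measurable_completion)
      have "(\<lambda>t. indicator {0..x} t *\<^sub>R ((x - t) powr (b - 1)) *\<^sub>R \<phi> t)
          = (\<lambda>t. (indicator {0..x} t * ((x - t) powr (b - 1))) *\<^sub>R (indicator {0..X} t *\<^sub>R \<phi> t))"
        using x by (intro ext) (auto simp: indicator_def)
      then show ?thesis using borel_measurable_scaleR[OF 2 1] by simp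
    qed
    have ae': "AE t in lebesgue. indicator {0..x} t *\<^sub>R ((x - t) powr (b - 1)) *\<^sub>R \<phi> t
        = indicator {0..x} t *\<^sub>R ((x - t) powr (b - 1)) *\<^sub>R \<psi> t"
      using ae by eventually_elim (use x in \<open>auto simp: indicator_def\<close>)
    have m': "(\<lambda>t. indicator {0..x} t *\<^sub>R ((x - t) powr (b - 1)) *\<^sub>R \<psi> t) \<in> borel_measurable lebesgue"
      by (rule borel_measurable_AE[OF m ae'])
    show ?thesis
      using integral_cong_AE[OF m m' ae'] False by (simp add: rl_integral_def set_lebesgue_integral_def)
  qed
  then show ?thesis by simp
qed

lemma AC_space_cong:
  assumes "g \<in> AC_space X" "AE x in lebesgue. x \<in> {0<..<X} \<longrightarrow> g x = g' x"
  shows "g' \<in> AC_space X"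
proof -
  obtain h where h: "abs_cont_on 0 X h" "AE x in lebesgue. x \<in> {0<..<X} \<longrightarrow> g x = h x"
    using assms(1) by (auto simp: AC_space_def ac_rep_def)
  have "AE x in lebesgue. x \<in> {0<..<X} \<longrightarrow> g' x = h x"
    using h(2) assms(2) by eventually_elim simp
  then show ?thesis using h(1) by (auto simp: AC_space_def ac_rep_def)
qed

text \<open>The space uses derivatives on \<open>[0, X]\<close>, the operator those on the
  half-line. From the innermost factor outwards both selections agree almost everywhere, and
  fractional integration preserves this.\<close>

lemma op_prod_half_line:
  assumes AC: "\<And>X i. X > 0 \<Longrightarrow> i \<in> {2..Suc n} \<Longrightarrow> op_prod {0..X} \<gamma> i n g \<in> AC_space X"
    and k: "k \<in> {2..Suc n}"
  shows "X > 0 \<Longrightarrow> AE x in lebesgue. x \<in> {0<..<X} \<longrightarrow> op_prod {0..X} \<gamma> k n g x = op_prod {0..} \<gamma> k n g x"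
    and "X > 0 \<Longrightarrow> op_prod {0..} \<gamma> k n g \<in> AC_space X"
proof -
  have "k \<le> Suc n" using k by simp
  \<comment> \<open>All \<open>X\<close> are treated together, because the half-line derivative is
    under control only once absolute continuity is known on every \<open>[0, X]\<close>.\<close>
  then have *: "2 \<le> k \<longrightarrow> (\<forall>X>0. AE x in lebesgue. x \<in> {0<..<X} \<longrightarrow> op_prod {0..X} \<gamma> k n g x = op_prod {0..} \<gamma> k n g x)"
  proof (induction k rule: inc_induct)
    case base
    then show ?case by (simp add: op_prod_Suc)
  next
    case (step k)
    show ?case
    proof (intro impI allI)
      fix X :: real assume k2: "2 \<le> k" and X: "X > 0"
      let ?G = "op_prod {0..} \<gamma> (Suc k) n g" and ?GX = "\<lambda>X. op_prod {0..X} \<gamma> (Suc k) n g"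
      have AC': "?GX Y \<in> AC_space Y" if "Y > 0" for Y using AC[OF that, of "Suc k"] k2 step.hyps by simp
      have eq: "AE x in lebesgue. x \<in> {0<..<Y} \<longrightarrow> ?GX Y x = ?G x" if "Y > 0" for Y
        using step.IH k2 that by simp
      have G: "?G \<in> AC_space Y" if "Y > 0" for Y by (rule AC_space_cong[OF AC' eq]) (use that in auto)
      have d: "is_ac_deriv X (?GX X) (ac_deriv {0..X} (?GX X))" by (rule ac_deriv_interval[OF AC'[OF X] X])
      have d': "is_ac_deriv X ?G (ac_deriv {0..} ?G)" by (rule ac_deriv_half_line[OF G X])
      have "AE x in lebesgue. x \<in> {0..X} \<longrightarrow> ac_deriv {0..X} (?GX X) x = ac_deriv {0..} ?G x"
        by (rule is_ac_deriv_unique[OF d d' X eq[OF X]])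
      moreover have "set_integrable lebesgue {0..X} (ac_deriv {0..X} (?GX X))"
        using d by (simp add: is_ac_deriv_def)
      ultimately show "AE x in lebesgue. x \<in> {0<..<X} \<longrightarrow> op_prod {0..X} \<gamma> k n g x = op_prod {0..} \<gamma> k n g x"
        using step.hyps by (simp only: op_prod_step[of k n] less_Suc_eq_le) (rule rl_integral_cong_AE)
    qed
  qed
  show 1: "AE x in lebesgue. x \<in> {0<..<X} \<longrightarrow> op_prod {0..X} \<gamma> k n g x = op_prod {0..} \<gamma> k n g x" if "X > 0" for X
    using * k that by simp
  show "op_prod {0..} \<gamma> k n g \<in> AC_space X" if "X > 0"
    by (rule AC_space_cong[OF AC[OF that k] 1[OF that]])
qed

text \<open>The continuous representative of \<open>g\<close> is its value at 0 plus a primitive; on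
  the positive axis the unit step \<open>rl_kernel 1\<close> carries the constant.\<close>

lemma causal_rep_ac_deriv:
  assumes g: "\<And>X. X > 0 \<Longrightarrow> g \<in> AC_space X" and \<phi>: "causal_rep (ac_deriv {0..} g) \<phi>"
  shows "causal_rep g (\<lambda>x. ac_value_0 g * rl_kernel 1 x + rl_op 1 \<phi> x)"
proof -
  have c: "causal \<phi>" using \<phi> by (simp add: causal_rep_def)
  have "causal (\<lambda>x. ac_value_0 g * rl_kernel 1 x + rl_op 1 \<phi> x)"
    using c by (intro causal_add causal_cmult causal_rl_kernel causal_rl_op) auto
  moreover have "AE x in lebesgue. 0 < x \<longrightarrow> g x = ac_value_0 g * rl_kernel 1 x + rl_op 1 \<phi> x"
    unfolding AE_lebesgue_iff
  proof (rule AE_lborel_le)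
    fix Y :: real
    \<comment> \<open>Positive and larger than \<open>Y\<close>, so that every \<open>x\<close> in
      \<open>(0, Y]\<close> lies in the open interval on which \<open>g\<close> and \<open>h\<close>
      are compared.\<close>
    define X where "X = max 1 (Y + 1)"
    have X: "X > 0" by (simp add: X_def)
    obtain h where h: "ac_rep X g h" "\<And>x. x \<in> {0..X} \<Longrightarrow> h x = h 0 + (LINT t:{0..x}|lebesgue. ac_deriv {0..} g t)"
      using ac_deriv_half_line[OF g X] unfolding is_ac_deriv_def by blast
    have h0: "ac_value_0 g = h 0" by (rule ac_value_0_eq[OF h(1) X])
    have "(LINT t:{0..x}|lebesgue. ac_deriv {0..} g t) = rl_op 1 \<phi> x" for x
      using causal_rep_weighted_integral[OF \<phi>, of "\<lambda>_. 1" x] by (simp add: rl_op_def)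
    then have hx: "h x = ac_value_0 g + rl_op 1 \<phi> x" if "x \<in> {0..X}" for x
      using h(2)[OF that] h0 by metis
    have "AE x in lborel. x \<in> {0<..<X} \<longrightarrow> g x = h x"
      using h(1) by (simp add: ac_rep_def AE_lebesgue_iff)
    then show "AE x in lborel. x \<le> Y \<longrightarrow> 0 < x \<longrightarrow> g x = ac_value_0 g * rl_kernel 1 x + rl_op 1 \<phi> x"
    proof eventually_elim
      case (elim x)
      show ?case
      proof (intro impI)
        assume "x \<le> Y" "0 < x"
        then have "x \<in> {0<..<X}" by (auto simp: X_def)
        then show "g x = ac_value_0 g * rl_kernel 1 x + rl_op 1 \<phi> x"
          using elim hx[of x] by (simp add: rl_kernel_def)
      qed
    qed
  qed
  ultimately show ?thesis by (simp add: causal_rep_def)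
qed

theorem mainTheorem2:
  fixes n :: nat and \<alpha> s0 :: real and \<gamma> :: "nat \<Rightarrow> real" and f :: "real \<Rightarrow> complex" and s :: complex
  assumes "n \<ge> 1" and "0 < \<alpha>" and "\<alpha> \<le> 1"
    and "\<And>k. k \<in> {1..n} \<Longrightarrow> \<gamma> k \<ge> 0 \<and> \<alpha> + psum \<gamma> k \<le> real k"
    and "real n - 1 < \<alpha> + psum \<gamma> n"
    and "\<And>k. k \<in> {2..n} \<Longrightarrow> \<gamma> k < 1"
    and "\<And>X. X > 0 \<Longrightarrow> f \<in> nL_space n \<alpha> \<gamma> X"
    and "s0 \<ge> 0"
    and "\<And>z. Re z > s0 \<Longrightarrow> laplace_exists f z"
    and "\<And>z. Re z > s0 \<Longrightarrow> laplace_exists (nL_deriv n \<alpha> \<gamma> f) z"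
    and "Re s > s0"
  shows "laplace (nL_deriv n \<alpha> \<gamma> f) s =
    s powr of_real \<alpha> * laplace f s
    - (\<Sum>k=1..n. ac_value_0 (op_prod {0..} \<gamma> (k + 1) n (rl_integral (real n - \<alpha> - psum \<gamma> n) f))
                  * s powr of_real (real k - psum \<gamma> k - 1))"
proof -
  define \<beta> where "\<beta> = real n - \<alpha> - psum \<gamma> n"
  define g where "g k = op_prod {0..} \<gamma> (Suc k) n (rl_integral \<beta> f)" for k
  define a where "a k = ac_value_0 (g k)" for k
  have nonneg: "0 \<le> \<gamma> k" if "k \<in> {1..n}" for k using assms(4)[OF that] by simp
  have psum_nonneg: "0 \<le> psum \<gamma> k" if "k \<le> n" for k
    unfolding psum_def using nonneg that by (intro sum_nonneg) auto
  have \<beta>: "0 \<le> \<beta>" using assms(4)[of n] assms(1) by (simp add: \<beta>_def)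
  have n\<alpha>: "0 \<le> real n - \<alpha>" using \<beta> psum_nonneg[of n] by (simp add: \<beta>_def)
  have s_pos: "Re s > 0" using assms(8,11) by simp
  then have s_ne: "s \<noteq> 0" by auto

  have int_f: "set_integrable lebesgue {0..X} f" if "X > 0" for X
    using assms(7)[OF that] by (simp add: nL_space_def)
  have AC: "op_prod {0..X} \<gamma> i n (rl_integral \<beta> f) \<in> AC_space X" if "X > 0" "i \<in> {2..Suc n}" for X i
    using assms(7)[OF that(1)] that(2) by (simp add: nL_space_def \<beta>_def)
  \<comment> \<open>The conditions of the space start at index 2, so absolute continuity is
    available for \<open>g 1\<close> to \<open>g n\<close> but not for the level derivative
    \<open>g 0\<close>.\<close>
  have g_AC: "g k \<in> AC_space X" if "k \<in> {1..n}" "X > 0" for k X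
    unfolding g_def using op_prod_half_line(2)[OF AC, of "Suc k"] that by simp
  have g_n: "g n = rl_integral \<beta> f" by (simp add: g_def op_prod_Suc)
  have g_step: "g (k - 1) = rl_integral (\<gamma> k) (ac_deriv {0..} (g k))" if "k \<in> {1..n}" for k
    using that op_prod_step[of k n "{0..}" \<gamma> "rl_integral \<beta> f"] by (simp add: g_def)
  have g_0: "g 0 = nL_deriv n \<alpha> \<gamma> f" by (simp add: g_def nL_deriv_def \<beta>_def)

  obtain f' where f': "causal_rep f f'" by (rule causal_rep_exists[OF int_f])
  then have cf: "causal f'" by (simp add: causal_rep_def)
  have "\<exists>\<phi>. causal_rep (ac_deriv {0..} (g k)) \<phi>" if k: "k \<in> {1..n}" for k
  proof -
    have "set_integrable lebesgue {0..X} (ac_deriv {0..} (g k))" if "X > 0" for X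
      using ac_deriv_half_line[OF g_AC[OF k] that] by (simp add: is_ac_deriv_def)
    from causal_rep_exists[OF this] show ?thesis by blast
  qed
  then have "\<forall>k. \<exists>\<phi>. k \<in> {1..n} \<longrightarrow> causal_rep (ac_deriv {0..} (g k)) \<phi>" by blast
  then obtain \<phi> where \<phi>: "\<And>k. k \<in> {1..n} \<Longrightarrow> causal_rep (ac_deriv {0..} (g k)) (\<phi> k)"
    by metis
  then have c\<phi>: "causal (\<phi> k)" if "k \<in> {1..n}" for k using that by (simp add: causal_rep_def)
  \<comment> \<open>Below the top, \<open>H k\<close> is the fractional integral of the next
    derivative, which makes \<open>step\<close> true by definition; \<open>prim\<close> then says
    that two representatives of the same \<open>g k\<close> agree.\<close>
  define H where "H k = (if k = n then rl_op \<beta> f' else rl_op (\<gamma> (Suc k)) (\<phi> (Suc k)))" for k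
  have H: "causal_rep (g k) (H k)" if "k \<le> n" for k
  proof (cases "k = n")
    case True
    then show ?thesis using causal_rep_rl_integral[OF f' \<beta>] by (simp add: H_def g_n)
  next
    case False
    then have "Suc k \<in> {1..n}" using that by simp
    then show ?thesis
      using causal_rep_rl_integral[OF \<phi> nonneg, of "Suc k" "Suc k"] g_step[of "Suc k"] False by (simp add: H_def)
  qed
  then have cH: "causal (H k)" if "k \<le> n" for k using that by (simp add: causal_rep_def)
  have prim: "AE x in lborel. H k x = a k * rl_kernel 1 x + rl_op 1 (\<phi> k) x" if k: "k \<in> {1..n}" for k
    unfolding a_def
    by (rule causal_rep_unique[OF H causal_rep_ac_deriv[OF g_AC \<phi>]]) (use k in auto)
  have step: "AE x in lborel. H (k - 1) x = rl_op (\<gamma> k) (\<phi> k) x" if "k \<in> {1..n}" for k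
    using that by (auto simp: H_def)

  let ?S = "\<lambda>x. \<Sum>j=1..n. a j * rl_kernel (psum \<gamma> j + real n - real j + 1) x"
  have Spos: "0 < psum \<gamma> j + real n - real j + 1" if "j \<in> {1..n}" for j
    using psum_nonneg[of j] that by auto
  have cS: "causal ?S" using Spos by (intro causal_sum causal_cmult causal_rl_kernel)
  have main: "AE x in lborel. rl_op (psum \<gamma> n) (H n) x = ?S x + rl_op (real n) (H 0) x"
    by (rule rl_op_iterated_derivative[where n = n and k = n and H = H and \<phi> = \<phi> and a = a and \<gamma> = \<gamma>, OF nonneg cH c\<phi> prim step order.refl])
  \<comment> \<open>The orders add up because
    \<open>psum \<gamma> n + \<beta> = n - \<alpha>\<close>.\<close>
  have "AE x in lborel. rl_op (psum \<gamma> n) (H n) x = rl_op (real n - \<alpha>) f' x"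
    using rl_op_rl_op[OF psum_nonneg[OF order.refl] \<beta> cf] by (simp add: H_def \<beta>_def)
  with main have eq: "AE x in lborel. rl_op (real n - \<alpha>) f' x = ?S x + rl_op (real n) (H 0) x"
    by eventually_elim simp
  \<comment> \<open>The extra integration is placed in front and then commuted inwards, so that
    \<open>f'\<close> and \<open>H 0\<close> occur only through \<open>rl_op 1\<close>, whose
    transforms converge absolutely.\<close>
  have "AE x in lborel. rl_op 1 (rl_op (real n - \<alpha>) f') x = rl_op 1 (\<lambda>x. ?S x + rl_op (real n) (H 0) x) x"
  proof (rule rl_op_cong_AE[OF eq])
    show "causal (rl_op (real n - \<alpha>) f')" by (rule causal_rl_op[OF n\<alpha> cf])
    show "causal (\<lambda>x. ?S x + rl_op (real n) (H 0) x)"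
      by (intro causal_add cS causal_rl_op cH) simp_all
  qed
  moreover have "AE x in lborel. rl_op 1 (\<lambda>x. ?S x + rl_op (real n) (H 0) x) x
      = rl_op 1 ?S x + rl_op 1 (rl_op (real n) (H 0)) x"
    by (intro rl_op_add cS causal_rl_op cH) auto
  moreover have "AE x in lborel. rl_op 1 ?S x
      = (\<Sum>j=1..n. a j * rl_kernel (1 + (psum \<gamma> j + real n - real j + 1)) x)"
    using Spos by (intro rl_op_kernel_sum) auto
  moreover have "AE x in lborel. rl_op 1 (rl_op (real n) (H 0)) x = rl_op (1 + real n) (H 0) x"
    by (intro rl_op_rl_op cH) auto
  moreover have "AE x in lborel. rl_op (real n) (rl_op 1 (H 0)) x = rl_op (real n + 1) (H 0) x"
    by (intro rl_op_rl_op cH) auto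
  moreover have "AE x in lborel. rl_op 1 (rl_op (real n - \<alpha>) f') x = rl_op (1 + (real n - \<alpha>)) f' x"
    by (intro rl_op_rl_op cf n\<alpha>) auto
  moreover have "AE x in lborel. rl_op (real n - \<alpha>) (rl_op 1 f') x = rl_op (real n - \<alpha> + 1) f' x"
    by (intro rl_op_rl_op cf n\<alpha>) auto
  ultimately have final: "AE x in lborel. rl_op (real n - \<alpha>) (rl_op 1 f') x
      = (\<Sum>j=1..n. a j * rl_kernel (1 + (psum \<gamma> j + real n - real j + 1)) x) + rl_op (real n) (rl_op 1 (H 0)) x"
    by eventually_elim (simp only: add.commute)

  have lf: "has_laplace (rl_op 1 f') s (laplace f s / s)"
    by (rule has_laplace_rep[OF f' assms(8,11,9)])
  have lH: "has_laplace (rl_op 1 (H 0)) s (laplace (nL_deriv n \<alpha> \<gamma> f) s / s)"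
    using has_laplace_rep[OF _ assms(8,11,10)] H[of 0] by (simp add: g_0)
  have "s powr (- of_real (real n - \<alpha>)) * (laplace f s / s)
    = (\<Sum>j=1..n. a j * s powr (- of_real (1 + (psum \<gamma> j + real n - real j + 1))))
      + s powr (- of_real (real n)) * (laplace (nL_deriv n \<alpha> \<gamma> f) s / s)"
  proof (rule has_laplace_unique[OF _ _ final])
    show "has_laplace (rl_op (real n - \<alpha>) (rl_op 1 f')) s (s powr (- of_real (real n - \<alpha>)) * (laplace f s / s))"
      by (rule has_laplace_rl_op[OF lf n\<alpha> s_pos])
    have "0 < 1 + (psum \<gamma> j + real n - real j + 1)" if "j \<in> {1..n}" for j using Spos[OF that] by simp
    then show "has_laplace (\<lambda>x. (\<Sum>j=1..n. a j * rl_kernel (1 + (psum \<gamma> j + real n - real j + 1)) x)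
        + rl_op (real n) (rl_op 1 (H 0)) x) s
      ((\<Sum>j=1..n. a j * s powr (- of_real (1 + (psum \<gamma> j + real n - real j + 1))))
      + s powr (- of_real (real n)) * (laplace (nL_deriv n \<alpha> \<gamma> f) s / s))"
      by (intro has_laplace_add has_laplace_kernel_sum has_laplace_rl_op lH s_pos) auto
    show "causal (rl_op (real n - \<alpha>) (rl_op 1 f'))" by (intro causal_rl_op n\<alpha> cf) simp
    have "0 < 1 + (psum \<gamma> j + real n - real j + 1)" if "j \<in> {1..n}" for j using Spos[OF that] by simp
    then show "causal (\<lambda>x. (\<Sum>j=1..n. a j * rl_kernel (1 + (psum \<gamma> j + real n - real j + 1)) x)
        + rl_op (real n) (rl_op 1 (H 0)) x)"
      by (intro causal_add causal_sum causal_cmult causal_rl_kernel causal_rl_op cH) auto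
  qed
  \<comment> \<open>The power \<open>n + 1\<close> undoes the \<open>n\<close> integrations in front
    of the level derivative and the extra one.\<close>
  then have "s powr of_real (real n + 1) * (s powr (- of_real (real n - \<alpha>)) * (laplace f s / s))
    = s powr of_real (real n + 1) * ((\<Sum>j=1..n. a j * s powr (- of_real (1 + (psum \<gamma> j + real n - real j + 1))))
      + s powr (- of_real (real n)) * (laplace (nL_deriv n \<alpha> \<gamma> f) s / s))"
    by (simp only:)
  moreover have "s powr of_real (real n + 1) * (s powr (- of_real (real n - \<alpha>)) * (laplace f s / s))
      = s powr of_real \<alpha> * laplace f s"
  proof -
    have e: "complex_of_real (real n + 1) + - of_real (real n - \<alpha>) = of_real \<alpha> + 1" by simp
    have "s powr of_real (real n + 1) * s powr (- of_real (real n - \<alpha>)) = s powr of_real \<alpha> * s powr 1"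
      by (simp only: powr_add[symmetric] e)
    then show ?thesis using s_ne by (simp add: mult.assoc[symmetric])
  qed
  \<comment> \<open>The kernel that belongs to \<open>a j\<close> has order
    \<open>n + 2 + psum \<gamma> j - j\<close>, which leaves the exponent
    \<open>j - psum \<gamma> j - 1\<close>.\<close>
  moreover have "s powr of_real (real n + 1) * (\<Sum>j=1..n. a j * s powr (- of_real (1 + (psum \<gamma> j + real n - real j + 1))))
      = (\<Sum>j=1..n. a j * s powr of_real (real j - psum \<gamma> j - 1))"
    unfolding sum_distrib_left
    by (intro sum.cong refl) (simp add: mult.left_commute powr_add[symmetric] algebra_simps)
  moreover have "s powr of_real (real n + 1) * (s powr (- of_real (real n)) * (laplace (nL_deriv n \<alpha> \<gamma> f) s / s))
      = laplace (nL_deriv n \<alpha> \<gamma> f) s"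
  proof -
    have "s powr of_real (real n + 1) * s powr (- of_real (real n)) = s"
      using s_ne by (simp add: powr_add[symmetric])
    then show ?thesis using s_ne by (simp add: mult.assoc[symmetric])
  qed
  ultimately have "s powr of_real \<alpha> * laplace f s
      = (\<Sum>j=1..n. a j * s powr of_real (real j - psum \<gamma> j - 1)) + laplace (nL_deriv n \<alpha> \<gamma> f) s"
    by (simp only: distrib_left)
  then show ?thesis by (simp add: a_def g_def \<beta>_def)
qed

end
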